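(* For each integer $d\ge d^1_{\min}:=\max\{1,r_1,\dots,r_m\}$, the semidefinite program $(\mathrm{P}_d)$ defined in the context has an optimal solution $(\mathbf{y}^d,\mathbf{v}_1^d,\dots,\mathbf{v}_m^d)$. In addition, $$\lim_{d\to\infty} y^d_\alpha=\int_{\Omega}\mathbf{x}^\alpha\,d\lambda\qquad\forall\alpha\in\mathbb{N}^n,$$ $$\lim_{d\to\infty} v^d_{j,\alpha}=\int_{\Omega_j}\mathbf{x}^\alpha\,d\phi_j\qquad\forall\alpha\in\mathbb{N}^n,\ j=1,\dots,m,$$ where $\lambda$ is the Lebesgue measure. In particular, $y^d_0\downarrow\mathrm{vol}(\Omega)$ as $d\to\infty$.
   Context: Setting. Let $\Omega=\{\mathbf{x}\in\mathbb{R}^n: g_j(\mathbf{x})\le b_j,\ j=1,\dots,m\}$ be compact, where each $g_j\in\mathbb{R}[\mathbf{x}]$ is a homogeneous polynomial of degree $d_j$ and $b_j>0$. Assume $\Omega\subset\mathbf{B}:=(-1,1)^n$. Let $\Omega_j:=\{\mathbf{x}\in\Omega: g_j(\mathbf{x})=b_j\}$, so that $\partial\Omega=\bigcup_{j=1}^m\Omega_j$, and assume $\nabla g_j(\mathbf{x})\ne0$ for all $\mathbf{x}\in\Omega_j$, $j=1,\dots,m$. Let $\sigma$ be the $(n-1)$-dimensional Hausdorff measure on $\partial\Omega$ and $\sigma_j$ its restriction to $\Omega_j$. Assume $\sigma_j(\{\mathbf{x}: g_k(\mathbf{x})=b_k\})=0$ for all $k\ne j$. Define the measure $\phi_j$ on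 $\Omega_j$ by $d\phi_j(\mathbf{x})=d\sigma_j(\mathbf{x})/\|\nabla g_j(\mathbf{x})\|$. Notation. $r_j:=\lceil d_j/2\rceil$. $\mathbb{N}^n_k:=\{\alpha\in\mathbb{N}^n:|\alpha|\le k\}$. For a real (finite or infinite) sequence $\mathbf{y}=(y_\alpha)$, the Riesz functional is $L_{\mathbf{y}}(\sum_\alpha p_\alpha\mathbf{x}^\alpha)=\sum_\alpha p_\alpha y_\alpha$. For $g\in\mathbb{R}[\mathbf{x}]$, the localizing matrix $\mathbf{M}_k(g\,\mathbf{y})$ is the real symmetric matrix indexed by $\mathbb{N}^n_k$ with entries $L_{\mathbf{y}}(g\,\mathbf{x}^{\alpha+\beta})$; the moment matrix is $\mathbf{M}_k(\mathbf{y}):=\mathbf{M}_k(1\,\mathbf{y})$. $\succeq0$ means positive semidefinite, and $A\succeq B$ means $A-B\succeq0$. $\mathbf{y}^{\mathbf{B}}$ is the moment sequence of the Lebesgue measure on $\mathbf{B}$: $y^{\mathbf{B}}_\alpha=\int_{\mathbf{B}}\mathbf{x}^\alpha d\mathbf{x}$. The program $(\mathrm{P}_d)$: over $\mathbf{y}=(y_\alpha)_{\alpha\in\mathbb{N}^n_{2d}}$ and $\mathbf{v}_j=(v_{j,\alpha})_{\alpha\in\mathbb{N}^n_{2d}}$, $j=1,\dots,m$, maximize $y_0$ subject to - $(n+|\alpha|)\,L_{\mathbf{y}}(\mathbf{x}^\alpha)=\sum_{j=1}^m d_j b_j\,L_{\mathbf{v}_j}(\mathbf{x}^\alpha)$ for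 all $|\alpha|\le2d$; - $\mathbf{M}_d(\mathbf{y}^{\mathbf{B}})\succeq\mathbf{M}_d(\mathbf{y})\succeq0$, and $\mathbf{M}_{d-r_j}((b_j-g_j)\,\mathbf{y})\succeq0$ for $j=1,\dots,m$; - $\mathbf{M}_d(\mathbf{v}_j)\succeq0$ and $\mathbf{M}_{d-r_j}((b_j-g_j)\,\mathbf{v}_j)=0$ for $j=1,\dots,m$; - $\mathbf{M}_{d-r_l}((b_l-g_l)\,\mathbf{v}_j)\succeq0$ for all $l\ne j$, $l,j=1,\dots,m$. *)

theory Defs
  imports "HOL-Analysis.Analysis" "HOL-Library.Poly_Mapping"
begin

text \<open>
  The s-dimensional Hausdorff measure for a natural number s, with the normalising factor
  \<open>unit_ball_vol s / 2 ^ s\<close>, so that it is the usual surface measure on s-dimensional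
  surfaces. For s = 0 a nonempty set has size 1 (note \<open>0 ^ 0 = 1\<close>), which gives the
  counting measure. Boundedness of the covering sets is required separately because the library's
  \<open>diameter\<close> is unspecified on unbounded sets.
\<close>

definition hausdorff_size :: "nat \<Rightarrow> 'a::metric_space set \<Rightarrow> ennreal" where
  "hausdorff_size s C =
     (if C = {} then 0 else ennreal (unit_ball_vol (real s) * (diameter C / 2) ^ s))"

definition hausdorff_content :: "nat \<Rightarrow> real \<Rightarrow> 'a::metric_space set \<Rightarrow> ennreal" where
  "hausdorff_content s \<delta> A =
     (INF C \<in> {C :: nat \<Rightarrow> 'a set. (\<forall>i. bounded (C i) \<and> diameter (C i) \<le> \<delta>) \<and> A \<subseteq> (\<Union>i. C i)}.
        suminf (\<lambda>i. hausdorff_size s (C i)))"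

definition hausdorff_outer :: "nat \<Rightarrow> 'a::metric_space set \<Rightarrow> ennreal" where
  "hausdorff_outer s A = (SUP \<delta>\<in>{0<..}. hausdorff_content s \<delta> A)"

definition hausdorff_measure :: "nat \<Rightarrow> 'a::metric_space measure" where
  "hausdorff_measure s = measure_of UNIV (sets borel) (hausdorff_outer s)"

text \<open>
  \<open>measure_of\<close> returns the zero measure when it is not given a measure. The following
  lemmas (the Caratheodory criterion for metric outer measures) show that this does not happen, see
  \<open>emeasure_hausdorff_measure\<close>.
\<close>

lemma hausdorff_content_mono:
  "A \<subseteq> B \<Longrightarrow> hausdorff_content s \<delta> A \<le> hausdorff_content s \<delta> B"
  unfolding hausdorff_content_def by (rule INF_superset_mono) auto

lemma hausdorff_content_antimono:
  "\<delta> \<le> \<epsilon> \<Longrightarrow> hausdorff_content s \<epsilon> A \<le> hausdorff_content s \<delta> A"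
  unfolding hausdorff_content_def by (rule INF_superset_mono) (auto intro: order_trans)

lemma hausdorff_outer_mono: "A \<subseteq> B \<Longrightarrow> hausdorff_outer s A \<le> hausdorff_outer s B"
  unfolding hausdorff_outer_def by (intro SUP_mono' hausdorff_content_mono)

lemma hausdorff_content_le_outer: "0 < \<delta> \<Longrightarrow> hausdorff_content s \<delta> A \<le> hausdorff_outer s A"
  unfolding hausdorff_outer_def by (intro SUP_upper) auto

lemma hausdorff_outer_empty: "hausdorff_outer s {} = 0"
proof -
  have "hausdorff_content s \<delta> ({} :: 'a set) \<le> 0" if "\<delta> > 0" for \<delta>
    unfolding hausdorff_content_def
    by (rule INF_lower2[of "\<lambda>_. {}"]) (use that in \<open>auto simp: hausdorff_size_def\<close>)
  then show ?thesis
    unfolding hausdorff_outer_def by (auto simp: le_zero_eq intro!: antisym SUP_least)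
qed

lemma hausdorff_content_UN:
  fixes A :: "nat \<Rightarrow> 'a::metric_space set"
  shows "hausdorff_content s \<delta> (\<Union>i. A i) \<le> suminf (\<lambda>i. hausdorff_content s \<delta> (A i))"
proof (cases "suminf (\<lambda>i. hausdorff_content s \<delta> (A i)) = top")
  case False
  then have nt: "hausdorff_content s \<delta> (A i) < top" for i
    by (metis ennreal_suminf_lessD less_top)
  show ?thesis
  proof (rule ennreal_le_epsilon)
    fix e :: real assume e: "e > 0"
    have "\<exists>C. (\<forall>k. bounded (C k) \<and> diameter (C k) \<le> \<delta>) \<and> A i \<subseteq> (\<Union>k. C k) \<and>
        suminf (\<lambda>k. hausdorff_size s (C k)) < hausdorff_content s \<delta> (A i) + ennreal (e * (1/2) ^ Suc i)"
      for i
    proof -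
      have "hausdorff_content s \<delta> (A i) < hausdorff_content s \<delta> (A i) + ennreal (e * (1/2) ^ Suc i)"
        using nt[of i] e by (simp add: ennreal_add_left_cancel_less[of _ 0, simplified])
      then show ?thesis
        unfolding hausdorff_content_def[of s \<delta> "A i"] INF_less_iff by auto
    qed
    then obtain C where C: "\<And>i k. bounded (C i k)" "\<And>i k. diameter (C i k) \<le> \<delta>"
        "\<And>i. A i \<subseteq> (\<Union>k. C i k)"
        "\<And>i. suminf (\<lambda>k. hausdorff_size s (C i k)) < hausdorff_content s \<delta> (A i) + ennreal (e * (1/2) ^ Suc i)"
      by metis
    define D where "D n = (case prod_decode n of (i, k) \<Rightarrow> C i k)" for n
    have "hausdorff_content s \<delta> (\<Union>i. A i) \<le> suminf (\<lambda>n. hausdorff_size s (D n))"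
      unfolding hausdorff_content_def
    proof (rule INF_lower, safe)
      fix x i assume "x \<in> A i"
      then obtain k where "x \<in> C i k" using C(3) by blast
      then have "x \<in> D (prod_encode (i, k))" by (simp add: D_def)
      then show "x \<in> (\<Union>n. D n)" by blast
    qed (auto simp: D_def C split: prod.split)
    also have "\<dots> = suminf (\<lambda>n. (\<lambda>(i, k). hausdorff_size s (C i k)) (prod_decode n))"
      by (simp add: D_def case_prod_unfold)
    also have "\<dots> = suminf (\<lambda>i. suminf (\<lambda>k. hausdorff_size s (C i k)))"
      by (rule suminf_ennreal_2dimen) simp
    also have "\<dots> \<le> suminf (\<lambda>i. hausdorff_content s \<delta> (A i) + ennreal (e * (1/2) ^ Suc i))"
      by (intro suminf_le summableI less_imp_le C)
    also have "\<dots> = suminf (\<lambda>i. hausdorff_content s \<delta> (A i)) + suminf (\<lambda>i. ennreal (e * (1/2) ^ Suc i))"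
      by (rule suminf_add[symmetric]) (rule summableI)+
    also have "suminf (\<lambda>i. ennreal (e * (1/2) ^ Suc i)) = ennreal e"
      using sums_mult[OF power_half_series, of e] e
      by (subst suminf_ennreal2) (auto simp: sums_iff)
    finally show "hausdorff_content s \<delta> (\<Union>i. A i) \<le> suminf (\<lambda>i. hausdorff_content s \<delta> (A i)) + ennreal e" .
  qed
qed simp

lemma hausdorff_outer_UN:
  fixes A :: "nat \<Rightarrow> 'a::metric_space set"
  shows "hausdorff_outer s (\<Union>i. A i) \<le> suminf (\<lambda>i. hausdorff_outer s (A i))"
proof -
  have "hausdorff_content s \<delta> (\<Union>i. A i) \<le> suminf (\<lambda>i. hausdorff_outer s (A i))" if "\<delta> > 0" for \<delta>
    using hausdorff_content_UN
    by (rule order_trans) (intro suminf_le summableI hausdorff_content_le_outer that)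
  then show ?thesis
    unfolding hausdorff_outer_def[of s "\<Union>i. A i"] by (auto intro!: SUP_least)
qed

lemma hausdorff_outer_Un: "hausdorff_outer s (A \<union> B) \<le> hausdorff_outer s A + hausdorff_outer s B"
proof -
  have "hausdorff_outer s (A \<union> B) = hausdorff_outer s (\<Union>i. binaryset A B i)"
    by (simp add: UN_binaryset_eq)
  also have "\<dots> \<le> suminf (\<lambda>i. hausdorff_outer s (binaryset A B i))"
    by (rule hausdorff_outer_UN)
  also have "\<dots> = hausdorff_outer s A + hausdorff_outer s B"
    by (rule suminf_binaryset_eq) (rule hausdorff_outer_empty)
  finally show ?thesis .
qed

lemma hausdorff_outer_separated:
  fixes A B :: "'a::metric_space set"
  assumes r: "r > 0" and sep: "\<And>x y. x \<in> A \<Longrightarrow> y \<in> B \<Longrightarrow> r \<le> dist x y"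
  shows "hausdorff_outer s A + hausdorff_outer s B \<le> hausdorff_outer s (A \<union> B)"
proof -
  have small: "hausdorff_content s \<delta> A + hausdorff_content s \<delta> B \<le> hausdorff_content s \<delta> (A \<union> B)"
    if \<delta>: "0 < \<delta>" "\<delta> < r" for \<delta>
    unfolding hausdorff_content_def[of s \<delta> "A \<union> B"]
  proof (rule INF_greatest, safe)
    fix C :: "nat \<Rightarrow> 'a set"
    assume C: "\<forall>i. bounded (C i) \<and> diameter (C i) \<le> \<delta>" and cov: "A \<union> B \<subseteq> (\<Union>i. C i)"
    define D where "D i = (if C i \<inter> A = {} then {} else C i)" for i
    define E where "E i = (if C i \<inter> B = {} then {} else C i)" for i
    have "D i = {} \<or> E i = {}" for i
    proof (rule ccontr)
      assume "\<not> ?thesis"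
      then obtain x y where "x \<in> C i" "x \<in> A" "y \<in> C i" "y \<in> B"
        by (auto simp: D_def E_def split: if_splits)
      then have "r \<le> diameter (C i)"
        using sep diameter_bounded_bound[of "C i" x y] C by (meson order_trans)
      with C \<delta> show False by (meson leD order_trans)
    qed
    then have le: "hausdorff_size s (D i) + hausdorff_size s (E i) \<le> hausdorff_size s (C i)" for i
      by (metis D_def E_def add_0 add.right_neutral hausdorff_size_def order_refl zero_le)
    have "hausdorff_content s \<delta> A \<le> suminf (\<lambda>i. hausdorff_size s (D i))"
      unfolding hausdorff_content_def
      using C cov \<delta> by (intro INF_lower) (fastforce simp: D_def)
    moreover have "hausdorff_content s \<delta> B \<le> suminf (\<lambda>i. hausdorff_size s (E i))"
      unfolding hausdorff_content_def
      using C cov \<delta> by (intro INF_lower) (fastforce simp: E_def)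
    ultimately have "hausdorff_content s \<delta> A + hausdorff_content s \<delta> B
        \<le> suminf (\<lambda>i. hausdorff_size s (D i)) + suminf (\<lambda>i. hausdorff_size s (E i))"
      by (rule add_mono)
    also have "\<dots> = suminf (\<lambda>i. hausdorff_size s (D i) + hausdorff_size s (E i))"
      by (rule suminf_add) (rule summableI)+
    also have "\<dots> \<le> suminf (\<lambda>i. hausdorff_size s (C i))"
      by (intro suminf_le summableI le)
    finally show "hausdorff_content s \<delta> A + hausdorff_content s \<delta> B \<le> suminf (\<lambda>i. hausdorff_size s (C i))" .
  qed
  have two: "hausdorff_content s \<delta> A + hausdorff_content s \<epsilon> B \<le> hausdorff_outer s (A \<union> B)"
    if "0 < \<delta>" "0 < \<epsilon>" for \<delta> \<epsilon>
  proof -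
    define \<eta> where "\<eta> = min (min \<delta> \<epsilon>) (r / 2)"
    have \<eta>: "0 < \<eta>" "\<eta> < r" "\<eta> \<le> \<delta>" "\<eta> \<le> \<epsilon>" using that r by (auto simp: \<eta>_def)
    have "hausdorff_content s \<delta> A + hausdorff_content s \<epsilon> B
        \<le> hausdorff_content s \<eta> A + hausdorff_content s \<eta> B"
      by (intro add_mono hausdorff_content_antimono \<eta>)
    also have "\<dots> \<le> hausdorff_content s \<eta> (A \<union> B)" by (rule small) fact+
    also have "\<dots> \<le> hausdorff_outer s (A \<union> B)" by (rule hausdorff_content_le_outer) fact
    finally show ?thesis .
  qed
  have "hausdorff_content s \<delta> A + hausdorff_outer s B \<le> hausdorff_outer s (A \<union> B)" if "0 < \<delta>" for \<delta>
    unfolding hausdorff_outer_def[of s B]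
    by (subst ennreal_SUP_add_right) (auto intro!: SUP_least two that)
  then show ?thesis
    unfolding hausdorff_outer_def[of s A]
    by (subst ennreal_SUP_add_left[symmetric]) (auto intro!: SUP_least)
qed

lemma hausdorff_outer_closed:
  fixes F T :: "'a::metric_space set"
  assumes F: "closed F"
  shows "hausdorff_outer s (T \<inter> F) + hausdorff_outer s (T - F) \<le> hausdorff_outer s T"
proof (cases "F = {} \<or> hausdorff_outer s T = top")
  case True
  then show ?thesis by (auto simp: hausdorff_outer_empty)
next
  case False
  define h where "h = (hausdorff_outer s :: 'a set \<Rightarrow> ennreal)"
  have ne: "F \<noteq> {}" and fin: "h T < top" using False by (auto simp: h_def less_top)
  define G where "G k = {x \<in> T - F. inverse (real (Suc k)) \<le> infdist x F}" for k
  define R where "R k = G (Suc k) - G k" for k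
  have G_mono: "G k \<subseteq> G l" if "k \<le> l" for k l
    using that by (auto simp: G_def elim!: order_trans[rotated] intro!: le_imp_inverse_le)
  have sepG: "h (T \<inter> F) + h (G k) \<le> h T" for k
  proof -
    have "h (T \<inter> F) + h (G k) \<le> h (T \<inter> F \<union> G k)"
      unfolding h_def
    proof (rule hausdorff_outer_separated)
      show "0 < inverse (real (Suc k))" by simp
      fix x y assume "x \<in> T \<inter> F" "y \<in> G k"
      then show "inverse (real (Suc k)) \<le> dist x y"
        using infdist_le[of x F y] by (auto simp: G_def dist_commute)
    qed
    also have "\<dots> \<le> h T" unfolding h_def by (rule hausdorff_outer_mono) (auto simp: G_def)
    finally show ?thesis .
  qed
  have sepR: "h (R k) + h (G l) \<le> h (R k \<union> G l)" if kl: "l < k" for k l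
    unfolding h_def
  proof (rule hausdorff_outer_separated)
    show "0 < inverse (real (Suc l)) - inverse (real (Suc k))"
      using kl less_imp_inverse_less[of "real (Suc l)" "real (Suc k)"] by simp
    fix x y assume x: "x \<in> R k" and y: "y \<in> G l"
    have "infdist x F < inverse (real (Suc k))" using x by (auto simp: R_def G_def)
    moreover have "inverse (real (Suc l)) \<le> infdist y F" using y by (auto simp: G_def)
    moreover have "infdist y F \<le> infdist x F + dist y x" by (rule infdist_triangle)
    ultimately show "inverse (real (Suc l)) - inverse (real (Suc k)) \<le> dist x y"
      by (simp add: dist_commute)
  qed
  have par: "(\<Sum>i<N. h (R (2 * i + p + 1))) \<le> h (G (2 * N + p))" for N p
  proof (induction N)
    case (Suc N)
    have "(\<Sum>i<Suc N. h (R (2 * i + p + 1))) \<le> h (R (2 * N + p + 1)) + h (G (2 * N + p))"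
      using Suc by (simp add: add.commute add_left_mono)
    also have "\<dots> \<le> h (R (2 * N + p + 1) \<union> G (2 * N + p))" by (rule sepR) simp
    also have "\<dots> \<le> h (G (2 * Suc N + p))"
      using G_mono[of "2 * N + p" "2 * Suc N + p"]
      unfolding h_def by (intro hausdorff_outer_mono) (auto simp: R_def)
    finally show ?case .
  qed simp
  have G_le: "h (G k) \<le> h T" for k
    unfolding h_def by (rule hausdorff_outer_mono) (auto simp: G_def)
  define f where "f k = h (R (Suc k))" for k
  have "sum f {..<2 * N} \<le> h T + h T" for N
  proof -
    have "sum f {..<2 * N} = (\<Sum>i<N. f (2 * i)) + (\<Sum>i<N. f (2 * i + 1))"
      by (induction N) (simp_all add: algebra_simps)
    also have "\<dots> \<le> h T + h T"
      using order_trans[OF par[of 0 N] G_le] order_trans[OF par[of 1 N] G_le]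
      by (intro add_mono) (simp_all add: f_def)
    finally show ?thesis .
  qed
  then have "sum f {..<N} \<le> h T + h T" for N
    by (rule order_trans[rotated, of _ _ "sum f {..<N}"]) (rule sum_mono2[of "{..<2 * N}"]; auto)
  then have "suminf f \<le> h T + h T"
    by (intro suminf_le_const summableI)
  then have f_fin: "suminf f < top" using fin by (simp add: order_le_less_trans)
  have "h (T \<inter> F) + h (T - F) \<le> h T"
  proof (rule ennreal_le_epsilon)
    fix e :: real assume e: "0 < e"
    have "(\<lambda>n. sum f {..<n} + ennreal e) \<longlonglongrightarrow> suminf f + ennreal e"
      by (intro tendsto_intros summable_LIMSEQ summableI)
    moreover have "suminf f < suminf f + ennreal e"
      using f_fin e by (simp add: ennreal_add_left_cancel_less[of _ 0, simplified])
    ultimately have "eventually (\<lambda>n. suminf f < sum f {..<n} + ennreal e) sequentially"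
      by (rule order_tendstoD)
    then obtain n where n: "suminf f < sum f {..<n} + ennreal e"
      by (auto simp: eventually_sequentially)
    have "suminf f = suminf (\<lambda>i. f (i + n)) + sum f {..<n}"
      by (rule suminf_offset) (rule summableI)
    with n have tl: "suminf (\<lambda>i. f (i + n)) \<le> ennreal e"
      by (metis add.commute ennreal_add_left_cancel_less less_imp_le)
    have "T - F \<subseteq> G (Suc n) \<union> (\<Union>i. R (Suc (i + n)))"
    proof
      fix x assume x: "x \<in> T - F"
      then have "0 < infdist x F"
        using F ne in_closed_iff_infdist_zero[of F x] infdist_nonneg[of x F] by auto
      then obtain k where "inverse (real (Suc k)) < infdist x F"
        using reals_Archimedean by blast
      with x have ex: "x \<in> G k" by (simp add: G_def)
      define j where "j = (LEAST j. x \<in> G j)"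
      have j: "x \<in> G j" unfolding j_def using ex by (rule LeastI)
      show "x \<in> G (Suc n) \<union> (\<Union>i. R (Suc (i + n)))"
      proof (cases "j \<le> Suc n")
        case True then show ?thesis using j G_mono by blast
      next
        case False
        define i where "i = j - n - 2"
        have ji: "j = Suc (Suc (i + n))" using False by (simp add: i_def)
        then have "x \<notin> G (Suc (i + n))" using not_less_Least[of "Suc (i + n)" "\<lambda>j. x \<in> G j"]
          by (simp add: j_def)
        with j ji have "x \<in> R (Suc (i + n))" by (simp add: R_def)
        then show ?thesis by blast
      qed
    qed
    then have "h (T - F) \<le> h (G (Suc n) \<union> (\<Union>i. R (Suc (i + n))))"
      unfolding h_def by (rule hausdorff_outer_mono)
    also have "\<dots> \<le> h (G (Suc n)) + h (\<Union>i. R (Suc (i + n)))"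
      unfolding h_def by (rule hausdorff_outer_Un)
    also have "\<dots> \<le> h (G (Suc n)) + suminf (\<lambda>i. f (i + n))"
      unfolding h_def f_def by (intro add_left_mono hausdorff_outer_UN)
    also have "\<dots> \<le> h (G (Suc n)) + ennreal e" by (intro add_left_mono tl)
    finally have "h (T \<inter> F) + h (T - F) \<le> h (T \<inter> F) + h (G (Suc n)) + ennreal e"
      by (simp add: add.assoc add_left_mono)
    also have "\<dots> \<le> h T + ennreal e" by (intro add_right_mono sepG)
    finally show "h (T \<inter> F) + h (T - F) \<le> h T + ennreal e" .
  qed
  then show ?thesis by (simp add: h_def)
qed

lemma measure_space_hausdorff:
  "measure_space UNIV (sets borel) (hausdorff_outer s :: 'a::metric_space set \<Rightarrow> ennreal)"
proof -
  let ?h = "hausdorff_outer s :: 'a set \<Rightarrow> ennreal"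
  let ?L = "lambda_system UNIV (Pow UNIV) ?h"
  interpret P: sigma_algebra "UNIV :: 'a set" "Pow UNIV" by (rule sigma_algebra_Pow)
  have os: "outer_measure_space (Pow UNIV) ?h"
    unfolding outer_measure_space_def positive_def increasing_def countably_subadditive_def
    by (auto simp: hausdorff_outer_empty hausdorff_outer_mono hausdorff_outer_UN)
  have L: "measure_space UNIV ?L ?h"
    by (rule P.caratheodory_lemma[OF os])
  then interpret L: sigma_algebra UNIV ?L by (simp add: measure_space_def)
  have "F \<in> ?L" if "closed F" for F
  proof -
    have "?h (T \<inter> F) + ?h (T - F) = ?h T" for T
      using hausdorff_outer_closed[OF that, of s T] hausdorff_outer_Un[of s "T \<inter> F" "T - F"]
      by (simp add: Int_Diff_Un antisym)
    then show ?thesis unfolding P.lambda_system_eq by blast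
  qed
  then have "sets borel \<subseteq> ?L"
    unfolding borel_eq_closed
    by (subst sets_measure_of, simp) (intro L.sigma_sets_subset subsetI, simp only: mem_Collect_eq)
  then show ?thesis
    using L unfolding measure_space_def positive_def countably_additive_def
    by (auto simp: sets.sigma_algebra_axioms sets.sigma_algebra_axioms[of borel, simplified])
qed

lemma sets_hausdorff_measure [simp, measurable_cong]: "sets (hausdorff_measure s) = sets borel"
  unfolding hausdorff_measure_def using sets.sets_measure_of_eq[of borel] by simp

lemma space_hausdorff_measure [simp]: "space (hausdorff_measure s) = UNIV"
  unfolding hausdorff_measure_def by (simp add: space_measure_of_conv)

lemma emeasure_hausdorff_measure:
  assumes "A \<in> sets borel"
  shows "emeasure (hausdorff_measure s) A = hausdorff_outer s A"
  unfolding hausdorff_measure_def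
  using measure_space_hausdorff[of s] assms
  by (intro emeasure_measure_of_sigma) (auto simp: measure_space_def)

text \<open>
  The variables are indexed by a finite type \<open>'n\<close>, so n = \<open>CARD('n)\<close>;
  the product of the ring \<open>'n rpoly\<close> is polynomial multiplication.
\<close>

type_synonym 'n multiindex = "'n \<Rightarrow>\<^sub>0 nat"
type_synonym 'n rpoly = "'n multiindex \<Rightarrow>\<^sub>0 real"

definition total_deg :: "'n::finite multiindex \<Rightarrow> nat" where
  "total_deg \<alpha> = (\<Sum>i\<in>UNIV. Poly_Mapping.lookup \<alpha> i)"

definition multiindices :: "nat \<Rightarrow> 'n::finite multiindex set" where
  "multiindices k = {\<alpha>. total_deg \<alpha> \<le> k}"

definition monom_eval :: "'n::finite multiindex \<Rightarrow> real ^ 'n \<Rightarrow> real" where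
  "monom_eval \<alpha> x = (\<Prod>i\<in>UNIV. (x $ i) ^ Poly_Mapping.lookup \<alpha> i)"

definition peval :: "'n::finite rpoly \<Rightarrow> real ^ 'n \<Rightarrow> real" where
  "peval p x = (\<Sum>\<alpha>\<in>Poly_Mapping.keys p. Poly_Mapping.lookup p \<alpha> * monom_eval \<alpha> x)"

abbreviation pconst :: "real \<Rightarrow> 'n rpoly" where
  "pconst c \<equiv> Poly_Mapping.single 0 c"

abbreviation pmonom :: "'n multiindex \<Rightarrow> 'n rpoly" where
  "pmonom \<alpha> \<equiv> Poly_Mapping.single \<alpha> 1"

text \<open>As usual, the zero polynomial counts as homogeneous of every degree.\<close>

definition homogeneous :: "nat \<Rightarrow> 'n::finite rpoly \<Rightarrow> bool" where
  "homogeneous k p \<longleftrightarrow> (\<forall>\<alpha>\<in>Poly_Mapping.keys p. total_deg \<alpha> = k)"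

definition gradient :: "('a::real_inner \<Rightarrow> real) \<Rightarrow> 'a \<Rightarrow> 'a" where
  "gradient f x = (THE D. GDERIV f x :> D)"

definition open_box :: "(real ^ 'n) set" where
  "open_box = {x. \<forall>i. -1 < x $ i \<and> x $ i < 1}"

definition Omega :: "nat \<Rightarrow> (nat \<Rightarrow> 'n::finite rpoly) \<Rightarrow> (nat \<Rightarrow> real) \<Rightarrow> (real ^ 'n) set" where
  "Omega m g b = {x. \<forall>j\<in>{1..m}. peval (g j) x \<le> b j}"

definition Omega_face ::
    "nat \<Rightarrow> (nat \<Rightarrow> 'n::finite rpoly) \<Rightarrow> (nat \<Rightarrow> real) \<Rightarrow> nat \<Rightarrow> (real ^ 'n) set" where
  "Omega_face m g b j = {x \<in> Omega m g b. peval (g j) x = b j}"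

definition surface_measure ::
    "nat \<Rightarrow> (nat \<Rightarrow> 'n::finite rpoly) \<Rightarrow> (nat \<Rightarrow> real) \<Rightarrow> (real ^ 'n) measure" where
  "surface_measure m g b =
     restrict_space (hausdorff_measure (CARD('n) - 1)) (frontier (Omega m g b))"

definition face_measure ::
    "nat \<Rightarrow> (nat \<Rightarrow> 'n::finite rpoly) \<Rightarrow> (nat \<Rightarrow> real) \<Rightarrow> nat \<Rightarrow> (real ^ 'n) measure" where
  "face_measure m g b j = restrict_space (surface_measure m g b) (Omega_face m g b j)"

definition phi_measure ::
    "nat \<Rightarrow> (nat \<Rightarrow> 'n::finite rpoly) \<Rightarrow> (nat \<Rightarrow> real) \<Rightarrow> nat \<Rightarrow> (real ^ 'n) measure" where
  "phi_measure m g b j =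
     density (face_measure m g b j) (\<lambda>x. ennreal (1 / norm (gradient (peval (g j)) x)))"

definition riesz :: "('n multiindex \<Rightarrow> real) \<Rightarrow> 'n rpoly \<Rightarrow> real" where
  "riesz y p = (\<Sum>\<alpha>\<in>Poly_Mapping.keys p. Poly_Mapping.lookup p \<alpha> * y \<alpha>)"

text \<open>
  Matrices are functions of two multi-indices. The entry does not depend on the order k of the
  matrix \<open>M\<^sub>k\<close>, which only enters through the index set \<open>multiindices k\<close>.
\<close>

definition localizing_matrix ::
    "'n rpoly \<Rightarrow> ('n multiindex \<Rightarrow> real) \<Rightarrow> 'n multiindex \<Rightarrow> 'n multiindex \<Rightarrow> real" where
  "localizing_matrix g y \<alpha> \<beta> = riesz y (g * pmonom (\<alpha> + \<beta>))"

definition moment_matrix ::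
    "('n multiindex \<Rightarrow> real) \<Rightarrow> 'n multiindex \<Rightarrow> 'n multiindex \<Rightarrow> real" where
  "moment_matrix y = localizing_matrix 1 y"

definition psd_on :: "'i set \<Rightarrow> ('i \<Rightarrow> 'i \<Rightarrow> real) \<Rightarrow> bool" where
  "psd_on I A \<longleftrightarrow> (\<forall>i\<in>I. \<forall>j\<in>I. A i j = A j i) \<and>
     (\<forall>c. 0 \<le> (\<Sum>i\<in>I. \<Sum>j\<in>I. c i * A i j * c j))"

definition loewner_le_on :: "'i set \<Rightarrow> ('i \<Rightarrow> 'i \<Rightarrow> real) \<Rightarrow> ('i \<Rightarrow> 'i \<Rightarrow> real) \<Rightarrow> bool" where
  "loewner_le_on I A B \<longleftrightarrow> psd_on I (\<lambda>i j. B i j - A i j)"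

definition zero_on :: "'i set \<Rightarrow> ('i \<Rightarrow> 'i \<Rightarrow> real) \<Rightarrow> bool" where
  "zero_on I A \<longleftrightarrow> (\<forall>i\<in>I. \<forall>j\<in>I. A i j = 0)"

definition box_moments :: "'n::finite multiindex \<Rightarrow> real" where
  "box_moments \<alpha> = (LINT x:open_box|lebesgue. monom_eval \<alpha> x)"

definition half_deg :: "nat \<Rightarrow> nat" where
  "half_deg k = nat \<lceil>real k / 2\<rceil>"

definition d_min :: "nat \<Rightarrow> (nat \<Rightarrow> nat) \<Rightarrow> nat" where
  "d_min m dg = Max (insert 1 ((\<lambda>j. half_deg (dg j)) ` {1..m}))"

text \<open>
  A sequence indexed by the multi-indices of total degree at most 2d is an extensional function
  (arbitrary but fixed outside its domain). All entries that occur below have index of total degree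
  at most 2d, because \<open>2 * (d - half_deg (dg j)) + dg j \<le> 2 * d\<close>.
\<close>

definition feasible ::
    "nat \<Rightarrow> (nat \<Rightarrow> 'n::finite rpoly) \<Rightarrow> (nat \<Rightarrow> nat) \<Rightarrow> (nat \<Rightarrow> real) \<Rightarrow> nat \<Rightarrow>
      ('n multiindex \<Rightarrow> real) \<Rightarrow> (nat \<Rightarrow> 'n multiindex \<Rightarrow> real) \<Rightarrow> bool" where
  "feasible m g dg b d y v \<longleftrightarrow>
     y \<in> multiindices (2 * d) \<rightarrow>\<^sub>E UNIV \<and>
     v \<in> {1..m} \<rightarrow>\<^sub>E (multiindices (2 * d) \<rightarrow>\<^sub>E UNIV) \<and>
     (\<forall>\<alpha>\<in>multiindices (2 * d).
        real (CARD('n) + total_deg \<alpha>) * riesz y (pmonom \<alpha>) =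
        (\<Sum>j=1..m. real (dg j) * b j * riesz (v j) (pmonom \<alpha>))) \<and>
     loewner_le_on (multiindices d) (moment_matrix y) (moment_matrix box_moments) \<and>
     psd_on (multiindices d) (moment_matrix y) \<and>
     (\<forall>j\<in>{1..m}. psd_on (multiindices (d - half_deg (dg j)))
        (localizing_matrix (pconst (b j) - g j) y)) \<and>
     (\<forall>j\<in>{1..m}. psd_on (multiindices d) (moment_matrix (v j))) \<and>
     (\<forall>j\<in>{1..m}. zero_on (multiindices (d - half_deg (dg j)))
        (localizing_matrix (pconst (b j) - g j) (v j))) \<and>
     (\<forall>j\<in>{1..m}. \<forall>l\<in>{1..m}. l \<noteq> j \<longrightarrow>
        psd_on (multiindices (d - half_deg (dg l)))
          (localizing_matrix (pconst (b l) - g l) (v j)))"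

definition optimal ::
    "nat \<Rightarrow> (nat \<Rightarrow> 'n::finite rpoly) \<Rightarrow> (nat \<Rightarrow> nat) \<Rightarrow> (nat \<Rightarrow> real) \<Rightarrow> nat \<Rightarrow>
      ('n multiindex \<Rightarrow> real) \<Rightarrow> (nat \<Rightarrow> 'n multiindex \<Rightarrow> real) \<Rightarrow> bool" where
  "optimal m g dg b d y v \<longleftrightarrow>
     feasible m g dg b d y v \<and>
     (\<forall>y' v'. feasible m g dg b d y' v' \<longrightarrow> y' 0 \<le> y 0)"

end

theory Submission
  imports Defs
begin

text \<open>
  Feasibility of the true moments amounts to the divergence identity
  \<open>(n + |\<alpha>|) \<integral>\<^sub>\<Omega> x\<^sup>\<alpha> = \<Sum>\<^sub>j d\<^sub>j b\<^sub>j \<integral> x\<^sup>\<alpha> d\<phi>\<^sub>j\<close>. As the \<open>g\<^sub>j\<close> are homogeneous,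
  \<open>\<Omega>\<close> is the union of the cones over its faces, which overlap in null sets, so that it suffices to
  know that the volume of the cone over a piece of a face is \<open>d\<^sub>j b\<^sub>j / n\<close> times its \<open>\<phi>\<^sub>j\<close>-measure.
  For pieces of a hyperplane this is the volume of a pyramid, because Hausdorff measure is Lebesgue
  measure on a hyperplane (isodiametric inequality and Vitali covering); in general the radial
  projection to the tangent hyperplane is locally almost an isometry.

  Optimal solutions are bounded entrywise, hence have cluster points, and these satisfy the
  constraints for every d. The Riesz functional of a cluster point y is positive and dominated by
  Lebesgue measure on the box, and the constraints confine it to \<open>\<Omega>\<close>; so it is at most integration
  over \<open>\<Omega>\<close>, while its mass is at least the volume of \<open>\<Omega>\<close>. For the \<open>v\<^sub>j\<close>, the functional
  \<open>d\<^sub>j b\<^sub>j v\<^sub>j\<close> is dominated by \<open>\<Sum>\<^sub>k d\<^sub>k b\<^sub>k \<phi>\<^sub>k\<close> and concentrated on \<open>g\<^sub>j = b\<^sub>j\<close>, where only \<open>\<phi>\<^sub>j\<close>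
  has mass; so it is at most \<open>d\<^sub>j b\<^sub>j \<phi>\<^sub>j\<close>, and the sums over j agree. Uniqueness of the cluster
  point gives convergence.
\<close>

section \<open>Hausdorff measure and Lebesgue measure on coordinate subspaces\<close>

text \<open>A ray from the origin meets a level set \<open>g j = b j\<close> with
  \<open>b j > 0\<close> and positive degree at most once. Because of this radial picture, faces may
  meet in corners as long as their overlaps are null. The factor \<open>n + |\<alpha>|\<close>
  arises because the part of a cone below radial height t has \<open>t^n\<close> times the volume of
  the cone; integrating the layers of a homogeneous function of degree k over t turns the factor n
  of the volume formula into n + k. The comparison with tangent hyperplanes loses powers of L > 1 on
  pieces whose size depends on L; compactness leaves finitely many pieces, both sides are additive,
  and L tends to 1 at the end. For the functionals the obstacle is that the matrix inequalities
  speak only about squares. Domination by a finite measure makes such a functional continuous in the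
  uniform norm on the cube. There a nonnegative continuous function is a uniform limit of squares of
  polynomials, so positivity and domination extend to all polynomials that are nonnegative on the
  cube. The mass is bounded below by the volume because the true moments are feasible for every
  d.\<close>

lemma ennreal_cmult_le_iff_inverse:
  assumes "c > 0" shows "x \<le> ennreal c * y \<longleftrightarrow> ennreal (1 / c) * x \<le> y"
proof
  assume "x \<le> ennreal c * y"
  then have "ennreal (1/c) * x \<le> ennreal (1/c) * (ennreal c * y)" by (rule mult_left_mono) simp
  also have "\<dots> = y" using assms by (simp add: mult.assoc[symmetric] ennreal_mult[symmetric])
  finally show "ennreal (1 / c) * x \<le> y" .
next
  assume "ennreal (1/c) * x \<le> y"
  then have "ennreal c * (ennreal (1/c) * x) \<le> ennreal c * y" by (rule mult_left_mono) simp
  then show "x \<le> ennreal c * y"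
    using assms by (simp add: mult.assoc[symmetric] ennreal_mult[symmetric])
qed

section \<open>Hausdorff measure of Lipschitz images\<close>

lemma diameter_lipschitz_image:
  fixes f :: "'a::metric_space \<Rightarrow> 'b::metric_space"
  assumes A: "bounded A" "A \<noteq> {}" and f: "\<And>x y. x \<in> A \<Longrightarrow> y \<in> A \<Longrightarrow> dist (f x) (f y) \<le> L * dist x y"
    and L: "L \<ge> 0"
  shows "bounded (f ` A)" "diameter (f ` A) \<le> L * diameter A"
proof -
  have d: "dist (f x) (f y) \<le> L * diameter A" if "x \<in> A" "y \<in> A" for x y
    using f[OF that] mult_left_mono[OF diameter_bounded_bound[OF A(1) that] L] by linarith
  then show "diameter (f ` A) \<le> L * diameter A"
    unfolding diameter_def using A(2) by (auto intro!: cSUP_least)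
  obtain a where "a \<in> A" using A by auto
  with d show "bounded (f ` A)" unfolding bounded_def by blast
qed

lemma hausdorff_size_image:
  fixes f :: "'a::metric_space \<Rightarrow> 'b::metric_space"
  assumes C: "bounded C" and f: "\<And>x y. x \<in> C \<Longrightarrow> y \<in> C \<Longrightarrow> dist (f x) (f y) \<le> L * dist x y"
    and L: "L \<ge> 0"
  shows "hausdorff_size s (f ` C) \<le> ennreal (L ^ s) * hausdorff_size s C"
proof (cases "C = {}")
  case False
  have "(diameter (f ` C) / 2) ^ s \<le> (L * (diameter C / 2)) ^ s"
    using diameter_lipschitz_image[OF C False f L] diameter_ge_0[of "f ` C"]
    by (intro power_mono) auto
  then have "unit_ball_vol (real s) * (diameter (f ` C) / 2) ^ s
      \<le> L ^ s * (unit_ball_vol (real s) * (diameter C / 2) ^ s)"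
    unfolding power_mult_distrib mult.left_commute[of "L ^ s"] by (rule mult_left_mono) simp
  then show ?thesis
    using False L diameter_ge_0[OF C]
    by (simp add: hausdorff_size_def ennreal_mult[symmetric] ennreal_leI)
qed (simp add: hausdorff_size_def)

lemma hausdorff_size_mono:
  assumes "A \<subseteq> B" "bounded B" shows "hausdorff_size s A \<le> hausdorff_size s B"
proof -
  have "bounded A" using assms bounded_subset by blast
  then show ?thesis
    using assms diameter_subset[OF assms] diameter_ge_0[of A]
    by (auto simp: hausdorff_size_def intro!: ennreal_leI mult_left_mono power_mono)
qed

text \<open>The set covers itself, and the sequence is padded with empty sets. The padding is free
  even for s = 0, since \<open>hausdorff_size\<close> gives the empty set the value 0 in every
  dimension.\<close>

lemma hausdorff_content_le_size:
  assumes "bounded C" "diameter C \<le> \<delta>" "\<delta> > 0"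
  shows "hausdorff_content s \<delta> C \<le> hausdorff_size s C"
proof -
  have "hausdorff_content s \<delta> C \<le> suminf (\<lambda>i. hausdorff_size s (if i = 0 then C else {}))"
    unfolding hausdorff_content_def using assms
    by (intro INF_lower) (auto split: if_splits)
  also have "\<dots> = (\<Sum>i\<in>{0::nat}. hausdorff_size s (if i = 0 then C else {}))"
    by (rule suminf_finite) (simp_all add: hausdorff_size_def)
  finally show ?thesis by simp
qed

lemma hausdorff_outer_lipschitz_image:
  fixes f :: "'a::metric_space \<Rightarrow> 'b::metric_space"
  assumes f: "\<And>x y. x \<in> A \<Longrightarrow> y \<in> A \<Longrightarrow> dist (f x) (f y) \<le> L * dist x y" and L: "L > 0"
  shows "hausdorff_outer s (f ` A) \<le> ennreal (L ^ s) * hausdorff_outer s A"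
  unfolding hausdorff_outer_def[of s "f ` A"]
proof (rule SUP_least)
  fix \<delta> :: real assume "\<delta> \<in> {0<..}"
  then have \<delta>: "\<delta> / L > 0" using L by simp
  have Ls: "L ^ s > 0" using L by simp
  \<comment> \<open>The constant is moved to the other side so that the infimum over coverings
    stands alone and can be bounded below covering by covering.\<close>
  have "ennreal (1 / L ^ s) * hausdorff_content s \<delta> (f ` A) \<le> hausdorff_content s (\<delta> / L) A"
    unfolding hausdorff_content_def[of s "\<delta> / L"]
  proof (rule INF_greatest, safe)
    fix C :: "nat \<Rightarrow> 'a set"
    assume C: "\<forall>i. bounded (C i) \<and> diameter (C i) \<le> \<delta> / L" and cov: "A \<subseteq> (\<Union>i. C i)"
    \<comment> \<open>The Lipschitz bound holds on A only, so the covering sets are cut down to A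
      before they are mapped.\<close>
    define D where "D i = f ` (C i \<inter> A)" for i
    have bd: "bounded (C i \<inter> A)" for i using C bounded_Int by blast
    have D: "bounded (D i) \<and> diameter (D i) \<le> \<delta>" for i
    proof (cases "C i \<inter> A = {}")
      case True
      then show ?thesis using \<delta> L by (simp add: D_def zero_less_divide_iff)
    next
      case False
      have "diameter (D i) \<le> L * diameter (C i \<inter> A)"
        unfolding D_def using f L by (intro diameter_lipschitz_image bd False) auto
      also have "\<dots> \<le> L * (\<delta> / L)"
        using C L diameter_subset[of "C i \<inter> A" "C i"]
        by (intro mult_left_mono) (auto intro: order_trans)
      finally have "diameter (D i) \<le> \<delta>" using L by simp
      moreover have "bounded (D i)"
        unfolding D_def using f L by (intro diameter_lipschitz_image[where L=L] bd False) auto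
      ultimately show ?thesis by simp
    qed
    have "hausdorff_content s \<delta> (f ` A) \<le> suminf (\<lambda>i. hausdorff_size s (D i))"
      unfolding hausdorff_content_def
    proof (rule INF_lower, safe)
      fix x assume "x \<in> A"
      moreover obtain i where "x \<in> C i" using cov \<open>x \<in> A\<close> by blast
      ultimately show "f x \<in> (\<Union>i. D i)" unfolding D_def by blast
    qed (use D in auto)
    also have "\<dots> \<le> suminf (\<lambda>i. ennreal (L ^ s) * hausdorff_size s (C i))"
    proof (intro suminf_le summableI)
      fix i
      have "hausdorff_size s (D i) \<le> ennreal (L ^ s) * hausdorff_size s (C i \<inter> A)"
        unfolding D_def using f L by (intro hausdorff_size_image bd) auto
      also have "\<dots> \<le> ennreal (L ^ s) * hausdorff_size s (C i)"
        using C by (intro mult_left_mono hausdorff_size_mono) auto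
      finally show "hausdorff_size s (D i) \<le> ennreal (L ^ s) * hausdorff_size s (C i)" .
    qed
    also have "\<dots> = ennreal (L ^ s) * suminf (\<lambda>i. hausdorff_size s (C i))"
      by simp
    finally show "ennreal (1 / L ^ s) * hausdorff_content s \<delta> (f ` A) \<le> suminf (\<lambda>i. hausdorff_size s (C i))"
      using ennreal_cmult_le_iff_inverse[OF Ls] by blast
  qed
  then have "hausdorff_content s \<delta> (f ` A) \<le> ennreal (L ^ s) * hausdorff_content s (\<delta> / L) A"
    using ennreal_cmult_le_iff_inverse[OF Ls] by blast
  also have "\<dots> \<le> ennreal (L ^ s) * hausdorff_outer s A"
    using \<delta> by (intro mult_left_mono hausdorff_content_le_outer) auto
  finally show "hausdorff_content s \<delta> (f ` A) \<le> ennreal (L ^ s) * hausdorff_outer s A" .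
qed

section \<open>Lebesgue measure on coordinate subspaces\<close>

text \<open>Lebesgue measure on the span of the basis vectors in I, as a Borel measure on the whole
  space that is concentrated on \<open>coord_span I\<close>. Staying in the ambient type allows
  induction on I and covers hyperplanes and the full space by the same statements.\<close>

definition coord_lborel :: "'a::euclidean_space set \<Rightarrow> 'a measure" where
  "coord_lborel I = distr (Pi\<^sub>M I (\<lambda>_. lborel)) borel (\<lambda>f. \<Sum>i\<in>I. f i *\<^sub>R i)"

definition coord_span :: "'a::euclidean_space set \<Rightarrow> 'a set" where
  "coord_span I = {x. \<forall>i\<in>Basis - I. x \<bullet> i = 0}"

lemma sets_coord_lborel [simp, measurable_cong]: "sets (coord_lborel I) = sets borel"
  by (simp add: coord_lborel_def)

lemma space_coord_lborel [simp]: "space (coord_lborel I) = UNIV"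
  by (simp add: coord_lborel_def)

lemma coord_lborel_Basis: "coord_lborel Basis = lborel"
  unfolding coord_lborel_def lborel_def[where 'a='a] lborel_eq_real ..

interpretation lborel_product: product_sigma_finite "\<lambda>_::'i. lborel :: real measure"
  by standard

lemma measurable_coord_sum [measurable]:
  fixes I :: "'a::euclidean_space set"
  shows "(\<lambda>f. \<Sum>i\<in>I. f i *\<^sub>R i) \<in> Pi\<^sub>M I (\<lambda>_. lborel) \<rightarrow>\<^sub>M borel"
  by measurable

lemma nn_integral_coord_lborel_insert:
  fixes f :: "'a::euclidean_space \<Rightarrow> ennreal"
  assumes I: "insert i I \<subseteq> Basis" "i \<notin> I" and f [measurable]: "f \<in> borel_measurable borel"
  shows "integral\<^sup>N (coord_lborel (insert i I)) f = (\<integral>\<^sup>+x. \<integral>\<^sup>+t. f (x + t *\<^sub>R i) \<partial>lborel \<partial>coord_lborel I)" (is ?a)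
    and "integral\<^sup>N (coord_lborel (insert i I)) f = (\<integral>\<^sup>+t. \<integral>\<^sup>+x. f (x + t *\<^sub>R i) \<partial>coord_lborel I \<partial>lborel)" (is ?b)
proof -
  have fin: "finite I" using I finite_subset[OF _ finite_Basis] by auto
  have s: "(\<Sum>j\<in>insert i I. (x(i := t)) j *\<^sub>R j) = (\<Sum>j\<in>I. x j *\<^sub>R j) + t *\<^sub>R i" for x :: "'a \<Rightarrow> real" and t
  proof -
    have "(\<Sum>j\<in>insert i I. (x(i := t)) j *\<^sub>R j) = t *\<^sub>R i + (\<Sum>j\<in>I. (x(i := t)) j *\<^sub>R j)"
      using fin I by simp
    also have "(\<Sum>j\<in>I. (x(i := t)) j *\<^sub>R j) = (\<Sum>j\<in>I. x j *\<^sub>R j)"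
      using I by (intro sum.cong) auto
    finally show ?thesis by simp
  qed
  interpret PI: sigma_finite_measure "Pi\<^sub>M I (\<lambda>_. lborel :: real measure)"
    by (rule lborel_product.sigma_finite[OF fin])
  have e: "integral\<^sup>N (coord_lborel (insert i I)) f
      = integral\<^sup>N (Pi\<^sub>M (insert i I) (\<lambda>_. lborel)) (\<lambda>x. f (\<Sum>j\<in>insert i I. x j *\<^sub>R j))"
    unfolding coord_lborel_def by (subst nn_integral_distr) auto
  show ?a
    unfolding e
    by (subst lborel_product.product_nn_integral_insert)
      (use fin I in \<open>auto simp del: sum.insert fun_upd_apply simp add: s coord_lborel_def nn_integral_distr\<close>)
  show ?b
    unfolding e
    by (subst lborel_product.product_nn_integral_insert_rev)
      (use fin I in \<open>auto simp del: sum.insert fun_upd_apply simp add: s coord_lborel_def nn_integral_distr intro!: nn_integral_cong\<close>)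
qed

text \<open>Fubini in both orders: sections by lines parallel to i serve translations and
  symmetrization, slices perpendicular to i serve the volume of cones.\<close>

lemma emeasure_coord_lborel_insert:
  fixes A :: "'a::euclidean_space set"
  assumes I: "insert i I \<subseteq> Basis" "i \<notin> I" and A [measurable]: "A \<in> sets borel"
  shows "emeasure (coord_lborel (insert i I)) A = (\<integral>\<^sup>+x. emeasure lborel {t. x + t *\<^sub>R i \<in> A} \<partial>coord_lborel I)" (is ?a)
    and "emeasure (coord_lborel (insert i I)) A = (\<integral>\<^sup>+t. emeasure (coord_lborel I) {x. x + t *\<^sub>R i \<in> A} \<partial>lborel)" (is ?b)
proof -
  have e: "emeasure (coord_lborel (insert i I)) A = integral\<^sup>N (coord_lborel (insert i I)) (indicator A)"
    by simp
  have 1: "(\<integral>\<^sup>+t. indicator A (x + t *\<^sub>R i) \<partial>lborel) = emeasure lborel {t. x + t *\<^sub>R i \<in> A}" for x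
    by (subst nn_integral_indicator[symmetric]) (measurable, auto intro!: nn_integral_cong simp: indicator_def simp del: nn_integral_indicator)
  have 2: "(\<integral>\<^sup>+x. indicator A (x + t *\<^sub>R i) \<partial>coord_lborel I) = emeasure (coord_lborel I) {x. x + t *\<^sub>R i \<in> A}" for t
    by (subst nn_integral_indicator[symmetric]) (measurable, auto intro!: nn_integral_cong simp: indicator_def simp del: nn_integral_indicator)
  show ?a unfolding e by (subst nn_integral_coord_lborel_insert(1)[OF I]) (auto simp: 1)
  show ?b unfolding e by (subst nn_integral_coord_lborel_insert(2)[OF I]) (auto simp: 2)
qed

lemma coord_span_closed: "closed (coord_span I)"
proof -
  have "coord_span I = (\<Inter>i\<in>Basis - I. {x. x \<bullet> i = 0})" by (auto simp: coord_span_def)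
  then show ?thesis by (auto intro!: closed_Collect_eq continuous_intros)
qed

lemma coord_sum_in_span: "I \<subseteq> Basis \<Longrightarrow> (\<Sum>i\<in>I. f i *\<^sub>R i) \<in> coord_span I"
  by (auto simp: coord_span_def inner_sum_left inner_Basis subset_iff intro!: sum.neutral)

lemma emeasure_coord_lborel_Int_span:
  assumes "I \<subseteq> Basis" "A \<in> sets borel"
  shows "emeasure (coord_lborel I) (A \<inter> coord_span I) = emeasure (coord_lborel I) A"
proof -
  have "A \<inter> coord_span I \<in> sets borel" using assms borel_closed[OF coord_span_closed] by (intro sets.Int) auto
  then show ?thesis
    unfolding coord_lborel_def using assms
    by (subst (1 2) emeasure_distr) (auto intro!: arg_cong2[where f=emeasure] coord_sum_in_span)
qed

lemma emeasure_coord_lborel_cball_0: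
  fixes I :: "'a::euclidean_space set"
  assumes I: "I \<subseteq> Basis" and r: "r > 0"
  shows "emeasure (coord_lborel I) (cball 0 r) = ennreal (unit_ball_vol (real (card I)) * r ^ card I)"
proof -
  have fin: "finite I" using I finite_subset[OF _ finite_Basis] by auto
  have n: "norm (\<Sum>i\<in>I. f i *\<^sub>R i) = sqrt (\<Sum>i\<in>I. (f i)\<^sup>2)" for f :: "'a \<Rightarrow> real"
  proof -
    have "(\<Sum>i\<in>I. f i *\<^sub>R i) \<bullet> (\<Sum>i\<in>I. f i *\<^sub>R i) = (\<Sum>i\<in>I. (f i)\<^sup>2)"
      unfolding inner_sum_left
    proof (rule sum.cong[OF refl])
      fix i assume i: "i \<in> I"
      have "(f i *\<^sub>R i) \<bullet> (\<Sum>j\<in>I. f j *\<^sub>R j) = (\<Sum>j\<in>I. if j = i then (f i)\<^sup>2 else 0)"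
        using i I unfolding inner_sum_right
        by (intro sum.cong) (auto simp: inner_Basis subset_iff power2_eq_square)
      then show "(f i *\<^sub>R i) \<bullet> (\<Sum>j\<in>I. f j *\<^sub>R j) = (f i)\<^sup>2" using i fin by simp
    qed
    then show ?thesis by (simp add: norm_eq_sqrt_inner)
  qed
  have "emeasure (coord_lborel I) (cball 0 r) = emeasure (Pi\<^sub>M I (\<lambda>_. lborel))
             ({f. sqrt (\<Sum>i\<in>I. (f i)\<^sup>2) \<le> r} \<inter> space (Pi\<^sub>M I (\<lambda>_. lborel)))"
    unfolding coord_lborel_def by (subst emeasure_distr) (auto simp: n intro!: arg_cong2[where f=emeasure])
  then show ?thesis using emeasure_cball_aux[OF fin r] by simp
qed

lemma coord_span_insert:
  assumes "i \<in> Basis" "c \<in> coord_span (insert i I)"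
  shows "c - (c \<bullet> i) *\<^sub>R i \<in> coord_span I"
  using assms by (auto simp: coord_span_def inner_diff_left inner_Basis)

text \<open>Induction on I: the i-th coordinate of c is absorbed by the one-dimensional integral
  along i, and the rest of c lies in the smaller subspace, where the induction hypothesis
  applies.\<close>

lemma coord_lborel_translate:
  fixes c :: "'a::euclidean_space"
  assumes I: "I \<subseteq> Basis" and c: "c \<in> coord_span I" and A: "A \<in> sets borel"
  shows "emeasure (coord_lborel I) {x. c + x \<in> A} = emeasure (coord_lborel I) A"
proof -
  have fin: "finite I" using I finite_subset[OF _ finite_Basis] by auto
  have "distr (coord_lborel I) borel (\<lambda>x. c + x) = coord_lborel I"
    using fin I c
  proof (induction I arbitrary: c rule: finite_induct)
    case empty
    have "c = 0" using empty by (auto simp: coord_span_def intro: euclidean_eqI)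
    then show ?case by (simp add: distr_id2)
  next
    case (insert i I)
    let ?s = "c \<bullet> i" let ?c = "c - ?s *\<^sub>R i"
    have i: "i \<in> Basis" "I \<subseteq> Basis" using insert by auto
    have IH: "distr (coord_lborel I) borel (\<lambda>x. ?c + x) = coord_lborel I"
      by (rule insert.IH[OF i(2)]) (use coord_span_insert[OF i(1)] insert in auto)
    show ?case
    proof (rule measure_eqI)
      fix A assume "A \<in> sets (distr (coord_lborel (insert i I)) borel (\<lambda>x. c + x))"
      then have A [measurable]: "A \<in> sets borel" by simp
      have [measurable]: "{x. c + x \<in> A} \<in> sets borel" by measurable
      have "emeasure (distr (coord_lborel (insert i I)) borel (\<lambda>x. c + x)) A
          = emeasure (coord_lborel (insert i I)) {x. c + x \<in> A}"
        by (subst emeasure_distr) (auto intro!: arg_cong2[where f=emeasure])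
      also have "\<dots> = (\<integral>\<^sup>+x. emeasure lborel {t. x + t *\<^sub>R i \<in> {x. c + x \<in> A}} \<partial>coord_lborel I)"
        by (rule emeasure_coord_lborel_insert) (use insert in auto)
      also have "\<dots> = (\<integral>\<^sup>+x. emeasure lborel {t. (?c + x) + t *\<^sub>R i \<in> A} \<partial>coord_lborel I)"
      proof (rule nn_integral_cong)
        fix x
        have "emeasure lborel {t. (?c + x) + t *\<^sub>R i \<in> A}
           = emeasure (distr lborel borel (\<lambda>t. ?s + t)) {t. (?c + x) + t *\<^sub>R i \<in> A}"
          using lborel_affine[of 1 ?s] by (simp add: density_1)
        also have "\<dots> = emeasure lborel {t. x + t *\<^sub>R i \<in> {x. c + x \<in> A}}"
          by (subst emeasure_distr) (auto intro!: arg_cong2[where f=emeasure] simp: algebra_simps)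
        finally show "emeasure lborel {t. x + t *\<^sub>R i \<in> {x. c + x \<in> A}} = emeasure lborel {t. (?c + x) + t *\<^sub>R i \<in> A}" ..
      qed
      also have "\<dots> = (\<integral>\<^sup>+x. emeasure lborel {t. x + t *\<^sub>R i \<in> A} \<partial>distr (coord_lborel I) borel (\<lambda>x. ?c + x))"
        by (subst nn_integral_distr) auto
      also have "\<dots> = emeasure (coord_lborel (insert i I)) A"
        unfolding IH by (rule emeasure_coord_lborel_insert[symmetric]) (use insert in auto)
      finally show "emeasure (distr (coord_lborel (insert i I)) borel (\<lambda>x. c + x)) A = emeasure (coord_lborel (insert i I)) A" .
    qed simp
  qed
  then have "emeasure (coord_lborel I) A = emeasure (distr (coord_lborel I) borel (\<lambda>x. c + x)) A" by simp
  also have "\<dots> = emeasure (coord_lborel I) {x. c + x \<in> A}"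
    using A by (subst emeasure_distr) (auto intro!: arg_cong2[where f=emeasure])
  finally show ?thesis ..
qed

lemma emeasure_coord_lborel_cball:
  assumes I: "I \<subseteq> Basis" and r: "r > 0" and c: "c \<in> coord_span I"
  shows "emeasure (coord_lborel I) (cball c r) = ennreal (unit_ball_vol (real (card I)) * r ^ card I)"
proof -
  have "emeasure (coord_lborel I) (cball c r) = emeasure (coord_lborel I) {x. c + x \<in> cball c r}"
    by (rule coord_lborel_translate[OF I c, symmetric]) auto
  also have "{x. c + x \<in> cball c r} = cball 0 r" by (auto simp: dist_norm)
  finally show ?thesis using emeasure_coord_lborel_cball_0[OF I r] by simp
qed

section \<open>The isodiametric inequality\<close>

definition coord_reflect :: "'a::euclidean_space \<Rightarrow> 'a \<Rightarrow> 'a" where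
  "coord_reflect i v = v - (2 * (v \<bullet> i)) *\<^sub>R i"

lemma norm_coord_reflect: "i \<in> Basis \<Longrightarrow> norm (coord_reflect i v) = norm v"
  by (simp add: coord_reflect_def norm_eq_sqrt_inner inner_diff_left inner_diff_right inner_commute algebra_simps)

lemma coord_reflect_diff: "coord_reflect i (v - w) = coord_reflect i v - coord_reflect i w"
  by (simp add: coord_reflect_def algebra_simps)

lemma coord_reflect_inner:
  "i \<in> Basis \<Longrightarrow> j \<in> Basis \<Longrightarrow> coord_reflect i v \<bullet> j = (if i = j then - (v \<bullet> j) else v \<bullet> j)"
  by (simp add: coord_reflect_def inner_diff_left inner_Basis)

text \<open>
  A variant of Steiner symmetrization: the points x and y range over the same line parallel to i, and
  the i-th coordinate becomes half the difference of theirs. On each line this replaces E by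
  \<open>(E - E) / 2\<close>, which is at least as long, and unlike for Steiner symmetrization compactness is
  preserved and the bound on the diameter is just the triangle inequality.
\<close>

definition coord_symmetrize :: "'a::euclidean_space \<Rightarrow> 'a set \<Rightarrow> 'a set" where
  "coord_symmetrize i K = (\<lambda>(x, y). (x + coord_reflect i y) /\<^sub>R 2) `
     {(x, y). x \<in> K \<and> y \<in> K \<and> (\<forall>j\<in>Basis - {i}. x \<bullet> j = y \<bullet> j)}"

lemma compact_coord_symmetrize:
  assumes "compact K" shows "compact (coord_symmetrize i K)"
proof -
  have "{(x, y). x \<in> K \<and> y \<in> K \<and> (\<forall>j\<in>Basis - {i}. x \<bullet> j = y \<bullet> j)}
      = (K \<times> K) \<inter> (\<Inter>j\<in>Basis - {i}. {p. fst p \<bullet> j = snd p \<bullet> j})" by auto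
  then show ?thesis
    unfolding coord_symmetrize_def coord_reflect_def
    by (auto intro!: compact_continuous_image continuous_intros compact_Int_closed compact_Times assms
         closed_Collect_eq simp: case_prod_unfold)
qed

lemma coord_symmetrizeE:
  assumes "z \<in> coord_symmetrize i K"
  obtains x y where "x \<in> K" "y \<in> K" "\<And>j. j \<in> Basis \<Longrightarrow> j \<noteq> i \<Longrightarrow> x \<bullet> j = y \<bullet> j"
    "z = (x + coord_reflect i y) /\<^sub>R 2"
  using assms unfolding coord_symmetrize_def by auto

lemma coord_symmetrizeI:
  assumes "x \<in> K" "y \<in> K" "\<And>j. j \<in> Basis \<Longrightarrow> j \<noteq> i \<Longrightarrow> x \<bullet> j = y \<bullet> j"
    "z = (x + coord_reflect i y) /\<^sub>R 2"
  shows "z \<in> coord_symmetrize i K"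
  unfolding coord_symmetrize_def using assms by (intro image_eqI[of _ _ "(x, y)"]) auto

lemma coord_symmetrize_span:
  assumes "K \<subseteq> coord_span I" "i \<in> I" "I \<subseteq> Basis" shows "coord_symmetrize i K \<subseteq> coord_span I"
  using assms by (auto elim!: coord_symmetrizeE simp: coord_span_def subset_iff inner_add_left coord_reflect_inner)

lemma diameter_coord_symmetrize:
  assumes K: "bounded K" "K \<noteq> {}" and i: "i \<in> Basis"
  shows "diameter (coord_symmetrize i K) \<le> diameter K"
proof -
  obtain k where "k \<in> K" using K by auto
  then have ne: "coord_symmetrize i K \<noteq> {}" using coord_symmetrizeI[of k K k i] by blast
  have "dist z w \<le> diameter K" if z: "z \<in> coord_symmetrize i K" and w: "w \<in> coord_symmetrize i K" for z w
  proof -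
    obtain x y where x: "x \<in> K" "y \<in> K" "z = (x + coord_reflect i y) /\<^sub>R 2" using z by (rule coord_symmetrizeE)
    obtain x' y' where x': "x' \<in> K" "y' \<in> K" "w = (x' + coord_reflect i y') /\<^sub>R 2" using w by (rule coord_symmetrizeE)
    have "z - w = ((x - x') + coord_reflect i (y - y')) /\<^sub>R 2"
      by (simp add: x x' coord_reflect_diff scaleR_diff_right[symmetric] algebra_simps)
    then have "norm (z - w) \<le> (norm (x - x') + norm (coord_reflect i (y - y'))) / 2"
      using norm_triangle_ineq[of "x - x'" "coord_reflect i (y - y')"] by simp
    also have "\<dots> \<le> (diameter K + diameter K) / 2"
      using diameter_bounded_bound[OF K(1) x(1) x'(1)] diameter_bounded_bound[OF K(1) x(2) x'(2)]
      by (simp add: norm_coord_reflect[OF i] dist_norm)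
    finally show ?thesis by (simp add: dist_norm)
  qed
  then show ?thesis
    unfolding diameter_def[of "coord_symmetrize i K"] using ne by (auto intro!: cSUP_least)
qed

text \<open>Swapping the two points on the line changes the sign of the i-th coordinate of their
  average and leaves the others alone.\<close>

lemma coord_symmetrize_reflect:
  assumes z: "z \<in> coord_symmetrize i K" and i: "i \<in> Basis"
  shows "coord_reflect i z \<in> coord_symmetrize i K"
proof -
  obtain x y where x: "x \<in> K" "y \<in> K" "\<And>j. j \<in> Basis \<Longrightarrow> j \<noteq> i \<Longrightarrow> x \<bullet> j = y \<bullet> j"
    "z = (x + coord_reflect i y) /\<^sub>R 2" using z by (rule coord_symmetrizeE) blast
  show ?thesis
  proof (rule coord_symmetrizeI[of y K x])
    show "coord_reflect i z = (y + coord_reflect i x) /\<^sub>R 2"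
      by (rule euclidean_eqI) (use i in \<open>simp add: x(4) coord_reflect_inner inner_add_left field_simps\<close>)
  qed (use x in auto)
qed

text \<open>Coordinate reflections commute. Hence a symmetry gained in one coordinate survives
  symmetrization in the next one, and the coordinates can be treated one after the other.\<close>

lemma coord_symmetrize_reflect_other:
  assumes K: "\<And>x. x \<in> K \<Longrightarrow> coord_reflect j x \<in> K" and j: "j \<in> Basis"
    and z: "z \<in> coord_symmetrize i K" and i: "i \<in> Basis"
  shows "coord_reflect j z \<in> coord_symmetrize i K"
proof -
  obtain x y where x: "x \<in> K" "y \<in> K" "\<And>j. j \<in> Basis \<Longrightarrow> j \<noteq> i \<Longrightarrow> x \<bullet> j = y \<bullet> j"
    "z = (x + coord_reflect i y) /\<^sub>R 2" using z by (rule coord_symmetrizeE) blast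
  show ?thesis
  proof (rule coord_symmetrizeI[of "coord_reflect j x" K "coord_reflect j y"])
    show "coord_reflect j z = (coord_reflect j x + coord_reflect i (coord_reflect j y)) /\<^sub>R 2"
      by (rule euclidean_eqI) (use i j in \<open>simp add: x(4) coord_reflect_inner inner_add_left field_simps\<close>)
  qed (use x K j in \<open>auto simp: coord_reflect_inner\<close>)
qed

lemma emeasure_lborel_translate:
  fixes c :: "'a::euclidean_space"
  shows "A \<in> sets borel \<Longrightarrow> emeasure lborel {x. c + x \<in> A} = emeasure lborel A"
  using coord_lborel_translate[of Basis c A] by (simp add: coord_lborel_Basis coord_span_def)

text \<open>With a and b the ends of E, the translates \<open>E - a\<close> and \<open>E - b\<close>
  lie in \<open>E - E\<close> and meet at most in 0, so \<open>E - E\<close> has at least twice the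
  length of E. The shift c is needed because the base point of a line may have nonzero i-th
  coordinate.\<close>

lemma emeasure_half_difference_set:
  fixes E F :: "real set"
  assumes E: "compact E" and F [measurable]: "F \<in> sets borel"
    and sub: "\<And>s t. s \<in> E \<Longrightarrow> t \<in> E \<Longrightarrow> (t - s) / 2 - c \<in> F"
  shows "emeasure lborel E \<le> emeasure lborel F"
proof (cases "E = {}")
  case False
  obtain a where a: "a \<in> E" "\<And>x. x \<in> E \<Longrightarrow> a \<le> x" using compact_attains_inf[OF E False] by auto
  obtain b where b: "b \<in> E" "\<And>x. x \<in> E \<Longrightarrow> x \<le> b" using compact_attains_sup[OF E False] by auto
  have [measurable]: "E \<in> sets borel" using E by (simp add: borel_compact)
  define G where "G = {x. - c + (1/2) * x \<in> F}"
  have [measurable]: "G \<in> sets borel" unfolding G_def by measurable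
  have "emeasure lborel F = (\<integral>\<^sup>+x. indicator F x \<partial>lborel)" by simp
  also have "\<dots> = ennreal (1/2) * (\<integral>\<^sup>+x. indicator F (- c + (1/2) * x) \<partial>lborel)"
    by (subst nn_integral_real_affine[where c="1/2" and t="-c"]) auto
  also have "(\<integral>\<^sup>+x. indicator F (- c + (1/2) * x) \<partial>lborel) = (\<integral>\<^sup>+x. indicator G x \<partial>lborel)"
    by (intro nn_integral_cong) (simp add: G_def indicator_def)
  finally have F': "emeasure lborel F = ennreal (1/2) * emeasure lborel G" by simp
  define E1 where "E1 = {x. a + x \<in> E}"
  define E2 where "E2 = {x. b + x \<in> E}"
  have [measurable]: "E1 \<in> sets borel" "E2 \<in> sets borel" unfolding E1_def E2_def by measurable
  have "E1 \<union> E2 \<subseteq> G"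
  proof
    fix x assume "x \<in> E1 \<union> E2"
    then show "x \<in> G" using sub[of a "a + x"] sub[of b "b + x"] a b by (auto simp: E1_def E2_def G_def)
  qed
  moreover have "E1 \<inter> (E2 - {0}) = {}"
  proof -
    have "x = 0" if "x \<in> E1" "x \<in> E2" for x
      using a(2)[of "a + x"] b(2)[of "b + x"] that by (auto simp: E1_def E2_def)
    then show ?thesis by blast
  qed
  moreover have "emeasure lborel (E2 - {0}) = emeasure lborel E2"
    by (rule emeasure_Diff_null_set) auto
  ultimately have "emeasure lborel E1 + emeasure lborel E2 = emeasure lborel (E1 \<union> (E2 - {0}))"
    and "E1 \<union> (E2 - {0}) \<subseteq> G"
    using plus_emeasure[of E1 lborel "E2 - {0}"] by auto
  then have "emeasure lborel E1 + emeasure lborel E2 \<le> emeasure lborel G"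
    by (simp add: emeasure_mono)
  moreover have "emeasure lborel E1 = emeasure lborel E" "emeasure lborel E2 = emeasure lborel E"
    unfolding E1_def E2_def by (auto intro!: emeasure_lborel_translate)
  ultimately have "emeasure lborel E + emeasure lborel E \<le> emeasure lborel G" by simp
  then have "ennreal (1/2) * (2 * emeasure lborel E) \<le> ennreal (1/2) * emeasure lborel G"
    by (intro mult_left_mono) (auto simp: mult_2)
  moreover have "ennreal (1/2) * (2 * emeasure lborel E) = emeasure lborel E"
  proof -
    have "ennreal (1/2) * 2 = ennreal (1/2) * ennreal 2" by simp
    also have "\<dots> = 1" by (subst ennreal_mult[symmetric]) auto
    finally have "ennreal (1/2) * 2 = 1" .
    then show ?thesis by (simp add: mult.assoc[symmetric])
  qed
  ultimately show ?thesis using F' by simp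
qed simp

lemma emeasure_coord_symmetrize:
  fixes K :: "'a::euclidean_space set"
  assumes K: "compact K" and I: "I \<subseteq> Basis" "i \<in> I"
  shows "emeasure (coord_lborel I) K \<le> emeasure (coord_lborel I) (coord_symmetrize i K)"
proof -
  have I': "insert i (I - {i}) \<subseteq> Basis" "i \<notin> I - {i}" "insert i (I - {i}) = I" using I by auto
  have i: "i \<in> Basis" using I by auto
  have S: "coord_symmetrize i K \<in> sets borel" using compact_coord_symmetrize[OF K] by (simp add: borel_compact)
  have Kb: "K \<in> sets borel" using K by (simp add: borel_compact)
  have "emeasure lborel {t. x + t *\<^sub>R i \<in> K} \<le> emeasure lborel {t. x + t *\<^sub>R i \<in> coord_symmetrize i K}" for x
  proof (rule emeasure_half_difference_set[where c="x \<bullet> i"])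
    show "compact {t. x + t *\<^sub>R i \<in> K}"
    proof -
      have "{t. x + t *\<^sub>R i \<in> K} = (\<lambda>t. x + t *\<^sub>R i) -` K" by auto
      moreover have "closed ((\<lambda>t. x + t *\<^sub>R i) -` K)"
        using compact_imp_closed[OF K] by (intro continuous_closed_vimage) (auto intro!: continuous_intros)
      moreover have "bounded {t. x + t *\<^sub>R i \<in> K}"
      proof -
        obtain B where B: "\<And>y. y \<in> K \<Longrightarrow> norm y \<le> B" using compact_imp_bounded[OF K] bounded_iff by blast
        have "norm t \<le> B + norm x" if "x + t *\<^sub>R i \<in> K" for t
          using norm_triangle_ineq4[of "x + t *\<^sub>R i" x] B[OF that] i by simp
        then show ?thesis by (auto simp: bounded_iff)
      qed
      ultimately show ?thesis by (simp add: compact_eq_bounded_closed)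
    qed
    show "{t. x + t *\<^sub>R i \<in> coord_symmetrize i K} \<in> sets borel"
      using S by measurable
    fix s t assume s: "s \<in> {t. x + t *\<^sub>R i \<in> K}" and t: "t \<in> {t. x + t *\<^sub>R i \<in> K}"
    have "x + ((t - s) / 2 - x \<bullet> i) *\<^sub>R i \<in> coord_symmetrize i K"
    proof (rule coord_symmetrizeI[of "x + t *\<^sub>R i" K "x + s *\<^sub>R i"])
      show "x + ((t - s) / 2 - x \<bullet> i) *\<^sub>R i = (x + t *\<^sub>R i + coord_reflect i (x + s *\<^sub>R i)) /\<^sub>R 2"
        by (rule euclidean_eqI)
          (use i in \<open>simp add: coord_reflect_inner inner_add_left inner_Basis field_simps\<close>)
    qed (use s t i in \<open>auto simp: inner_add_left inner_Basis\<close>)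
    then show "(t - s) / 2 - x \<bullet> i \<in> {t. x + t *\<^sub>R i \<in> coord_symmetrize i K}" by simp
  qed
  then show ?thesis
    using emeasure_coord_lborel_insert(1)[OF I'(1,2) Kb] emeasure_coord_lborel_insert(1)[OF I'(1,2) S]
    unfolding I'(3) by (simp add: nn_integral_mono)
qed

text \<open>After symmetrization in every coordinate of I the set contains \<open>- x\<close> along
  with x. Antipodal points are at distance \<open>2 * norm x\<close>, so the set lies in the ball
  around 0 whose radius is half the diameter, and the volume of that ball is the size.\<close>

lemma isodiametric:
  fixes K :: "'a::euclidean_space set"
  assumes K: "compact K" "K \<noteq> {}" and I: "I \<subseteq> Basis" and KI: "K \<subseteq> coord_span I"
  shows "emeasure (coord_lborel I) K \<le> hausdorff_size (card I) K"
proof -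
  have fin: "finite I" using I finite_subset[OF _ finite_Basis] by auto
  have "\<exists>K'. compact K' \<and> K' \<noteq> {} \<and> K' \<subseteq> coord_span I \<and> diameter K' \<le> diameter K \<and>
     emeasure (coord_lborel I) K \<le> emeasure (coord_lborel I) K' \<and>
     (\<forall>j\<in>J. \<forall>x\<in>K'. coord_reflect j x \<in> K')" if "finite J" "J \<subseteq> I" for J
    using that
  proof (induction J rule: finite_induct)
    case empty
    then show ?case using K KI by (intro exI[of _ K]) auto
  next
    case (insert i J)
    then obtain K' where K': "compact K'" "K' \<noteq> {}" "K' \<subseteq> coord_span I" "diameter K' \<le> diameter K"
     "emeasure (coord_lborel I) K \<le> emeasure (coord_lborel I) K'"
     "\<forall>j\<in>J. \<forall>x\<in>K'. coord_reflect j x \<in> K'" by auto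
    have i: "i \<in> I" "i \<in> Basis" "J \<subseteq> Basis" using insert I by auto
    obtain k where k: "k \<in> K'" using K' by auto
    show ?case
    proof (intro exI[of _ "coord_symmetrize i K'"] conjI ballI)
      show "compact (coord_symmetrize i K')" by (rule compact_coord_symmetrize[OF K'(1)])
      show "coord_symmetrize i K' \<subseteq> coord_span I" by (rule coord_symmetrize_span[OF K'(3) i(1) I])
      show "coord_symmetrize i K' \<noteq> {}" using coord_symmetrizeI[of k K' k i] k by blast
      show "diameter (coord_symmetrize i K') \<le> diameter K"
        using diameter_coord_symmetrize[OF compact_imp_bounded[OF K'(1)] K'(2) i(2)] K'(4) by simp
      show "emeasure (coord_lborel I) K \<le> emeasure (coord_lborel I) (coord_symmetrize i K')"
        using emeasure_coord_symmetrize[OF K'(1) I i(1)] K'(5) by (rule order_trans[rotated])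
      fix j x assume "j \<in> insert i J" "x \<in> coord_symmetrize i K'"
      then show "coord_reflect j x \<in> coord_symmetrize i K'"
        using coord_symmetrize_reflect[OF _ i(2)] coord_symmetrize_reflect_other[OF _ _ _ i(2), of K' j x] K'(6) i
        by blast
    qed
  qed
  from this[OF fin order_refl] obtain K' where K': "compact K'" "K' \<noteq> {}" "K' \<subseteq> coord_span I" "diameter K' \<le> diameter K"
     "emeasure (coord_lborel I) K \<le> emeasure (coord_lborel I) K'"
     "\<And>j x. j \<in> I \<Longrightarrow> x \<in> K' \<Longrightarrow> coord_reflect j x \<in> K'" by blast
  have neg: "- x \<in> K'" if x: "x \<in> K'" for x
  proof -
    \<comment> \<open>The reflections in all coordinates of I compose to negation on
      \<open>coord_span I\<close>; the signs are flipped one coordinate at a time.\<close>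
    have "\<exists>y\<in>K'. \<forall>j\<in>Basis. y \<bullet> j = (if j \<in> J then - (x \<bullet> j) else x \<bullet> j)" if "finite J" "J \<subseteq> I" for J
      using that
    proof (induction J rule: finite_induct)
      case empty then show ?case using x by auto
    next
      case (insert i J)
      then obtain y where "y \<in> K'" "\<forall>j\<in>Basis. y \<bullet> j = (if j \<in> J then - (x \<bullet> j) else x \<bullet> j)" by auto
      then show ?case
        using insert I by (intro bexI[of _ "coord_reflect i y"] K'(6)) (auto simp: coord_reflect_inner)
    qed
    from this[OF fin order_refl] obtain y where y: "y \<in> K'" "\<forall>j\<in>Basis. y \<bullet> j = (if j \<in> I then - (x \<bullet> j) else x \<bullet> j)"
      by blast
    have xs: "x \<bullet> j = 0" if "j \<in> Basis" "j \<notin> I" for j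
      using x K'(3) that unfolding coord_span_def by blast
    have "y = - x"
    proof (rule euclidean_eqI)
      fix j :: 'a assume "j \<in> Basis"
      then show "y \<bullet> j = (- x) \<bullet> j" using y(2) xs[of j] by (cases "j \<in> I") simp_all
    qed
    then show ?thesis using y by simp
  qed
  have sub: "K' \<subseteq> cball 0 (diameter K / 2)"
  proof
    fix x assume x: "x \<in> K'"
    have "dist x (- x) \<le> diameter K'"
      by (rule diameter_bounded_bound[OF compact_imp_bounded[OF K'(1)] x neg[OF x]])
    moreover have "dist x (- x) = 2 * norm x"
      by (simp add: dist_norm scaleR_2[symmetric])
    ultimately show "x \<in> cball 0 (diameter K / 2)" using K'(4) by simp
  qed
  have D0: "diameter K \<ge> 0" by (rule diameter_ge_0[OF compact_imp_bounded[OF K(1)]])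
  have "emeasure (coord_lborel I) (cball 0 (diameter K / 2)) \<le> hausdorff_size (card I) K"
  \<comment> \<open>The volume formula for balls assumes a positive radius. In radius 0 the measure
    is at most 1 for empty I, which is the size because \<open>0 ^ 0 = 1\<close>, and it is 0
    otherwise.\<close>
  proof (cases "diameter K = 0")
    case False
    then show ?thesis
      using D0 K emeasure_coord_lborel_cball_0[OF I, of "diameter K / 2"] by (simp add: hausdorff_size_def)
  next
    case True
    show ?thesis
    proof (cases "I = {}")
      case True
      have "emeasure (coord_lborel I) (cball 0 (diameter K / 2)) \<le> emeasure (coord_lborel I) (cball 0 1)"
        by (rule emeasure_mono) (auto simp: \<open>diameter K = 0\<close>)
      also have "\<dots> = 1" using emeasure_coord_lborel_cball_0[OF I, of 1] True by simp
      finally show ?thesis using K True by (simp add: hausdorff_size_def)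
    next
      case False
      have c: "card I > 0" using False fin by (simp add: card_gt_0_iff)
      have small: "emeasure (coord_lborel I) (cball 0 0) \<le> ennreal e" if e: "e > 0" for e
      proof -
        define w where "w = unit_ball_vol (real (card I))"
        have w: "w > 0" by (simp add: w_def)
        define r where "r = min 1 (e / w)"
        have r: "r > 0" "r \<le> 1" "r \<le> e / w" using e w by (auto simp: r_def)
        have "emeasure (coord_lborel I) (cball 0 0) \<le> emeasure (coord_lborel I) (cball 0 r)"
          by (rule emeasure_mono) (use r in auto)
        also have "\<dots> = ennreal (w * r ^ card I)"
          unfolding w_def by (rule emeasure_coord_lborel_cball_0[OF I r(1)])
        also have "w * r ^ card I \<le> w * r ^ 1"
          using w r c by (intro mult_left_mono power_decreasing) auto
        also have "w * r ^ 1 \<le> e" using r w by (simp add: field_simps)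
        finally show ?thesis by (simp add: ennreal_leI)
      qed
      have "emeasure (coord_lborel I) (cball 0 0) \<le> 0"
        by (rule ennreal_le_epsilon) (use small in simp)
      then show ?thesis using True by simp
    qed
  qed
  moreover have "emeasure (coord_lborel I) K' \<le> emeasure (coord_lborel I) (cball 0 (diameter K / 2))"
    using sub by (rule emeasure_mono) simp
  ultimately show ?thesis using K'(5) by (meson order_trans)
qed

text \<open>Taking the closure of a covering set and cutting it with the subspace makes it compact
  without enlarging its diameter; \<open>isodiametric\<close> then bounds its measure by the size of
  the original set.\<close>

lemma coord_lborel_le_hausdorff_outer:
  fixes A :: "'a::euclidean_space set"
  assumes I: "I \<subseteq> Basis" and A: "A \<in> sets borel" "A \<subseteq> coord_span I"
  shows "emeasure (coord_lborel I) A \<le> hausdorff_outer (card I) A"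
proof -
  have "emeasure (coord_lborel I) A \<le> hausdorff_content (card I) 1 A"
    unfolding hausdorff_content_def
  proof (rule INF_greatest, safe)
    fix C :: "nat \<Rightarrow> 'a set"
    assume C: "\<forall>i. bounded (C i) \<and> diameter (C i) \<le> 1" and cov: "A \<subseteq> (\<Union>i. C i)"
    define D where "D i = closure (C i) \<inter> coord_span I" for i
    have D: "compact (D i)" for i
      using C unfolding D_def by (intro compact_Int_closed coord_span_closed) (simp add: compact_closure)
    have [measurable]: "D i \<in> sets borel" for i using D by (simp add: borel_compact)
    have "A \<subseteq> (\<Union>i. D i)"
    proof
      fix x assume x: "x \<in> A"
      then obtain i where "x \<in> C i" using cov by blast
      then show "x \<in> (\<Union>i. D i)" using x A closure_subset unfolding D_def by blast
    qed
    then have "emeasure (coord_lborel I) A \<le> emeasure (coord_lborel I) (\<Union>i. D i)"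
      by (rule emeasure_mono) auto
    also have "\<dots> \<le> suminf (\<lambda>i. emeasure (coord_lborel I) (D i))"
      by (rule emeasure_subadditive_countably) auto
    also have "\<dots> \<le> suminf (\<lambda>i. hausdorff_size (card I) (C i))"
    proof (intro suminf_le summableI)
      fix i
      show "emeasure (coord_lborel I) (D i) \<le> hausdorff_size (card I) (C i)"
      proof (cases "D i = {}")
        case False
        have bC: "bounded (C i)" using C by auto
        have "emeasure (coord_lborel I) (D i) \<le> hausdorff_size (card I) (D i)"
          by (rule isodiametric[OF D False I]) (auto simp: D_def)
        also have "\<dots> \<le> hausdorff_size (card I) (closure (C i))"
          using bC by (intro hausdorff_size_mono) (auto simp: D_def)
        also have "\<dots> = hausdorff_size (card I) (C i)"
          using diameter_closure[OF bC] by (simp add: hausdorff_size_def)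
        finally show ?thesis .
      qed simp
    qed
    finally show "emeasure (coord_lborel I) A \<le> suminf (\<lambda>i. hausdorff_size (card I) (C i))" .
  qed
  then show ?thesis using hausdorff_content_le_outer[of 1] by (meson order_trans zero_less_one)
qed

section \<open>Vitali coverings of coordinate subspaces\<close>

lemma hausdorff_size_le_cball:
  assumes C: "C \<subseteq> cball a r" and r: "r \<ge> 0"
  shows "hausdorff_size s C \<le> ennreal (unit_ball_vol (real s) * r ^ s)"
proof (cases "C = {}")
  case False
  have b: "bounded C" using C bounded_subset by blast
  have "dist x y \<le> 2 * r" if "x \<in> C" "y \<in> C" for x y
    using that C dist_triangle2[of x y a] by (auto simp: dist_commute subset_iff) (smt (verit) dist_commute)
  then have "diameter C \<le> 2 * r"
    unfolding diameter_def using False by (auto intro!: cSUP_least)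
  then show ?thesis
    using False diameter_ge_0[OF b] by (auto simp: hausdorff_size_def intro!: ennreal_leI mult_left_mono power_mono)
qed (simp add: hausdorff_size_def)

text \<open>The \<open>B n\<close> are traces on the subspace of disjoint balls centred there, the
  \<open>E n\<close> traces of the balls five times as large. That the size of a trace
  \<open>B n\<close> is at most its measure is where the normalising factor of Hausdorff measure
  matters.\<close>

lemma vitali_coord_span:
  fixes I :: "'a::euclidean_space set"
  assumes I: "I \<subseteq> Basis" and S: "open S" and \<delta>: "\<delta> > 0"
  obtains B E :: "nat \<Rightarrow> 'a set"
  where "\<And>n. closed (B n)" "\<And>n. B n \<subseteq> S \<inter> coord_span I" "disjoint_family B"
    "\<And>n. bounded (E n)" "\<And>n. closed (E n)" "\<And>n. diameter (E n) \<le> \<delta>" "\<And>n. B n \<subseteq> E n"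
    "S \<inter> coord_span I \<subseteq> (\<Union>n. E n)"
    "\<And>n. hausdorff_size (card I) (E n) \<le> ennreal (5 ^ card I) * emeasure (coord_lborel I) (B n)"
    "\<And>n. hausdorff_size (card I) (B n) \<le> emeasure (coord_lborel I) (B n)"
    "\<And>n. emeasure (coord_lborel I) (E n) \<le> ennreal (5 ^ card I) * emeasure (coord_lborel I) (B n)"
proof -
  let ?V = "coord_span I" and ?m = "coord_lborel I" and ?s = "card I"
  \<comment> \<open>With radii up to \<open>\<delta> / 10\<close> the fivefold balls still have
    diameter at most \<delta>.\<close>
  define K where "K = {(a, r). a \<in> ?V \<and> 0 < r \<and> r \<le> \<delta> / 10 \<and> cball a r \<subseteq> S}"
  have cov: "S \<inter> ?V \<subseteq> (\<Union>p\<in>K. cball (fst p) (snd p))"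
  proof
    fix x assume x: "x \<in> S \<inter> ?V"
    then obtain e where e: "e > 0" "cball x e \<subseteq> S" using S open_contains_cball by blast
    then have "(x, min e (\<delta> / 10)) \<in> K" using x \<delta> by (auto simp: K_def)
    then show "x \<in> (\<Union>p\<in>K. cball (fst p) (snd p))"
      using e \<delta> by (intro UN_I[of "(x, min e (\<delta> / 10))"]) auto
  qed
  have Kr: "0 < snd p \<and> snd p \<le> \<delta> / 10" if "p \<in> K" for p using that by (auto simp: K_def)
  obtain C where C: "countable C" "C \<subseteq> K"
     "pairwise (\<lambda>i j. disjnt (cball (fst i) (snd i)) (cball (fst j) (snd j))) C"
     "S \<inter> ?V \<subseteq> (\<Union>p\<in>C. cball (fst p) (5 * snd p))"
    by (rule Vitali_covering_lemma_cballs[OF cov Kr])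
  \<comment> \<open>The selected family is countable but may be finite; indices outside N receive
    the empty set.\<close>
  define N where "N = to_nat_on C ` C"
  define q where "q = from_nat_into C"
  have q: "q n \<in> C" if "n \<in> N" for n using that C(1) by (auto simp: q_def N_def)
  have qi: "inj_on q N" using C(1) by (auto simp: q_def N_def inj_on_def)
  have qs: "q ` N = C" using C(1) by (force simp: q_def N_def)
  define B where "B n = (if n \<in> N then cball (fst (q n)) (snd (q n)) \<inter> ?V else {})" for n
  define E where "E n = (if n \<in> N then cball (fst (q n)) (5 * snd (q n)) \<inter> ?V else {})" for n
  have Bm: "emeasure ?m (B n) = ennreal (unit_ball_vol (real ?s) * snd (q n) ^ ?s)" if n: "n \<in> N" for n
  proof -
    have "q n \<in> K" using q[OF n] C(2) by auto
    then show ?thesis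
      using emeasure_coord_lborel_cball[OF I, of "snd (q n)" "fst (q n)"] n emeasure_coord_lborel_Int_span[OF I, of "cball (fst (q n)) (snd (q n))"]
      by (auto simp: B_def K_def)
  qed
  have five: "ennreal (unit_ball_vol (real ?s) * (5 * snd (q n)) ^ ?s) = ennreal (5 ^ ?s) * emeasure ?m (B n)" if n: "n \<in> N" for n
    unfolding Bm[OF n] by (subst ennreal_mult[symmetric]) (use Kr[of "q n"] q[OF n] C(2) in \<open>auto simp: power_mult_distrib mult_ac\<close>)
  show thesis
  proof (rule that[of B E])
    show "closed (B n)" "closed (E n)" "bounded (E n)" for n
      by (auto simp: B_def E_def intro: closed_Int coord_span_closed bounded_Int)
    show "B n \<subseteq> S \<inter> ?V" for n
    proof (cases "n \<in> N")
      case True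
      then have "q n \<in> K" using q C(2) by blast
      then show ?thesis using True by (auto simp: B_def K_def)
    qed (simp add: B_def)
    show "B n \<subseteq> E n" for n
      using q[of n] C(2) Kr[of "q n"] by (auto simp: B_def E_def)
    show "disjoint_family B"
      unfolding disjoint_family_on_def
    proof (intro ballI impI)
      fix m n :: nat assume mn: "m \<noteq> n"
      show "B m \<inter> B n = {}"
      proof (cases "m \<in> N \<and> n \<in> N")
        case True
        then have "q m \<noteq> q n" using qi mn by (auto simp: inj_on_def)
        then have "disjnt (cball (fst (q m)) (snd (q m))) (cball (fst (q n)) (snd (q n)))"
          using C(3) q True by (auto simp: pairwise_def)
        then show ?thesis by (auto simp: B_def disjnt_def)
      qed (auto simp: B_def)
    qed
    show "S \<inter> ?V \<subseteq> (\<Union>n. E n)"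
    proof
      fix x assume x: "x \<in> S \<inter> ?V"
      then obtain p where "p \<in> C" "x \<in> cball (fst p) (5 * snd p)" using C(4) by blast
      moreover then obtain n where "n \<in> N" "p = q n" using qs by blast
      ultimately have "x \<in> E n" using x by (simp add: E_def)
      then show "x \<in> (\<Union>n. E n)" by blast
    qed
    fix n
    show "hausdorff_size ?s (B n) \<le> emeasure ?m (B n)"
    proof (cases "n \<in> N")
      case True
      then show ?thesis
        unfolding Bm[OF True] using Kr[of "q n"] q[of n] C(2)
        by (intro hausdorff_size_le_cball[of _ "fst (q n)"]) (auto simp: B_def)
    qed (simp add: B_def hausdorff_size_def)
    show "hausdorff_size ?s (E n) \<le> ennreal (5 ^ ?s) * emeasure ?m (B n)"
    proof (cases "n \<in> N")
      case True
      then show ?thesis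
        unfolding five[OF True, symmetric] using Kr[of "q n"] q[of n] C(2)
        by (intro hausdorff_size_le_cball[of _ "fst (q n)"]) (auto simp: E_def)
    qed (simp add: E_def hausdorff_size_def)
    show "emeasure ?m (E n) \<le> ennreal (5 ^ ?s) * emeasure ?m (B n)"
    proof (cases "n \<in> N")
      case True
      have "emeasure ?m (E n) \<le> emeasure ?m (cball (fst (q n)) (5 * snd (q n)))"
        by (rule emeasure_mono) (auto simp: E_def)
      also have "\<dots> = ennreal (unit_ball_vol (real ?s) * (5 * snd (q n)) ^ ?s)"
        using q[OF True] C(2) by (intro emeasure_coord_lborel_cball[OF I]) (auto simp: K_def)
      finally show ?thesis using five[OF True] by simp
    qed (simp add: E_def)
    show "diameter (E n) \<le> \<delta>"
    proof (cases "E n = {}")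
      case False
      then have n: "n \<in> N" by (auto simp: E_def split: if_splits)
      have sub: "E n \<subseteq> cball (fst (q n)) (5 * snd (q n))" using n by (auto simp: E_def)
      have "dist x y \<le> \<delta>" if "x \<in> E n" "y \<in> E n" for x y
      proof -
        have "dist x y \<le> dist (fst (q n)) x + dist (fst (q n)) y"
          by (metis dist_triangle3)
        moreover have "dist (fst (q n)) x \<le> 5 * snd (q n)" "dist (fst (q n)) y \<le> 5 * snd (q n)"
          using that sub by auto
        moreover have "10 * snd (q n) \<le> \<delta>" using Kr[of "q n"] q[OF n] C(2) by auto
        ultimately show ?thesis by linarith
      qed
      then show ?thesis unfolding diameter_def using False by (auto intro!: cSUP_least)
    qed (use \<delta> in simp)
  qed
qed

lemma hausdorff_content_empty: "\<delta> > 0 \<Longrightarrow> hausdorff_content s \<delta> {} = 0"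
  using hausdorff_content_le_outer[of \<delta> s "{}"] by (simp add: hausdorff_outer_empty)

lemma hausdorff_content_Un:
  assumes "\<delta> > 0"
  shows "hausdorff_content s \<delta> (A \<union> B) \<le> hausdorff_content s \<delta> A + hausdorff_content s \<delta> B"
proof -
  have "hausdorff_content s \<delta> (A \<union> B) = hausdorff_content s \<delta> (\<Union>i. binaryset A B i)"
    by (simp add: UN_binaryset_eq)
  also have "\<dots> \<le> suminf (\<lambda>i. hausdorff_content s \<delta> (binaryset A B i))"
    by (rule hausdorff_content_UN)
  also have "\<dots> = hausdorff_content s \<delta> A + hausdorff_content s \<delta> B"
    by (rule suminf_binaryset_eq) (rule hausdorff_content_empty[OF assms])
  finally show ?thesis .
qed

lemma hausdorff_content_finite_UN:
  fixes j :: nat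
  assumes "\<delta> > 0"
  shows "hausdorff_content s \<delta> (A \<union> (\<Union>n<j. B n)) \<le> hausdorff_content s \<delta> A + (\<Sum>n<j. hausdorff_content s \<delta> (B n))"
proof (induction j)
  case (Suc j)
  have "A \<union> (\<Union>n<Suc j. B n) = (A \<union> (\<Union>n<j. B n)) \<union> B j" by (auto simp: less_Suc_eq)
  then have "hausdorff_content s \<delta> (A \<union> (\<Union>n<Suc j. B n))
      \<le> hausdorff_content s \<delta> (A \<union> (\<Union>n<j. B n)) + hausdorff_content s \<delta> (B j)"
    using hausdorff_content_Un[OF assms] by metis
  also have "\<dots> \<le> hausdorff_content s \<delta> A + (\<Sum>n<j. hausdorff_content s \<delta> (B n)) + hausdorff_content s \<delta> (B j)"
    by (rule add_right_mono) (rule Suc.IH)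
  finally show ?case by (simp add: add.assoc)
qed simp

text \<open>
  Finitely many disjoint balls of a Vitali covering catch a fixed fraction of S without loss, so the
  crude factor \<open>5 ^ card I\<close> is only paid for the remainder, which shrinks geometrically with k.
\<close>

lemma hausdorff_outer_open_le_iter:
  fixes I :: "'a::euclidean_space set"
  assumes I: "I \<subseteq> Basis" and S: "open S" "emeasure (coord_lborel I) S < top"
  shows "hausdorff_outer (card I) (S \<inter> coord_span I)
     \<le> ennreal ((1 + 5 ^ card I * (1 - 1 / (2 * 5 ^ card I)) ^ k) * measure (coord_lborel I) S)"
  using S
proof (induction k arbitrary: S)
  case 0
  let ?V = "coord_span I" and ?m = "coord_lborel I" and ?s = "card I"
  have "hausdorff_content ?s \<delta> (S \<inter> ?V) \<le> ennreal (5 ^ ?s) * emeasure ?m S" if \<delta>: "\<delta> > 0" for \<delta>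
  proof -
    obtain B E :: "nat \<Rightarrow> 'a set"
    where BE: "\<And>n. closed (B n)" "\<And>n. B n \<subseteq> S \<inter> ?V" "disjoint_family B"
      "\<And>n. bounded (E n)" "\<And>n. closed (E n)" "\<And>n. diameter (E n) \<le> \<delta>" "\<And>n. B n \<subseteq> E n"
      "S \<inter> ?V \<subseteq> (\<Union>n. E n)"
      "\<And>n. hausdorff_size ?s (E n) \<le> ennreal (5 ^ ?s) * emeasure ?m (B n)"
      "\<And>n. hausdorff_size ?s (B n) \<le> emeasure ?m (B n)"
      "\<And>n. emeasure ?m (E n) \<le> ennreal (5 ^ ?s) * emeasure ?m (B n)"
      by (rule vitali_coord_span[OF I 0(1) \<delta>]) blast
    have "hausdorff_content ?s \<delta> (S \<inter> ?V) \<le> suminf (\<lambda>n. hausdorff_size ?s (E n))"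
      unfolding hausdorff_content_def using BE by (intro INF_lower) auto
    also have "\<dots> \<le> suminf (\<lambda>n. ennreal (5 ^ ?s) * emeasure ?m (B n))"
      by (intro suminf_le summableI BE)
    also have "\<dots> = ennreal (5 ^ ?s) * suminf (\<lambda>n. emeasure ?m (B n))" by simp
    also have "suminf (\<lambda>n. emeasure ?m (B n)) = emeasure ?m (\<Union>n. B n)"
      using BE by (intro suminf_emeasure) auto
    also have "\<dots> \<le> emeasure ?m S" using BE(2) 0(1) by (intro emeasure_mono) auto
    finally show ?thesis by (simp add: mult_left_mono)
  qed
  then have "hausdorff_outer ?s (S \<inter> ?V) \<le> ennreal (5 ^ ?s) * emeasure ?m S"
    unfolding hausdorff_outer_def by (auto intro!: SUP_least)
  also have "\<dots> = ennreal (5 ^ ?s * measure ?m S)"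
    using 0(2) by (simp add: emeasure_eq_ennreal_measure ennreal_mult)
  also have "\<dots> \<le> ennreal ((1 + 5 ^ card I * (1 - 1 / (2 * 5 ^ card I)) ^ 0) * measure (coord_lborel I) S)"
    by (intro ennreal_leI mult_right_mono) auto
  finally show ?case .
next
  case (Suc k)
  let ?V = "coord_span I" and ?m = "coord_lborel I" and ?s = "card I"
  let ?\<kappa> = "1 / (2 * 5 ^ card I) :: real"
  define c where "c = 5 ^ ?s * (1 - ?\<kappa>) ^ k"
  have k1: "0 < ?\<kappa>" "?\<kappa> \<le> 1"
  proof -
    have "1 \<le> (5::real) ^ ?s" by simp
    then have "1 \<le> 2 * (5::real) ^ ?s" by linarith
    then show "0 < ?\<kappa>" "?\<kappa> \<le> 1" by auto
  qed
  then have c: "c \<ge> 0" unfolding c_def by (intro mult_nonneg_nonneg zero_le_power) auto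
  have Sf: "S \<in> fmeasurable ?m" using Suc.prems by (auto simp: fmeasurable_def)
  have "hausdorff_content ?s \<delta> (S \<inter> ?V) \<le> ennreal ((1 + c * (1 - ?\<kappa>)) * measure ?m S)" if \<delta>: "\<delta> > 0" for \<delta>
  proof -
    obtain B E :: "nat \<Rightarrow> 'a set"
    where BE: "\<And>n. closed (B n)" "\<And>n. B n \<subseteq> S \<inter> ?V" "disjoint_family B"
      "\<And>n. bounded (E n)" "\<And>n. closed (E n)" "\<And>n. diameter (E n) \<le> \<delta>" "\<And>n. B n \<subseteq> E n"
      "S \<inter> ?V \<subseteq> (\<Union>n. E n)"
      "\<And>n. hausdorff_size ?s (E n) \<le> ennreal (5 ^ ?s) * emeasure ?m (B n)"
      "\<And>n. hausdorff_size ?s (B n) \<le> emeasure ?m (B n)"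
      "\<And>n. emeasure ?m (E n) \<le> ennreal (5 ^ ?s) * emeasure ?m (B n)"
      by (rule vitali_coord_span[OF I Suc.prems(1) \<delta>]) blast
    have B [measurable]: "B n \<in> sets borel" for n using BE(1) by auto
    have UB: "(\<Union>n. B n) \<in> fmeasurable ?m"
      by (rule fmeasurableI2[OF Sf]) (use BE(2) in auto)
    have Bf: "B n \<in> fmeasurable ?m" for n
      by (rule fmeasurableI2[OF Sf]) (use BE(2) in auto)
    have "emeasure ?m S \<le> ennreal (5 ^ ?s) * emeasure ?m (\<Union>n. B n)"
    proof -
      have "emeasure ?m S = emeasure ?m (S \<inter> ?V)"
        using emeasure_coord_lborel_Int_span[OF I] Suc.prems by auto
      also have "\<dots> \<le> emeasure ?m (\<Union>n. E n)" using BE(8,5) by (intro emeasure_mono) auto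
      also have "\<dots> \<le> suminf (\<lambda>n. emeasure ?m (E n))"
        using BE(5) by (intro emeasure_subadditive_countably) auto
      also have "\<dots> \<le> suminf (\<lambda>n. ennreal (5 ^ ?s) * emeasure ?m (B n))"
        by (intro suminf_le summableI BE)
      also have "\<dots> = ennreal (5 ^ ?s) * suminf (\<lambda>n. emeasure ?m (B n))" by simp
      also have "suminf (\<lambda>n. emeasure ?m (B n)) = emeasure ?m (\<Union>n. B n)"
        using BE by (intro suminf_emeasure) auto
      finally show ?thesis .
    qed
    then have "ennreal (measure ?m S) \<le> ennreal (5 ^ ?s * measure ?m (\<Union>n. B n))"
      using Sf UB by (simp add: emeasure_eq_measure2 ennreal_mult)
    then have big: "measure ?m S \<le> 5 ^ ?s * measure ?m (\<Union>n. B n)" by simp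
    \<comment> \<open>All disjoint balls together cover at least the fraction
      \<open>1 / 5 ^ card I\<close> of S. Asking for half of that lets finitely many of them
      suffice.\<close>
    have "\<exists>j. ?\<kappa> * measure ?m S \<le> (\<Sum>n<j. measure ?m (B n))"
    proof (cases "measure ?m S = 0")
      case False
      then have pos: "measure ?m S > 0" using zero_less_measure_iff by blast
      have "(\<lambda>n. measure ?m (B n)) sums measure ?m (\<Union>n. B n)"
        using BE(3) UB Bf by (intro measure_UNION) (auto simp: fmeasurable_def)
      moreover have "?\<kappa> * measure ?m S < measure ?m (\<Union>n. B n)"
      proof -
        have "?\<kappa> * measure ?m S < measure ?m S / 5 ^ ?s" using pos by (simp add: field_simps)
        also have "\<dots> \<le> measure ?m (\<Union>n. B n)" using big by (simp add: field_simps)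
        finally show ?thesis .
      qed
      ultimately have "eventually (\<lambda>j. ?\<kappa> * measure ?m S < (\<Sum>n<j. measure ?m (B n))) sequentially"
        unfolding sums_def by (rule order_tendstoD)
      then show ?thesis by (meson eventually_sequentially less_imp_le order_refl)
    qed (auto intro: exI[of _ 0])
    then obtain j where j: "?\<kappa> * measure ?m S \<le> (\<Sum>n<j. measure ?m (B n))" by blast
    \<comment> \<open>Only finitely many closed sets are removed, so the remainder is open and the
      induction hypothesis applies to it.\<close>
    define S' where "S' = S - (\<Union>n<j. B n)"
    have S': "open S'" unfolding S'_def using Suc.prems BE(1) by (intro open_Diff closed_UN) auto
    have S'f: "S' \<in> fmeasurable ?m" by (rule fmeasurableI2[OF Sf]) (use S' in \<open>auto simp: S'_def\<close>)
    have "measure ?m (\<Union>n<j. B n) = (\<Sum>n<j. measure ?m (B n))"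
      using BE(3) fmeasurableD2[OF Bf] by (intro measure_finite_Union) (auto simp: disjoint_family_on_def)
    moreover have "measure ?m S' = measure ?m S - measure ?m (\<Union>n<j. B n)"
      unfolding S'_def using Sf BE(2) by (intro measurable_measure_Diff) auto
    ultimately have mS': "(\<Sum>n<j. measure ?m (B n)) = measure ?m S - measure ?m S'" by simp
    have "S \<inter> ?V \<subseteq> (S' \<inter> ?V) \<union> (\<Union>n<j. B n)" unfolding S'_def by auto
    then have "hausdorff_content ?s \<delta> (S \<inter> ?V) \<le> hausdorff_content ?s \<delta> ((S' \<inter> ?V) \<union> (\<Union>n<j. B n))"
      by (rule hausdorff_content_mono)
    also have "\<dots> \<le> hausdorff_content ?s \<delta> (S' \<inter> ?V) + (\<Sum>n<j. hausdorff_content ?s \<delta> (B n))"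
      by (rule hausdorff_content_finite_UN[OF \<delta>])
    also have "\<dots> \<le> ennreal ((1 + c) * measure ?m S') + (\<Sum>n<j. ennreal (measure ?m (B n)))"
    proof (intro add_mono sum_mono)
      show "hausdorff_content ?s \<delta> (S' \<inter> ?V) \<le> ennreal ((1 + c) * measure ?m S')"
        unfolding c_def
        by (rule order_trans[OF hausdorff_content_le_outer[OF \<delta>] Suc.IH[OF S']])
          (use S'f in \<open>auto simp: fmeasurable_def\<close>)
      fix n
      have "hausdorff_content ?s \<delta> (B n) \<le> hausdorff_size ?s (B n)"
      proof (rule hausdorff_content_le_size[OF _ _ \<delta>])
        show "bounded (B n)" using bounded_subset[OF BE(4,7)] .
        show "diameter (B n) \<le> \<delta>" using diameter_subset[OF BE(7,4)] BE(6) by (rule order_trans)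
      qed
      also have "\<dots> \<le> ennreal (measure ?m (B n))"
        using BE(10) Bf by (simp add: emeasure_eq_measure2[symmetric])
      finally show "hausdorff_content ?s \<delta> (B n) \<le> ennreal (measure ?m (B n))" .
    qed
    also have "\<dots> = ennreal ((1 + c) * measure ?m S' + (\<Sum>n<j. measure ?m (B n)))"
      using c by (simp add: sum_ennreal ennreal_plus[symmetric] sum_nonneg del: ennreal_plus)
    \<comment> \<open>The balls cost exactly their measure and the remainder \<open>1 + c\<close>
      times its own, so the excess over the measure of S is c times the remainder, which is at most
      the fraction \<open>1 - ?\<kappa>\<close> of S.\<close>
    also have "\<dots> \<le> ennreal ((1 + c * (1 - ?\<kappa>)) * measure ?m S)"
    proof (rule ennreal_leI)
      have "measure ?m S' \<le> (1 - ?\<kappa>) * measure ?m S" using j mS' by (simp add: algebra_simps)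
      then have "c * measure ?m S' \<le> c * ((1 - ?\<kappa>) * measure ?m S)" using c by (rule mult_left_mono)
      then show "(1 + c) * measure ?m S' + (\<Sum>n<j. measure ?m (B n)) \<le> (1 + c * (1 - ?\<kappa>)) * measure ?m S"
        unfolding mS' by (simp add: algebra_simps)
    qed
    finally show ?thesis .
  qed
  then have "hausdorff_outer ?s (S \<inter> ?V) \<le> ennreal ((1 + c * (1 - ?\<kappa>)) * measure ?m S)"
    unfolding hausdorff_outer_def by (auto intro!: SUP_least)
  then show ?case by (simp add: c_def mult_ac)
qed

section \<open>Equality of Hausdorff and Lebesgue measure on coordinate subspaces\<close>

lemma hausdorff_outer_open_le:
  fixes I :: "'a::euclidean_space set"
  assumes I: "I \<subseteq> Basis" and S: "open S" "emeasure (coord_lborel I) S < top"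
  shows "hausdorff_outer (card I) (S \<inter> coord_span I) \<le> emeasure (coord_lborel I) S"
proof -
  let ?q = "1 - 1 / (2 * 5 ^ card I) :: real"
  have "1 \<le> (5::real) ^ card I" by simp
  then have "1 \<le> 2 * (5::real) ^ card I" by linarith
  then have q: "0 \<le> ?q" "?q < 1" by (auto simp: field_simps)
  have "(\<lambda>k. (1 + 5 ^ card I * ?q ^ k) * measure (coord_lborel I) S) \<longlonglongrightarrow> (1 + 5 ^ card I * 0) * measure (coord_lborel I) S"
    using q by (intro tendsto_intros LIMSEQ_power_zero) auto
  then have "(\<lambda>k. ennreal ((1 + 5 ^ card I * ?q ^ k) * measure (coord_lborel I) S)) \<longlonglongrightarrow> ennreal (measure (coord_lborel I) S)"
    by (intro tendsto_ennrealI) simp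
  then have "hausdorff_outer (card I) (S \<inter> coord_span I) \<le> ennreal (measure (coord_lborel I) S)"
    by (rule LIMSEQ_le_const) (use hausdorff_outer_open_le_iter[OF I S] in blast)
  then show ?thesis using S(2) by (simp add: emeasure_eq_ennreal_measure)
qed

lemma hausdorff_outer_bounded_le:
  fixes I :: "'a::euclidean_space set"
  assumes I: "I \<subseteq> Basis" and A: "A \<in> sets borel" "A \<subseteq> coord_span I" "A \<subseteq> ball 0 R"
  shows "hausdorff_outer (card I) A \<le> emeasure (coord_lborel I) A"
proof -
  let ?m = "coord_lborel I"
  have fin: "emeasure ?m (ball 0 R) < top"
  proof -
    have "emeasure ?m (ball 0 R) \<le> emeasure ?m (cball 0 (max R 1))"
      by (rule emeasure_mono) auto
    also have "\<dots> < top" by (subst emeasure_coord_lborel_cball_0[OF I]) auto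
    finally show ?thesis .
  qed
  \<comment> \<open>Outer regularity is applied to a finite measure, so
    \<open>coord_lborel I\<close> is cut off outside a ball containing A.\<close>
  define M where "M = density ?m (indicator (ball 0 R))"
  have sM: "sets M = sets borel" and spM: "space M = UNIV" by (simp_all add: M_def)
  have [measurable]: "(indicator (ball 0 R) :: 'a \<Rightarrow> ennreal) \<in> borel_measurable ?m"
    by (intro borel_measurable_indicator) simp
  have eM: "emeasure M B = emeasure ?m (B \<inter> ball 0 R)" if "B \<in> sets borel" for B
    unfolding M_def using that
    by (subst emeasure_density) (auto simp: indicator_inter_arith[symmetric] mult.commute Int_commute nn_integral_indicator[symmetric] simp del: nn_integral_indicator intro!: nn_integral_cong)
  have "emeasure M A = (INF U\<in>{U. A \<subseteq> U \<and> open U}. emeasure M U)"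
    by (rule outer_regular[OF sM _ A(1)]) (use fin in \<open>simp add: spM eM\<close>)
  moreover have "hausdorff_outer (card I) A \<le> emeasure M U" if U: "A \<subseteq> U" "open U" for U
  proof -
    have "hausdorff_outer (card I) A \<le> hausdorff_outer (card I) ((U \<inter> ball 0 R) \<inter> coord_span I)"
      using U A by (intro hausdorff_outer_mono) auto
    also have "\<dots> \<le> emeasure ?m (U \<inter> ball 0 R)"
    proof (rule hausdorff_outer_open_le[OF I])
      have "emeasure ?m (U \<inter> ball 0 R) \<le> emeasure ?m (ball 0 R)" by (rule emeasure_mono) auto
      then show "emeasure ?m (U \<inter> ball 0 R) < top" using fin by (rule order_le_less_trans)
    qed (use U in auto)
    finally show ?thesis using eM[of U] U by auto
  qed
  ultimately have "hausdorff_outer (card I) A \<le> emeasure M A" by (auto intro!: INF_greatest)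
  also have "\<dots> = emeasure ?m A" using A by (simp add: eM Int_absorb2)
  finally show ?thesis .
qed

theorem hausdorff_measure_coord_span:
  fixes I :: "'a::euclidean_space set"
  assumes I: "I \<subseteq> Basis" and A: "A \<in> sets borel" "A \<subseteq> coord_span I"
  shows "hausdorff_outer (card I) A = emeasure (coord_lborel I) A"
proof (rule antisym)
  let ?A = "\<lambda>n. A \<inter> ball 0 (real n)"
  have inc: "incseq ?A" by (auto simp: incseq_def intro: less_le_trans)
  have U: "(\<Union>n. ?A n) = A" by (auto simp: reals_Archimedean2)
  have "hausdorff_outer (card I) A = emeasure (hausdorff_measure (card I)) A"
    using A by (simp add: emeasure_hausdorff_measure)
  also have "\<dots> = (SUP n. emeasure (hausdorff_measure (card I)) (?A n))"
    using inc A by (subst SUP_emeasure_incseq) (auto simp: U simp del: UN_simps)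
  also have "\<dots> \<le> emeasure (coord_lborel I) A"
  proof (rule SUP_least)
    fix n
    have "emeasure (hausdorff_measure (card I)) (?A n) = hausdorff_outer (card I) (?A n)"
      using A by (simp add: emeasure_hausdorff_measure)
    also have "\<dots> \<le> emeasure (coord_lborel I) (?A n)"
      using A by (intro hausdorff_outer_bounded_le[OF I, of _ "real n"]) auto
    also have "\<dots> \<le> emeasure (coord_lborel I) A" using A by (intro emeasure_mono) auto
    finally show "emeasure (hausdorff_measure (card I)) (?A n) \<le> emeasure (coord_lborel I) A" .
  qed
  finally show "hausdorff_outer (card I) A \<le> emeasure (coord_lborel I) A" .
  show "emeasure (coord_lborel I) A \<le> hausdorff_outer (card I) A"
    by (rule coord_lborel_le_hausdorff_outer[OF I A])
qed

corollary hausdorff_outer_eq_lborel: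
  fixes A :: "'a::euclidean_space set"
  shows "A \<in> sets borel \<Longrightarrow> hausdorff_outer DIM('a) A = emeasure lborel A"
  using hausdorff_measure_coord_span[of Basis A] by (simp add: coord_lborel_Basis coord_span_def)

section \<open>Cones over hyperplanes and level sets\<close>

lemma hausdorff_outer_similarity:
  fixes f :: "'a::metric_space \<Rightarrow> 'b::metric_space"
  assumes f: "\<And>x y. x \<in> A \<Longrightarrow> y \<in> A \<Longrightarrow> dist (f x) (f y) = L * dist x y" and L: "L > 0"
  shows "hausdorff_outer s (f ` A) = ennreal (L ^ s) * hausdorff_outer s A"
proof (rule antisym)
  show "hausdorff_outer s (f ` A) \<le> ennreal (L ^ s) * hausdorff_outer s A"
    using f L by (intro hausdorff_outer_lipschitz_image) auto
  have inj: "inj_on f A"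
  proof (rule inj_onI)
    fix x y assume "x \<in> A" "y \<in> A" "f x = f y"
    then have "L * dist x y = 0" using f by (metis dist_self)
    then show "x = y" using L by simp
  qed
  have "hausdorff_outer s (inv_into A f ` f ` A) \<le> ennreal ((1 / L) ^ s) * hausdorff_outer s (f ` A)"
    using f L inj by (intro hausdorff_outer_lipschitz_image) auto
  also have "inv_into A f ` f ` A = A" using inj by simp
  finally have "ennreal (L ^ s) * hausdorff_outer s A \<le> ennreal (L ^ s) * (ennreal ((1 / L) ^ s) * hausdorff_outer s (f ` A))"
    by (rule mult_left_mono) simp
  also have "\<dots> = hausdorff_outer s (f ` A)"
    using L by (simp add: mult.assoc[symmetric] ennreal_mult[symmetric] power_mult_distrib[symmetric])
  finally show "ennreal (L ^ s) * hausdorff_outer s A \<le> hausdorff_outer s (f ` A)" .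
qed

lemma emeasure_lborel_scale:
  fixes A :: "'a::euclidean_space set"
  assumes A: "A \<in> sets borel" and r: "r > 0"
  shows "(*\<^sub>R) r ` A \<in> sets borel" "emeasure lborel ((*\<^sub>R) r ` A) = ennreal (r ^ DIM('a)) * emeasure lborel A"
proof -
  have "(*\<^sub>R) r ` A = (\<lambda>x. x /\<^sub>R r) -` A \<inter> space borel"
    using r by (force simp: image_iff)
  also have "\<dots> \<in> sets borel" using A by measurable
  finally show b: "(*\<^sub>R) r ` A \<in> sets borel" .
  show "emeasure lborel ((*\<^sub>R) r ` A) = ennreal (r ^ DIM('a)) * emeasure lborel A"
    unfolding hausdorff_outer_eq_lborel[OF b, symmetric] hausdorff_outer_eq_lborel[OF A, symmetric]
    using r by (intro hausdorff_outer_similarity) (simp_all add: dist_norm scaleR_diff_right[symmetric])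
qed

text \<open>The apex is left out, so that over a piece of a hyperplane off the origin, or of a level
  set, every point of the cone determines its multiplier t and its base point.\<close>

definition cone_over :: "'a::real_vector set \<Rightarrow> 'a set" where
  "cone_over A = {t *\<^sub>R a | t a. 0 < t \<and> t \<le> 1 \<and> a \<in> A}"

lemma cone_over_hyperplane:
  fixes A :: "'a::euclidean_space set"
  assumes A: "A \<subseteq> {x. x \<bullet> v = h}" and h: "h > 0"
  shows "cone_over A = {z. 0 < z \<bullet> v \<and> z \<bullet> v \<le> h \<and> (h / (z \<bullet> v)) *\<^sub>R z \<in> A}"
proof (intro set_eqI iffI)
  fix z assume "z \<in> cone_over A"
  then obtain t a where "0 < t" "t \<le> 1" "a \<in> A" "z = t *\<^sub>R a" by (auto simp: cone_over_def)
  moreover then have "z \<bullet> v = t * h" using A by auto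
  ultimately show "z \<in> {z. 0 < z \<bullet> v \<and> z \<bullet> v \<le> h \<and> (h / (z \<bullet> v)) *\<^sub>R z \<in> A}"
    using h by (simp add: mult_le_cancel_right1 field_simps)
next
  fix z assume z: "z \<in> {z. 0 < z \<bullet> v \<and> z \<bullet> v \<le> h \<and> (h / (z \<bullet> v)) *\<^sub>R z \<in> A}"
  then have "z = ((z \<bullet> v) / h) *\<^sub>R ((h / (z \<bullet> v)) *\<^sub>R z)" using h by simp
  moreover have "0 < (z \<bullet> v) / h" "(z \<bullet> v) / h \<le> 1" using z h by auto
  ultimately show "z \<in> cone_over A" using z unfolding cone_over_def by blast
qed

lemma cone_over_hyperplane_borel:
  fixes A :: "'a::euclidean_space set"
  assumes A: "A \<subseteq> {x. x \<bullet> v = h}" "A \<in> sets borel" and h: "h > 0"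
  shows "cone_over A \<in> sets borel"
proof -
  have "{z. 0 < z \<bullet> v \<and> z \<bullet> v \<le> h \<and> (h / (z \<bullet> v)) *\<^sub>R z \<in> A} \<in> sets borel"
    using A(2) by measurable
  then show ?thesis using cone_over_hyperplane[OF A(1) h] by simp
qed

text \<open>Serves as the factor of the pyramid volume: the slice at height t is the base scaled by
  \<open>t / h\<close>.\<close>

lemma nn_integral_power_Icc:
  assumes h: "h > 0" and n: "n > 0"
  shows "(\<integral>\<^sup>+t. indicator {0<..h} t * ennreal ((t / h) ^ (n - 1)) \<partial>lborel) = ennreal (h / real n)"
proof -
  have "(\<integral>\<^sup>+t. indicator {0<..h} t * ennreal ((t / h) ^ (n - 1)) \<partial>lborel)
      = (\<integral>\<^sup>+t. ennreal ((t / h) ^ (n - 1)) * indicator {0..h} t \<partial>lborel)"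
    by (rule nn_integral_cong_AE) (use AE_lborel_singleton[of "0::real"] in \<open>eventually_elim, auto simp: indicator_def\<close>)
  also have "\<dots> = ennreal (h * (h / h) ^ n / real n - h * (0 / h) ^ n / real n)"
  proof (rule nn_integral_FTC_Icc)
    fix t :: real
    have "((\<lambda>t. h * (t / h) ^ n / real n) has_real_derivative (h * (real n * (t / h) ^ (n - Suc 0) * (1 / h)) / real n)) (at t)"
      by (auto intro!: derivative_eq_intros)
    then show "((\<lambda>t. h * (t / h) ^ n / real n) has_real_derivative (t / h) ^ (n - 1)) (at t)"
      using h n by simp
  qed (use h in auto)
  also have "\<dots> = ennreal (h / real n)" using h n by (simp add: power_0_left)
  finally show ?thesis .
qed

text \<open>Cavalieri's principle. Slices perpendicular to v can be moved into a coordinate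
  subspace, where Lebesgue and Hausdorff measure agree; the base, which lies in a parallel affine
  hyperplane, enters only through its similarity to the slices.\<close>

lemma emeasure_cone_over_axis:
  fixes A :: "'a::euclidean_space set"
  assumes v: "v \<in> Basis" and A: "A \<subseteq> {x. x \<bullet> v = h}" "A \<in> sets borel" and h: "h > 0"
  shows "emeasure lborel (cone_over A) = ennreal (h / real DIM('a)) * hausdorff_outer (DIM('a) - 1) A"
proof -
  define I where "I = Basis - {v}"
  have I: "insert v I \<subseteq> Basis" "v \<notin> I" "insert v I = Basis" "I \<subseteq> Basis" and cI: "card I = DIM('a) - 1"
    using v by (auto simp: I_def)
  note [measurable] = cone_over_hyperplane_borel[OF A h] A(2)
  have slice: "emeasure (coord_lborel I) {x. x + t *\<^sub>R v \<in> cone_over A}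
      = indicator {0<..h} t * ennreal ((t / h) ^ (DIM('a) - 1)) * hausdorff_outer (DIM('a) - 1) A" for t
  proof -
    let ?S = "{x. x + t *\<^sub>R v \<in> cone_over A} \<inter> coord_span I"
    have [measurable]: "{x. x + t *\<^sub>R v \<in> cone_over A} \<in> sets borel" by measurable
    have S: "?S \<in> sets borel" using coord_span_closed[of I] by (intro sets.Int) auto
    have "emeasure (coord_lborel I) {x. x + t *\<^sub>R v \<in> cone_over A} = emeasure (coord_lborel I) ?S"
      by (rule emeasure_coord_lborel_Int_span[OF I(4), symmetric]) measurable
    also have "\<dots> = hausdorff_outer (DIM('a) - 1) ?S"
      using hausdorff_measure_coord_span[OF I(4) S] cI by simp
    finally have e: "emeasure (coord_lborel I) {x. x + t *\<^sub>R v \<in> cone_over A} = hausdorff_outer (DIM('a) - 1) ?S" .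
    have xv: "(x + t *\<^sub>R v) \<bullet> v = t" if "x \<in> coord_span I" for x
      using that v by (auto simp: coord_span_def I_def inner_add_left)
    show ?thesis
    proof (cases "0 < t \<and> t \<le> h")
      case True
      have "?S = (\<lambda>a. (t / h) *\<^sub>R (a - h *\<^sub>R v)) ` A"
      proof (intro set_eqI iffI)
        fix x assume x: "x \<in> ?S"
        then have "(h / t) *\<^sub>R (x + t *\<^sub>R v) \<in> A"
          unfolding cone_over_hyperplane[OF A(1) h] using xv[of x] by simp
        moreover have "x = (t / h) *\<^sub>R ((h / t) *\<^sub>R (x + t *\<^sub>R v) - h *\<^sub>R v)"
          using True by (simp add: algebra_simps)
        ultimately show "x \<in> (\<lambda>a. (t / h) *\<^sub>R (a - h *\<^sub>R v)) ` A" by blast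
      next
        fix x assume "x \<in> (\<lambda>a. (t / h) *\<^sub>R (a - h *\<^sub>R v)) ` A"
        then obtain a where a: "a \<in> A" "x = (t / h) *\<^sub>R (a - h *\<^sub>R v)" by auto
        have "a \<bullet> v = h" using a A by auto
        then have "x \<in> coord_span I" using v by (auto simp: a coord_span_def I_def inner_diff_left)
        moreover have "x + t *\<^sub>R v = (t / h) *\<^sub>R a" using h by (simp add: a algebra_simps)
        then have "x + t *\<^sub>R v \<in> cone_over A" unfolding cone_over_def using True a h
          by (intro CollectI exI[of _ "t / h"] exI[of _ a]) auto
        ultimately show "x \<in> ?S" by simp
      qed
      then have "hausdorff_outer (DIM('a) - 1) ?S = ennreal ((t / h) ^ (DIM('a) - 1)) * hausdorff_outer (DIM('a) - 1) A"
        using True h by (simp only:) (intro hausdorff_outer_similarity, auto simp: dist_norm scaleR_diff_right[symmetric])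
      then show ?thesis unfolding e using True by simp
    next
      case False
      have "?S = {}" unfolding cone_over_hyperplane[OF A(1) h] using xv False by auto
      then show ?thesis unfolding e using False by (auto simp: hausdorff_outer_empty)
    qed
  qed
  have "emeasure lborel (cone_over A) = emeasure (coord_lborel (insert v I)) (cone_over A)"
    by (simp add: I coord_lborel_Basis)
  also have "\<dots> = (\<integral>\<^sup>+t. emeasure (coord_lborel I) {x. x + t *\<^sub>R v \<in> cone_over A} \<partial>lborel)"
    by (rule emeasure_coord_lborel_insert(2)[OF I(1,2)]) measurable
  also have "\<dots> = (\<integral>\<^sup>+t. indicator {0<..h} t * ennreal ((t / h) ^ (DIM('a) - 1)) * hausdorff_outer (DIM('a) - 1) A \<partial>lborel)"
    by (simp only: slice)
  also have "\<dots> = (\<integral>\<^sup>+t. indicator {0<..h} t * ennreal ((t / h) ^ (DIM('a) - 1)) \<partial>lborel) * hausdorff_outer (DIM('a) - 1) A"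
    by (rule nn_integral_multc) measurable
  also have "\<dots> = ennreal (h / real DIM('a)) * hausdorff_outer (DIM('a) - 1) A"
    by (subst nn_integral_power_Icc[OF h]) auto
  finally show ?thesis .
qed

text \<open>An orthogonal map takes v to a basis vector. It preserves the Hausdorff measures of
  dimension n and n - 1 alike, and volume is the former.\<close>

lemma emeasure_cone_over_hyperplane:
  fixes A :: "(real ^ 'n) set"
  assumes v: "norm v = 1" and A: "A \<subseteq> {x. x \<bullet> v = h}" "A \<in> sets borel" and h: "h > 0"
  shows "emeasure lborel (cone_over A) = ennreal (h / real CARD('n)) * hausdorff_outer (CARD('n) - 1) A"
proof -
  obtain b :: "real ^ 'n" where b: "b \<in> Basis" using nonempty_Basis by blast
  obtain f where f: "orthogonal_transformation f" "f v = b"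
    using orthogonal_transformation_exists_1[OF v, of b] b by auto
  have lin: "linear f" and inn: "\<And>x y. f x \<bullet> f y = x \<bullet> y"
    using f(1) by (auto simp: orthogonal_transformation_def)
  have iso: "dist (f x) (f y) = 1 * dist x y" for x y
    using f(1) by (simp add: orthogonal_transformation_isometry)
  have borel: "f ` B \<in> sets borel" if "B \<in> sets borel" for B
  proof -
    have "bij f" using f(1) orthogonal_transformation_bij by blast
    then have "f ` B = inv f -` B \<inter> space borel" by (simp add: bij_vimage_eq_inv_image bij_imp_bij_inv inv_inv_eq)
    moreover have "linear (inv f)" using f(1) orthogonal_transformation_inv orthogonal_transformation_linear by blast
    then have "inv f \<in> borel_measurable borel" by (intro borel_measurable_continuous_onI linear_continuous_on linear_conv_bounded_linear[THEN iffD1])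
    ultimately show ?thesis using that by (metis measurable_sets)
  qed
  note CA = cone_over_hyperplane_borel[OF A h]
  have c: "cone_over (f ` A) = f ` cone_over A"
    unfolding cone_over_def using linear_scale[OF lin] by (auto simp: image_iff) (metis linear_scale[OF lin])+
  have "emeasure lborel (cone_over (f ` A)) = hausdorff_outer CARD('n) (f ` cone_over A)"
    unfolding c using hausdorff_outer_eq_lborel[OF borel[OF CA]] by simp
  also have "\<dots> = hausdorff_outer CARD('n) (cone_over A)"
    by (subst hausdorff_outer_similarity[where L=1]) (use iso in auto)
  also have "\<dots> = emeasure lborel (cone_over A)"
    using hausdorff_outer_eq_lborel[OF CA] by simp
  finally have 1: "emeasure lborel (cone_over (f ` A)) = emeasure lborel (cone_over A)" .
  have "emeasure lborel (cone_over (f ` A)) = ennreal (h / real DIM(real ^ 'n)) * hausdorff_outer (DIM(real ^ 'n) - 1) (f ` A)"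
    by (rule emeasure_cone_over_axis[OF b]) (use A borel inn[of _ v] f(2) h in auto)
  also have "hausdorff_outer (DIM(real ^ 'n) - 1) (f ` A) = hausdorff_outer (CARD('n) - 1) A"
    by (subst hausdorff_outer_similarity[where L=1]) (use iso in auto)
  finally show ?thesis using 1 by simp
qed

lemma hausdorff_outer_bilipschitz_ge:
  fixes f :: "'a::metric_space \<Rightarrow> 'b::metric_space"
  assumes f: "\<And>x y. x \<in> A \<Longrightarrow> y \<in> A \<Longrightarrow> dist x y \<le> L * dist (f x) (f y)" and L: "L > 0"
  shows "hausdorff_outer s A \<le> ennreal (L ^ s) * hausdorff_outer s (f ` A)"
proof -
  have inj: "inj_on f A"
    using f by (intro inj_onI) (metis dist_self mult_zero_right dist_le_zero_iff)
  have "hausdorff_outer s (inv_into A f ` f ` A) \<le> ennreal (L ^ s) * hausdorff_outer s (f ` A)"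
    using f L inj by (intro hausdorff_outer_lipschitz_image) auto
  then show ?thesis using inj by simp
qed

lemma emeasure_cone_over_finite:
  fixes A :: "'a::euclidean_space set"
  assumes "bounded A" shows "emeasure lborel (cone_over A) < top"
proof -
  obtain B where B: "\<And>x. x \<in> A \<Longrightarrow> norm x \<le> B" using assms bounded_iff by blast
  have "cone_over A \<subseteq> cball 0 B"
  proof
    fix z assume "z \<in> cone_over A"
    then obtain t a where t: "0 < t" "t \<le> 1" "a \<in> A" "z = t *\<^sub>R a" by (auto simp: cone_over_def)
    have "norm z \<le> 1 * norm a" unfolding t(4) norm_scaleR using t by (intro mult_right_mono) auto
    then show "z \<in> cball 0 B" using B[OF t(3)] by simp
  qed
  then have "emeasure lborel (cone_over A) \<le> emeasure lborel (cball 0 B :: 'a set)"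
    by (rule emeasure_mono) simp
  also have "\<dots> < top" using emeasure_bounded_finite[of "cball 0 B :: 'a set"] by (simp add: less_top)
  finally show ?thesis .
qed

text \<open>The shell is the cone minus its copy scaled by q. The ray condition makes the multiplier
  of a point unique, so that the two do not interfere, and the finite volume of the cone permits the
  subtraction.\<close>

lemma emeasure_shell:
  fixes A :: "'a::euclidean_space set"
  assumes ray: "\<And>a a' s t. a \<in> A \<Longrightarrow> a' \<in> A \<Longrightarrow> 0 < s \<Longrightarrow> 0 < t \<Longrightarrow> s *\<^sub>R a = t *\<^sub>R a' \<Longrightarrow> s = t"
    and C: "cone_over A \<in> sets borel" and A: "bounded A" and q: "0 < q" "q < 1"
  defines "S \<equiv> {t *\<^sub>R a | t a. q < t \<and> t \<le> 1 \<and> a \<in> A}"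
  shows "S \<in> sets borel" "emeasure lborel S = ennreal (1 - q ^ DIM('a)) * emeasure lborel (cone_over A)"
proof -
  have "S = cone_over A - (*\<^sub>R) q ` cone_over A"
  proof (intro set_eqI iffI)
    fix z assume "z \<in> S"
    then obtain t a where z: "q < t" "t \<le> 1" "a \<in> A" "z = t *\<^sub>R a" by (auto simp: S_def)
    then have "z \<in> cone_over A" unfolding cone_over_def using q by force
    moreover have "z \<notin> (*\<^sub>R) q ` cone_over A"
    proof
      assume "z \<in> (*\<^sub>R) q ` cone_over A"
      then obtain s a' where s: "0 < s" "s \<le> 1" "a' \<in> A" "z = (q * s) *\<^sub>R a'" by (auto simp: cone_over_def)
      then have "t = q * s" using ray[of a a' t "q * s"] z q by simp
      moreover have "q * s \<le> q * 1" using s q by (intro mult_left_mono) auto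
      ultimately show False using z by simp
    qed
    ultimately show "z \<in> cone_over A - (*\<^sub>R) q ` cone_over A" by blast
  next
    fix z assume z: "z \<in> cone_over A - (*\<^sub>R) q ` cone_over A"
    then obtain t a where t: "0 < t" "t \<le> 1" "a \<in> A" "z = t *\<^sub>R a" by (auto simp: cone_over_def)
    have "q < t"
    proof (rule ccontr)
      assume "\<not> q < t"
      then have "(t / q) *\<^sub>R a \<in> cone_over A" unfolding cone_over_def using t q by force
      moreover have "z = q *\<^sub>R ((t / q) *\<^sub>R a)" using t q by simp
      ultimately show False using z by blast
    qed
    then show "z \<in> S" using t by (auto simp: S_def)
  qed
  note S = this
  note sc = emeasure_lborel_scale[OF C q(1)]
  show "S \<in> sets borel" unfolding S using C sc by auto
  have sub: "(*\<^sub>R) q ` cone_over A \<subseteq> cone_over A"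
  proof
    fix z assume "z \<in> (*\<^sub>R) q ` cone_over A"
    then obtain s a' where s: "0 < s" "s \<le> 1" "a' \<in> A" "z = (q * s) *\<^sub>R a'" by (auto simp: cone_over_def)
    moreover have "q * s \<le> 1" using s q mult_le_one[of q s] by simp
    ultimately show "z \<in> cone_over A" unfolding cone_over_def using q by (intro CollectI exI[of _ "q * s"] exI[of _ a']) auto
  qed
  have fin: "emeasure lborel (cone_over A) < top" by (rule emeasure_cone_over_finite[OF A])
  then obtain m where m: "emeasure lborel (cone_over A) = ennreal m" "m \<ge> 0"
    by (cases "emeasure lborel (cone_over A)") auto
  have q1: "q ^ DIM('a) \<le> 1" using q by (intro power_le_one) auto
  have fs: "emeasure lborel ((*\<^sub>R) q ` cone_over A) \<noteq> \<infinity>"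
    unfolding sc(2) m(1) using m q by (simp add: ennreal_mult[symmetric])
  have "emeasure lborel S = emeasure lborel (cone_over A) - emeasure lborel ((*\<^sub>R) q ` cone_over A)"
    unfolding S using C sc sub fs by (intro emeasure_Diff) auto
  also have "\<dots> = ennreal (m - q ^ DIM('a) * m)"
    unfolding sc(2) m(1) using m q q1 by (simp add: ennreal_mult[symmetric] ennreal_minus)
  also have "\<dots> = ennreal (1 - q ^ DIM('a)) * emeasure lborel (cone_over A)"
    unfolding m(1) using m q1 by (simp add: ennreal_mult[symmetric] algebra_simps)
  finally show "emeasure lborel S = ennreal (1 - q ^ DIM('a)) * emeasure lborel (cone_over A)" .
qed

section \<open>Level sets of homogeneous functions\<close>

lemma isCont_eventually_less:
  fixes f :: "'a::t2_space \<Rightarrow> real"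
  assumes "isCont f p"
  shows "f p < c \<Longrightarrow> \<forall>\<^sub>F z in nhds p. f z < c" "c < f p \<Longrightarrow> \<forall>\<^sub>F z in nhds p. c < f z"
proof -
  have "(f \<longlongrightarrow> f p) (nhds p)"
    using assms unfolding isCont_def by (simp add: tendsto_at_iff_tendsto_nhds)
  then show "f p < c \<Longrightarrow> \<forall>\<^sub>F z in nhds p. f z < c" "c < f p \<Longrightarrow> \<forall>\<^sub>F z in nhds p. c < f z"
    by (auto intro: order_tendstoD)
qed

locale homogeneous_C1 =
  fixes g :: "real ^ 'n \<Rightarrow> real" and D :: "real ^ 'n \<Rightarrow> real ^ 'n" and d :: nat and b :: real
  assumes deriv: "\<And>z. (g has_derivative (\<lambda>u. D z \<bullet> u)) (at z)"
    and contD: "continuous_on UNIV D"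
    and homog: "\<And>t z. t > 0 \<Longrightarrow> g (t *\<^sub>R z) = t ^ d * g z"
    and d_pos: "d > 0" and b_pos: "b > 0"
begin

lemma cont_g: "continuous_on UNIV g"
  using deriv by (meson continuous_on_eq_continuous_at has_derivative_continuous open_UNIV)

lemma g_borel [measurable]: "g \<in> borel_measurable borel"
  by (rule borel_measurable_continuous_onI[OF cont_g])

lemma D_borel [measurable]: "D \<in> borel_measurable borel"
  by (rule borel_measurable_continuous_onI[OF contD])

text \<open>Both sides are the derivative of \<open>g (t *\<^sub>R z)\<close> with respect to t at
  1.\<close>

lemma euler: "D z \<bullet> z = real d * g z"
proof -
  have "((\<lambda>t. g (t *\<^sub>R z)) has_derivative (\<lambda>s. D (1 *\<^sub>R z) \<bullet> (s *\<^sub>R z))) (at 1)"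
    by (rule has_derivative_compose[of "\<lambda>t. t *\<^sub>R z" "\<lambda>s. s *\<^sub>R z" 1 UNIV g])
      (auto intro!: derivative_eq_intros deriv)
  then have 1: "((\<lambda>t. g (t *\<^sub>R z)) has_real_derivative (D z \<bullet> z)) (at 1)"
    by (rule has_derivative_imp_has_field_derivative) simp
  have "((\<lambda>t. t ^ d * g z) has_real_derivative (real d * g z)) (at 1)"
    by (auto intro!: derivative_eq_intros)
  then have "((\<lambda>t. g (t *\<^sub>R z)) has_real_derivative (real d * g z)) (at 1)"
    by (rule has_field_derivative_transform_within[where d=1])
      (auto simp: homog dist_real_def)
  then show ?thesis using 1 DERIV_unique by blast
qed

text \<open>The radial coordinate for the level set: a point \<open>t *\<^sub>R a\<close> with
  \<open>g a = b\<close> and t > 0 has gauge t. It has this meaning only where g is positive, but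
  \<open>root\<close> is continuous on all reals, so the gauge is Borel everywhere.\<close>

definition gauge where "gauge z = root d (g z / b)"

lemma gauge_pos: "g z > 0 \<Longrightarrow> gauge z > 0"
  using d_pos b_pos by (simp add: gauge_def)

lemma gauge_scale: "t > 0 \<Longrightarrow> gauge (t *\<^sub>R z) = t * gauge z"
  using d_pos unfolding gauge_def homog
  by (simp add: real_root_mult real_root_pos2 times_divide_eq_right[symmetric] del: times_divide_eq_right)

lemma gauge_eq_1: "g z = b \<Longrightarrow> gauge z = 1"
  using d_pos b_pos by (simp add: gauge_def)

definition retract where "retract z = z /\<^sub>R gauge z"

lemma retract_scale: "t > 0 \<Longrightarrow> retract (t *\<^sub>R z) = retract z"
  by (cases "gauge z = 0") (simp_all add: retract_def gauge_scale)

lemma retract_eq: "g z = b \<Longrightarrow> retract z = z"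
  by (simp add: retract_def gauge_eq_1)

lemma gauge_borel [measurable]: "gauge \<in> borel_measurable borel"
proof -
  have "continuous_on UNIV gauge"
    unfolding gauge_def by (intro continuous_intros cont_g) (use b_pos in auto)
  then show ?thesis by (rule borel_measurable_continuous_onI)
qed

lemma retract_borel [measurable]: "retract \<in> borel_measurable borel"
  unfolding retract_def by measurable

lemma cone_over_level:
  assumes A: "A \<subseteq> {x. g x = b}"
  shows "cone_over A = {z. 0 < g z \<and> gauge z \<le> 1 \<and> retract z \<in> A}"
proof (intro set_eqI iffI)
  fix z assume "z \<in> cone_over A"
  then obtain t a where t: "0 < t" "t \<le> 1" "a \<in> A" "z = t *\<^sub>R a" by (auto simp: cone_over_def)
  then have "g a = b" using A by auto
  then show "z \<in> {z. 0 < g z \<and> gauge z \<le> 1 \<and> retract z \<in> A}"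
    using t b_pos by (simp add: homog gauge_scale gauge_eq_1 retract_scale retract_eq)
next
  fix z assume z: "z \<in> {z. 0 < g z \<and> gauge z \<le> 1 \<and> retract z \<in> A}"
  then have "z = gauge z *\<^sub>R retract z" using gauge_pos[of z] by (simp add: retract_def)
  then show "z \<in> cone_over A" using z gauge_pos[of z] unfolding cone_over_def by blast
qed

lemma cone_over_level_borel:
  assumes A: "A \<subseteq> {x. g x = b}" "A \<in> sets borel"
  shows "cone_over A \<in> sets borel"
  unfolding cone_over_level[OF A(1)] using A(2) by measurable

lemma level_ray:
  assumes "g a = b" "g a' = b" "0 < s" "0 < t" "s *\<^sub>R a = t *\<^sub>R a'"
  shows "s = t"
  using assms gauge_scale[of s a] gauge_scale[of t a'] by (simp add: gauge_eq_1)

text \<open>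
  On rays, \<open>\<lambda>z. \<phi> z *\<^sub>R z\<close> is linear, and it maps the level set through p to the tangent hyperplane
  \<open>x \<bullet> v = h\<close>. By Euler's identity the derivative of \<open>\<phi>\<close> vanishes at p.
\<close>

lemma near_identity:
  assumes p: "g p = b" and L: "L > 1"
  defines "v \<equiv> D p /\<^sub>R norm (D p)" and "h \<equiv> real d * b / norm (D p)"
  defines "\<phi> \<equiv> \<lambda>z. exp (ln (g z / b) / real d - ln (z \<bullet> v / h))"
  shows "norm v = 1" "h > 0" "D p \<noteq> 0"
    "\<exists>r>0. (\<forall>z\<in>ball p r. g z > 0 \<and> z \<bullet> v > 0) \<and>
       (\<forall>x\<in>ball p r. \<forall>y\<in>ball p r. dist (\<phi> x *\<^sub>R x) (\<phi> y *\<^sub>R y) \<le> L * dist x y \<and>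
          dist x y \<le> L * dist (\<phi> x *\<^sub>R x) (\<phi> y *\<^sub>R y))"
proof -
  have Dpp: "D p \<bullet> p = real d * b" using euler[of p] p by simp
  then show D0: "D p \<noteq> 0" using d_pos b_pos by auto
  show v: "norm v = 1" using D0 by (simp add: v_def)
  show h: "h > 0" using D0 d_pos b_pos by (simp add: h_def)
  have pv: "p \<bullet> v = h" by (simp add: v_def h_def inner_commute[of p] Dpp divide_inverse)
  have Dv: "D p = norm (D p) *\<^sub>R v" using D0 by (simp add: v_def)
  \<comment> \<open>This value satisfies both \<open>1 + \<epsilon> \<le> L\<close> and
    \<open>1 - \<epsilon> = 1 / L\<close>, one for each of the two Lipschitz bounds.\<close>
  define \<epsilon> where "\<epsilon> = (L - 1) / L"
  have \<epsilon>: "\<epsilon> > 0" using L by (simp add: \<epsilon>_def)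
  define M where "M = norm p + 1"
  have M: "M > 0" by (simp add: M_def add_nonneg_pos)
  \<comment> \<open>The norm of the gradient of \<phi> at z. At p both vectors in the difference
    equal \<open>v /\<^sub>R h\<close>, so it vanishes there.\<close>
  define N where "N z = \<phi> z * norm (D z /\<^sub>R (real d * g z) - v /\<^sub>R (z \<bullet> v))" for z
  have cg: "isCont g p" using cont_g by (simp add: continuous_on_eq_continuous_at)
  have cD: "isCont D p" using contD by (simp add: continuous_on_eq_continuous_at)
  have c\<phi>: "isCont \<phi> p" unfolding \<phi>_def
    by (intro continuous_intros cg) (use p b_pos h pv d_pos in auto)
  have cN: "isCont N p" unfolding N_def
    by (intro continuous_intros c\<phi> cD cg) (use p b_pos h pv d_pos in auto)
  have \<phi>p: "\<phi> p = 1" using p b_pos h pv by (simp add: \<phi>_def)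
  have "D p /\<^sub>R (real d * g p) = v /\<^sub>R (p \<bullet> v)"
    using D0 d_pos b_pos by (subst Dv) (simp add: pv p h_def field_simps)
  then have Np: "N p = 0" by (simp add: N_def)
  have "\<forall>\<^sub>F z in nhds p. g z > 0 \<and> z \<bullet> v > 0 \<and> \<bar>\<phi> z - 1\<bar> < \<epsilon> / 2 \<and> N z < \<epsilon> / (2 * M)"
  proof (intro eventually_conj)
    show "\<forall>\<^sub>F z in nhds p. g z > 0"
      using cg p b_pos by (intro isCont_eventually_less) auto
    have "isCont (\<lambda>z. z \<bullet> v) p" by (intro continuous_intros)
    then show "\<forall>\<^sub>F z in nhds p. z \<bullet> v > 0"
      using h pv by (intro isCont_eventually_less) auto
    have "isCont (\<lambda>z. \<bar>\<phi> z - 1\<bar>) p" by (intro continuous_intros c\<phi>)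
    then show "\<forall>\<^sub>F z in nhds p. \<bar>\<phi> z - 1\<bar> < \<epsilon> / 2"
      using \<epsilon> by (intro isCont_eventually_less) (auto simp: \<phi>p)
    show "\<forall>\<^sub>F z in nhds p. N z < \<epsilon> / (2 * M)"
      using cN \<epsilon> M by (intro isCont_eventually_less) (auto simp: Np)
  qed
  then obtain r0 where r0: "r0 > 0"
    "\<And>z. dist z p < r0 \<Longrightarrow> g z > 0 \<and> z \<bullet> v > 0 \<and> \<bar>\<phi> z - 1\<bar> < \<epsilon> / 2 \<and> N z < \<epsilon> / (2 * M)"
    unfolding eventually_nhds_metric by blast
  define r where "r = min r0 1"
  have r: "r > 0" "r \<le> 1" using r0 by (auto simp: r_def)
  have r1: "g z > 0" "z \<bullet> v > 0" "\<bar>\<phi> z - 1\<bar> < \<epsilon> / 2" "N z < \<epsilon> / (2 * M)" if "z \<in> ball p r" for z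
    using r0(2)[of z] that by (auto simp: r_def dist_commute)
  have der: "(\<phi> has_derivative (\<lambda>u. \<phi> z * ((D z \<bullet> u) / (real d * g z) - (u \<bullet> v) / (z \<bullet> v)))) (at z within ball p r)"
    if "z \<in> ball p r" for z
  proof -
    have "(g has_derivative (\<lambda>u. D z \<bullet> u)) (at z within ball p r)"
      using deriv has_derivative_at_withinI by blast
    then show ?thesis
      unfolding \<phi>_def using r1(1,2)[OF that] b_pos h d_pos
      by (auto intro!: derivative_eq_intros simp: fun_eq_iff divide_simps)
  qed
  have on: "onorm (\<lambda>u. \<phi> z * ((D z \<bullet> u) / (real d * g z) - (u \<bullet> v) / (z \<bullet> v))) \<le> \<epsilon> / (2 * M)"
    if "z \<in> ball p r" for z
  proof (rule onorm_le)
    fix u :: "real ^ 'n"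
    have "(D z \<bullet> u) / (real d * g z) - (u \<bullet> v) / (z \<bullet> v) = (D z /\<^sub>R (real d * g z) - v /\<^sub>R (z \<bullet> v)) \<bullet> u"
      by (simp add: inner_diff_left inner_commute[of u v] divide_inverse mult_ac)
    then have "norm (\<phi> z * ((D z \<bullet> u) / (real d * g z) - (u \<bullet> v) / (z \<bullet> v)))
        \<le> \<phi> z * (norm (D z /\<^sub>R (real d * g z) - v /\<^sub>R (z \<bullet> v)) * norm u)"
      using Cauchy_Schwarz_ineq2[of "D z /\<^sub>R (real d * g z) - v /\<^sub>R (z \<bullet> v)" u]
      by (simp add: abs_mult \<phi>_def del: scaleR_scaleR)
    also have "\<dots> = N z * norm u" by (simp add: N_def)
    also have "\<dots> \<le> \<epsilon> / (2 * M) * norm u" using r1(4)[OF that] by (intro mult_right_mono) auto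
    finally show "norm (\<phi> z * ((D z \<bullet> u) / (real d * g z) - (u \<bullet> v) / (z \<bullet> v))) \<le> \<epsilon> / (2 * M) * norm u" .
  qed
  have lip: "\<bar>\<phi> x - \<phi> y\<bar> \<le> \<epsilon> / (2 * M) * norm (x - y)" if "x \<in> ball p r" "y \<in> ball p r" for x y
    using differentiable_bound[OF convex_ball der on that] by simp
  have near: "norm ((\<phi> x *\<^sub>R x - \<phi> y *\<^sub>R y) - (x - y)) \<le> \<epsilon> * norm (x - y)"
    if x: "x \<in> ball p r" and y: "y \<in> ball p r" for x y
  proof -
    have "(\<phi> x *\<^sub>R x - \<phi> y *\<^sub>R y) - (x - y) = (\<phi> x - 1) *\<^sub>R (x - y) + (\<phi> x - \<phi> y) *\<^sub>R y"
      by (simp add: algebra_simps)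
    then have "norm ((\<phi> x *\<^sub>R x - \<phi> y *\<^sub>R y) - (x - y)) \<le> \<bar>\<phi> x - 1\<bar> * norm (x - y) + \<bar>\<phi> x - \<phi> y\<bar> * norm y"
      using norm_triangle_ineq[of "(\<phi> x - 1) *\<^sub>R (x - y)" "(\<phi> x - \<phi> y) *\<^sub>R y"] by simp
    also have "\<dots> \<le> \<epsilon> / 2 * norm (x - y) + (\<epsilon> / (2 * M) * norm (x - y)) * M"
    proof (intro add_mono mult_right_mono mult_mono lip[OF x y])
      show "\<bar>\<phi> x - 1\<bar> \<le> \<epsilon> / 2" using r1(3)[OF x] by simp
      have "norm y \<le> norm p + dist p y" by (metis dist_commute dist_norm norm_triangle_sub)
      then show "norm y \<le> M" using y r by (simp add: M_def)
    qed (use \<epsilon> M in auto)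
    also have "\<dots> = \<epsilon> * norm (x - y)" using M by (simp add: field_simps)
    finally show ?thesis .
  qed
  have "dist (\<phi> x *\<^sub>R x) (\<phi> y *\<^sub>R y) \<le> L * dist x y \<and> dist x y \<le> L * dist (\<phi> x *\<^sub>R x) (\<phi> y *\<^sub>R y)"
    if x: "x \<in> ball p r" and y: "y \<in> ball p r" for x y
  proof
    let ?\<Theta> = "\<phi> x *\<^sub>R x - \<phi> y *\<^sub>R y"
    have n: "norm (?\<Theta> - (x - y)) \<le> \<epsilon> * norm (x - y)" by (rule near[OF x y])
    have "norm ?\<Theta> \<le> (1 + \<epsilon>) * norm (x - y)"
      using n norm_triangle_sub[of ?\<Theta> "x - y"] by (simp add: algebra_simps)
    also have "1 + \<epsilon> \<le> L"
    proof -
      have "0 \<le> (L - 1)\<^sup>2" by simp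
      then show ?thesis using L by (simp add: \<epsilon>_def field_simps power2_eq_square)
    qed
    then have "(1 + \<epsilon>) * norm (x - y) \<le> L * norm (x - y)" by (intro mult_right_mono) auto
    finally show "dist (\<phi> x *\<^sub>R x) (\<phi> y *\<^sub>R y) \<le> L * dist x y" by (simp add: dist_norm)
    have "norm (x - y) \<le> norm ?\<Theta> + \<epsilon> * norm (x - y)"
      using n norm_triangle_sub[of "x - y" ?\<Theta>] by (simp add: norm_minus_commute)
    then have "norm (x - y) / L \<le> norm ?\<Theta>" using L by (simp add: \<epsilon>_def field_simps)
    then show "dist x y \<le> L * dist (\<phi> x *\<^sub>R x) (\<phi> y *\<^sub>R y)" using L by (simp add: dist_norm field_simps)
  qed
  then show "\<exists>r>0. (\<forall>z\<in>ball p r. g z > 0 \<and> z \<bullet> v > 0) \<and>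
       (\<forall>x\<in>ball p r. \<forall>y\<in>ball p r. dist (\<phi> x *\<^sub>R x) (\<phi> y *\<^sub>R y) \<le> L * dist x y \<and>
          dist x y \<le> L * dist (\<phi> x *\<^sub>R x) (\<phi> y *\<^sub>R y))"
    using r1 r by blast
qed

end

lemma ennreal_le_of_scaled:
  fixes x y :: ennreal
  assumes "\<And>L :: real. L > 1 \<Longrightarrow> x \<le> ennreal (L ^ k) * y"
  shows "x \<le> y"
proof (cases "y = top")
  case False
  then obtain r where y: "y = ennreal r" "r \<ge> 0" by (cases y) auto
  have "((\<lambda>L. ennreal (L ^ k * r)) \<longlongrightarrow> ennreal (1 ^ k * r)) (at_right 1)"
    by (intro tendsto_intros tendsto_ennrealI)
  moreover have "eventually (\<lambda>L. x \<le> ennreal (L ^ k * r)) (at_right 1)"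
    unfolding eventually_at_right_field
    by (intro exI[of _ 2]) (use assms y in \<open>auto simp: ennreal_mult\<close>)
  ultimately have "x \<le> ennreal (1 ^ k * r)"
    by (intro tendsto_lowerbound) auto
  then show ?thesis using y by simp
qed simp

context homogeneous_C1
begin

section \<open>The volume of cones over pieces of a level set\<close>

text \<open>The weighted measure \<open>d * b\<close> times \<phi>, written as an integral against
  Hausdorff measure on the whole space.\<close>

definition surf :: "(real ^ 'n) set \<Rightarrow> ennreal" where
  "surf A = (\<integral>\<^sup>+x. ennreal (real d * b / norm (D x)) * indicator A x \<partial>hausdorff_measure (CARD('n) - 1))"

lemma surf_bounds:
  assumes A: "A \<in> sets borel" and c: "0 \<le> c1" "\<And>x. x \<in> A \<Longrightarrow> c1 \<le> real d * b / norm (D x)"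
    "\<And>x. x \<in> A \<Longrightarrow> real d * b / norm (D x) \<le> c2"
  shows "ennreal c1 * hausdorff_outer (CARD('n) - 1) A \<le> surf A"
    "surf A \<le> ennreal c2 * hausdorff_outer (CARD('n) - 1) A"
proof -
  have e: "ennreal c * hausdorff_outer (CARD('n) - 1) A = (\<integral>\<^sup>+x. ennreal c * indicator A x \<partial>hausdorff_measure (CARD('n) - 1))" for c
    using A by (subst nn_integral_cmult_indicator) (auto simp: emeasure_hausdorff_measure)
  show "ennreal c1 * hausdorff_outer (CARD('n) - 1) A \<le> surf A"
    "surf A \<le> ennreal c2 * hausdorff_outer (CARD('n) - 1) A"
    unfolding e surf_def using c by (auto intro!: nn_integral_mono ennreal_leI simp: indicator_def)
qed

lemma surf_Un:
  assumes "A \<in> sets borel" "B \<in> sets borel" "A \<inter> B = {}"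
  shows "surf (A \<union> B) = surf A + surf B"
proof -
  have "surf (A \<union> B) = (\<integral>\<^sup>+x. ennreal (real d * b / norm (D x)) * indicator A x
     + ennreal (real d * b / norm (D x)) * indicator B x \<partial>hausdorff_measure (CARD('n) - 1))"
    unfolding surf_def using assms(3) by (intro nn_integral_cong) (auto simp: indicator_def)
  also have "\<dots> = surf A + surf B"
    unfolding surf_def using assms by (intro nn_integral_add) auto
  finally show ?thesis .
qed

lemma cone_Un:
  assumes "A \<in> sets borel" "B \<in> sets borel" "A \<inter> B = {}" "A \<subseteq> {x. g x = b}" "B \<subseteq> {x. g x = b}"
  shows "emeasure lborel (cone_over (A \<union> B)) = emeasure lborel (cone_over A) + emeasure lborel (cone_over B)"
proof -
  have AB: "A \<union> B \<subseteq> {x. g x = b}" using assms by auto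
  have "cone_over A \<inter> cone_over B = {}" "cone_over (A \<union> B) = cone_over A \<union> cone_over B"
    unfolding cone_over_level[OF assms(4)] cone_over_level[OF assms(5)] cone_over_level[OF AB] using assms(3) by auto
  then show ?thesis
    using plus_emeasure[of "cone_over A" lborel "cone_over B"] assms cone_over_level_borel by simp
qed

text \<open>The map \<Theta> carries a piece of the level set near p to the tangent hyperplane,
  where the pyramid formula is exact. It distorts (n - 1)-dimensional Hausdorff measure by at most
  \<open>L ^ (n - 1)\<close> and volume by at most \<open>L ^ n\<close>, and the density differs
  from its value h at p by at most a factor L. These three factors multiply to
  \<open>L ^ (2 * n)\<close>.\<close>

lemma cone_surf_local:
  assumes p: "g p = b" and L: "L > 1"
  shows "\<exists>r>0. \<forall>A\<in>sets borel. A \<subseteq> {x. g x = b} \<inter> ball p r \<longrightarrow>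
     ennreal CARD('n) * emeasure lborel (cone_over A) \<le> ennreal (L ^ (2 * CARD('n))) * surf A \<and>
     surf A \<le> ennreal (L ^ (2 * CARD('n))) * (ennreal CARD('n) * emeasure lborel (cone_over A))"
proof -
  define v where "v = D p /\<^sub>R norm (D p)"
  define h where "h = real d * b / norm (D p)"
  define \<phi> where "\<phi> z = exp (ln (g z / b) / real d - ln (z \<bullet> v / h))" for z
  define \<Theta> where "\<Theta> z = \<phi> z *\<^sub>R z" for z
  note ni = near_identity[OF p L, folded v_def h_def, folded \<phi>_def, folded \<Theta>_def]
  note v = ni(1) and h = ni(2) and D0 = ni(3)
  obtain r where r: "r > 0" "\<And>z. z \<in> ball p r \<Longrightarrow> g z > 0 \<and> z \<bullet> v > 0"
    "\<And>x y. x \<in> ball p r \<Longrightarrow> y \<in> ball p r \<Longrightarrow> dist (\<Theta> x) (\<Theta> y) \<le> L * dist x y \<and> dist x y \<le> L * dist (\<Theta> x) (\<Theta> y)"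
    using ni(4) by blast
  have "isCont (\<lambda>x. norm (D x)) p"
    using contD by (intro continuous_intros) (simp add: continuous_on_eq_continuous_at)
  then have "\<forall>\<^sub>F x in nhds p. norm (D p) / L < norm (D x) \<and> norm (D x) < L * norm (D p)"
    using D0 L by (intro eventually_conj isCont_eventually_less) (auto simp: field_simps)
  then obtain r' where r': "r' > 0" "\<And>x. dist x p < r' \<Longrightarrow> norm (D p) / L < norm (D x) \<and> norm (D x) < L * norm (D p)"
    unfolding eventually_nhds_metric by blast
  define \<rho> where "\<rho> = min (r / 2) r'"
  have \<rho>: "\<rho> > 0" "\<rho> \<le> r / 2" "\<rho> \<le> r'" using r r' by (auto simp: \<rho>_def)
  \<comment> \<open>Points of A have norm at most \<open>norm p + r\<close>, so a shell of relative
    thickness \<delta> reaches less than r / 2 towards the origin. As A itself lies within r / 2 of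
    p, the shell stays in the ball where \<Theta> is controlled.\<close>
  define \<delta> where "\<delta> = r / (4 * (norm p + r))"
  have pr: "norm p + r > 0" using r(1) by (simp add: add_nonneg_pos)
  have \<delta>: "\<delta> > 0" "\<delta> < 1" "\<delta> * (norm p + r) < r / 2"
  proof -
    show "\<delta> > 0" using r(1) pr by (simp add: \<delta>_def)
    have "r < 4 * (norm p + r)" using r(1) norm_ge_zero[of p] by (simp add: distrib_left) (smt (verit) norm_ge_zero)
    then show "\<delta> < 1" using pr by (simp add: \<delta>_def)
    have "\<delta> * (norm p + r) = r / 4" using pr unfolding \<delta>_def by (simp only: divide_divide_eq_left[symmetric]) (simp del: divide_divide_eq_left)
    then show "\<delta> * (norm p + r) < r / 2" using r(1) by simp
  qed
  define q where "q = 1 - \<delta>"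
  have q: "0 < q" "q < 1" using \<delta>(1,2) by (simp_all add: q_def)
  show ?thesis
  proof (intro exI[of _ \<rho>] conjI ballI impI \<rho>(1))
    fix A :: "(real ^ 'n) set" assume Ab: "A \<in> sets borel" and A: "A \<subseteq> {x. g x = b} \<inter> ball p \<rho>"
    have gA: "g a = b" and aA: "a \<in> ball p r" and av: "a \<bullet> v > 0" if "a \<in> A" for a
    proof -
      have "g a = b" "dist p a < \<rho>" using that A by auto
      moreover have "\<rho> < r" using \<rho>(2) r(1) by linarith
      ultimately show "g a = b" "a \<in> ball p r" by simp_all
      then show "a \<bullet> v > 0" using r(2) by blast
    qed
    have lip: "dist (\<Theta> x) (\<Theta> y) \<le> L * dist x y" and lip': "dist x y \<le> L * dist (\<Theta> x) (\<Theta> y)"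
      if "x \<in> S" "y \<in> S" "S \<subseteq> ball p r" for x y S
      using r(3) that by blast+
    have Ar: "A \<subseteq> ball p r" using aA by blast
    have Alev: "A \<subseteq> {x. g x = b}" using A by auto
    have \<phi>a: "\<phi> a = h / (a \<bullet> v)" if "a \<in> A" for a
    proof -
      have "\<phi> a = exp (- ln (a \<bullet> v / h))" using gA[OF that] b_pos by (simp add: \<phi>_def)
      also have "\<dots> = inverse (a \<bullet> v / h)" using av[OF that] h by (simp add: exp_minus)
      finally show ?thesis by simp
    qed
    have \<Theta>v: "\<Theta> a \<bullet> v = h" if "a \<in> A" for a
      using \<phi>a[OF that] av[OF that] by (simp add: \<Theta>_def)
    \<comment> \<open>The factor \<phi> is constant along rays: the d-th root of
      \<open>t ^ d\<close> cancels against the factor t in the inner product with v.\<close>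
    have \<Theta>t: "\<Theta> (t *\<^sub>R a) = t *\<^sub>R \<Theta> a" if a: "a \<in> A" and t: "t > 0" for t a
    proof -
      have "ln (t * (a \<bullet> v) / h) = ln t + ln (a \<bullet> v / h)"
        using t av[OF a] h ln_mult[of t "a \<bullet> v / h"] by simp
      moreover have "ln (g (t *\<^sub>R a) / b) = real d * ln t"
        using t b_pos by (simp add: homog gA[OF a] ln_realpow)
      ultimately have "\<phi> (t *\<^sub>R a) = exp (- ln (a \<bullet> v / h))" using d_pos by (simp add: \<phi>_def)
      moreover have "\<phi> a = exp (- ln (a \<bullet> v / h))" using gA[OF a] b_pos by (simp add: \<phi>_def)
      ultimately show ?thesis by (simp add: \<Theta>_def)
    qed
    define T where "T = \<Theta> ` A"
    have T: "T \<subseteq> {x. x \<bullet> v = h}" using \<Theta>v by (auto simp: T_def)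
    \<comment> \<open>Described through the radial projection, the image T is visibly Borel.\<close>
    have "T = {y. y \<bullet> v = h \<and> 0 < g y \<and> retract y \<in> A}"
    proof (intro set_eqI iffI)
      fix y assume "y \<in> T"
      then obtain a where a: "a \<in> A" "y = \<phi> a *\<^sub>R a" by (auto simp: T_def \<Theta>_def)
      have "\<phi> a > 0" by (simp add: \<phi>_def)
      then show "y \<in> {y. y \<bullet> v = h \<and> 0 < g y \<and> retract y \<in> A}"
        using a \<Theta>v[OF a(1)] gA[OF a(1)] b_pos by (simp add: \<Theta>_def homog retract_scale retract_eq)
    next
      fix y assume y: "y \<in> {y. y \<bullet> v = h \<and> 0 < g y \<and> retract y \<in> A}"
      have gy: "gauge y > 0" using y gauge_pos by blast
      have ya: "y = gauge y *\<^sub>R retract y" using gy by (simp add: retract_def)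
      then have "h = gauge y * (retract y \<bullet> v)" using y by (metis (mono_tags, lifting) inner_scaleR_left mem_Collect_eq)
      then have "gauge y = \<phi> (retract y)" using \<phi>a[of "retract y"] av[of "retract y"] y by simp
      then have "y = \<Theta> (retract y)" using ya by (simp add: \<Theta>_def)
      then show "y \<in> T" using y by (auto simp: T_def)
    qed
    moreover have "{y. y \<bullet> v = h \<and> 0 < g y \<and> retract y \<in> A} \<in> sets borel"
      using Ab by measurable
    ultimately have Tb: "T \<in> sets borel" by simp
    note cA = cone_over_level_borel[OF Alev Ab] and cT = cone_over_hyperplane_borel[OF T Tb h]
    have bA: "bounded A" using A bounded_subset by blast
    have bT: "bounded T"
      unfolding T_def
    proof (cases "A = {}")
      case False
      show "bounded (\<Theta> ` A)"
        by (rule diameter_lipschitz_image(1)[OF bA False, where L=L]) (use lip[OF _ _ Ar] L in simp_all)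
    qed simp
    \<comment> \<open>The map is only controlled near p, so thin shells have to stand in for the cones.\<close>
    define SA where "SA = {t *\<^sub>R a | t a. q < t \<and> t \<le> 1 \<and> a \<in> A}"
    define ST where "ST = {t *\<^sub>R a | t a. q < t \<and> t \<le> 1 \<and> a \<in> T}"
    have rayA: "s = t" if "a \<in> A" "a' \<in> A" "0 < s" "0 < t" "s *\<^sub>R a = t *\<^sub>R a'" for a a' s t
      by (rule level_ray[OF gA[OF that(1)] gA[OF that(2)] that(3-5)])
    have shA: "SA \<in> sets borel" "emeasure lborel SA = ennreal (1 - q ^ CARD('n)) * emeasure lborel (cone_over A)"
      unfolding SA_def using emeasure_shell[OF rayA cA bA q] by simp_all
    have rayT: "s = t" if "a \<in> T" "a' \<in> T" "0 < s" "0 < t" "s *\<^sub>R a = t *\<^sub>R a'" for a a' s t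
    proof -
      have "s * (a \<bullet> v) = t * (a' \<bullet> v)" using that(5) by (metis inner_scaleR_left)
      moreover have "a \<bullet> v = h" "a' \<bullet> v = h" using that(1,2) T by blast+
      ultimately show ?thesis using h by simp
    qed
    have shT: "ST \<in> sets borel" "emeasure lborel ST = ennreal (1 - q ^ CARD('n)) * emeasure lborel (cone_over T)"
      unfolding ST_def using emeasure_shell[OF rayT cT bT q] by simp_all
    have SAr: "SA \<subseteq> ball p r"
    proof
      fix z assume "z \<in> SA"
      then obtain t a where t: "q < t" "t \<le> 1" "a \<in> A" "z = t *\<^sub>R a" by (auto simp: SA_def)
      have pa: "dist p a < \<rho>" using t A by auto
      have na: "norm a \<le> norm p + r"
        using norm_triangle_sub[of a p] pa \<rho> r(1) by (simp add: dist_norm norm_minus_commute)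
      have "dist a z = (1 - t) * norm a"
        using t(2) unfolding dist_norm t(4) by (metis abs_of_nonneg diff_ge_0_iff_ge norm_scaleR scaleR_diff_left scaleR_one)
      also have "\<dots> \<le> \<delta> * (norm p + r)" using t q_def \<delta> na by (intro mult_mono) auto
      finally have "dist a z < r / 2" using \<delta>(3) by linarith
      then show "z \<in> ball p r" using pa \<rho>(2) dist_triangle[of p z a] by simp
    qed
    have img: "\<Theta> ` SA = ST"
    proof (intro set_eqI iffI)
      fix z assume "z \<in> \<Theta> ` SA"
      then obtain t a where t: "q < t" "t \<le> 1" "a \<in> A" "z = \<Theta> (t *\<^sub>R a)" by (auto simp: SA_def)
      then have "z = t *\<^sub>R \<Theta> a" using \<Theta>t q by simp
      then show "z \<in> ST" unfolding ST_def T_def using t by blast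
    next
      fix z assume "z \<in> ST"
      then obtain t a where t: "q < t" "t \<le> 1" "a \<in> A" "z = t *\<^sub>R \<Theta> a" by (auto simp: ST_def T_def)
      then have "z = \<Theta> (t *\<^sub>R a)" using \<Theta>t q by simp
      then show "z \<in> \<Theta> ` SA" unfolding SA_def using t by blast
    qed
    have L0: "L > 0" using L by simp
    \<comment> \<open>Both shells carry the same fraction c of the volume of their cones. It is
      nonzero and finite, so it cancels from the comparison of shells.\<close>
    define c where "c = ennreal (1 - q ^ CARD('n))"
    have "q ^ CARD('n) < 1" using q by (simp add: power_less_one_iff)
    then have c: "c \<noteq> 0" "c \<noteq> top" by (auto simp: c_def)
    have "hausdorff_outer CARD('n) ST \<le> ennreal (L ^ CARD('n)) * hausdorff_outer CARD('n) SA"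
      unfolding img[symmetric] by (rule hausdorff_outer_lipschitz_image[OF lip[OF _ _ SAr] L0])
    then have "c * emeasure lborel (cone_over T) \<le> c * (ennreal (L ^ CARD('n)) * emeasure lborel (cone_over A))"
      using hausdorff_outer_eq_lborel[OF shA(1)] hausdorff_outer_eq_lborel[OF shT(1)] shA(2) shT(2)
      by (simp add: c_def[symmetric] mult_ac)
    then have vol1: "emeasure lborel (cone_over T) \<le> ennreal (L ^ CARD('n)) * emeasure lborel (cone_over A)"
      using c by (simp add: ennreal_mult_le_mult_iff)
    have "hausdorff_outer CARD('n) SA \<le> ennreal (L ^ CARD('n)) * hausdorff_outer CARD('n) ST"
      unfolding img[symmetric] by (rule hausdorff_outer_bilipschitz_ge[OF lip'[OF _ _ SAr] L0])
    then have "c * emeasure lborel (cone_over A) \<le> c * (ennreal (L ^ CARD('n)) * emeasure lborel (cone_over T))"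
      using hausdorff_outer_eq_lborel[OF shA(1)] hausdorff_outer_eq_lborel[OF shT(1)] shA(2) shT(2)
      by (simp add: c_def[symmetric] mult_ac)
    then have vol2: "emeasure lborel (cone_over A) \<le> ennreal (L ^ CARD('n)) * emeasure lborel (cone_over T)"
      using c by (simp add: ennreal_mult_le_mult_iff)
    let ?H = "hausdorff_outer (CARD('n) - 1)"
    have H1: "?H T \<le> ennreal (L ^ (CARD('n) - 1)) * ?H A"
      unfolding T_def by (rule hausdorff_outer_lipschitz_image[OF lip[OF _ _ Ar] L0])
    have H2: "?H A \<le> ennreal (L ^ (CARD('n) - 1)) * ?H T"
      unfolding T_def by (rule hausdorff_outer_bilipschitz_ge[OF lip'[OF _ _ Ar] L0])
    have flat: "ennreal CARD('n) * emeasure lborel (cone_over T) = ennreal h * ?H T"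
      using emeasure_cone_over_hyperplane[OF v T Tb h] h
      by (simp add: mult.assoc[symmetric] ennreal_mult[symmetric])
    have dens: "h / L \<le> real d * b / norm (D x)" "real d * b / norm (D x) \<le> L * h" if "x \<in> A" for x
    proof -
      have x: "norm (D p) / L < norm (D x)" "norm (D x) < L * norm (D p)"
        using r'(2)[of x] that A \<rho>(3) by (auto simp: dist_commute)
      have Dp: "norm (D p) > 0" using D0 by simp
      have Dx: "norm (D x) > 0" using x(1) Dp L0 by (meson divide_pos_pos less_trans)
      have "real d * b / (L * norm (D p)) \<le> real d * b / norm (D x)"
        using x(2) Dx Dp L0 d_pos b_pos by (intro divide_left_mono) auto
      then show "h / L \<le> real d * b / norm (D x)" by (simp add: h_def mult.commute)
      have "real d * b / norm (D x) \<le> real d * b / (norm (D p) / L)"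
        using x(1) Dx Dp L0 d_pos b_pos by (intro divide_left_mono) auto
      then show "real d * b / norm (D x) \<le> L * h" by (simp add: h_def mult_ac)
    qed
    have s1: "ennreal (h / L) * ?H A \<le> surf A" and s2: "surf A \<le> ennreal (L * h) * ?H A"
      using surf_bounds[OF Ab, of "h / L" "L * h"] dens h L0 by auto
    have pw: "L ^ (2 * CARD('n)) = L ^ CARD('n) * L ^ (CARD('n) - 1) * L"
    proof -
      have "2 * CARD('n) = CARD('n) + (CARD('n) - 1) + 1" using zero_less_card_finite[where 'a='n] by linarith
      then show ?thesis by (metis power_add power_one_right)
    qed
    have "ennreal CARD('n) * emeasure lborel (cone_over A) \<le> ennreal (L ^ CARD('n)) * (ennreal CARD('n) * emeasure lborel (cone_over T))"
      using mult_left_mono[OF vol2, of "ennreal CARD('n)"] by (simp add: mult_ac)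
    also have "\<dots> \<le> ennreal (L ^ CARD('n)) * (ennreal h * (ennreal (L ^ (CARD('n) - 1)) * ?H A))"
      unfolding flat by (intro mult_left_mono H1) auto
    also have "\<dots> = ennreal (L ^ (2 * CARD('n))) * (ennreal (h / L) * ?H A)"
      unfolding pw using L0 h by (simp add: mult.assoc[symmetric] ennreal_mult[symmetric]) (simp add: mult_ac)
    also have "\<dots> \<le> ennreal (L ^ (2 * CARD('n))) * surf A" by (intro mult_left_mono s1) auto
    finally show "ennreal CARD('n) * emeasure lborel (cone_over A) \<le> ennreal (L ^ (2 * CARD('n))) * surf A" .
    note s2
    also have "ennreal (L * h) * ?H A \<le> ennreal (L * h) * (ennreal (L ^ (CARD('n) - 1)) * ?H T)"
      by (intro mult_left_mono H2) auto
    also have "\<dots> = ennreal (L * L ^ (CARD('n) - 1)) * (ennreal CARD('n) * emeasure lborel (cone_over T))"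
      unfolding flat using L0 h by (simp add: mult.assoc[symmetric] ennreal_mult[symmetric]) (simp add: mult_ac)
    also have "\<dots> \<le> ennreal (L * L ^ (CARD('n) - 1)) * (ennreal CARD('n) * (ennreal (L ^ CARD('n)) * emeasure lborel (cone_over A)))"
      by (intro mult_left_mono vol1) auto
    also have "\<dots> = ennreal (L ^ (2 * CARD('n))) * (ennreal CARD('n) * emeasure lborel (cone_over A))"
      unfolding pw using L0 by (simp add: ennreal_mult mult_ac)
    finally show "surf A \<le> ennreal (L ^ (2 * CARD('n))) * (ennreal CARD('n) * emeasure lborel (cone_over A))" .
  qed
qed

text \<open>For fixed L finitely many of the balls from \<open>cone_surf_local\<close> cover K. Both
  sides are additive over disjoint pieces, so the estimate holds for A with the same factor, however
  many balls were used, and L may tend to 1.\<close>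

lemma cone_surf:
  assumes K: "compact K" "K \<subseteq> {x. g x = b}" and A: "A \<in> sets borel" "A \<subseteq> K"
  shows "ennreal CARD('n) * emeasure lborel (cone_over A) = surf A"
proof -
  let ?cn = "\<lambda>A. ennreal CARD('n) * emeasure lborel (cone_over A)"
  have both: "?cn A \<le> ennreal (L ^ (2 * CARD('n))) * surf A \<and> surf A \<le> ennreal (L ^ (2 * CARD('n))) * ?cn A"
    if L: "L > 1" for L
  proof -
    let ?c = "ennreal (L ^ (2 * CARD('n)))"
    have "\<forall>p\<in>K. \<exists>r>0. \<forall>A\<in>sets borel. A \<subseteq> {x. g x = b} \<inter> ball p r \<longrightarrow>
        ?cn A \<le> ?c * surf A \<and> surf A \<le> ?c * ?cn A"
      using cone_surf_local[OF _ L] K(2) by blast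
    from bchoice[OF this] obtain r where
      r': "\<forall>p\<in>K. r p > 0 \<and> (\<forall>A\<in>sets borel. A \<subseteq> {x. g x = b} \<inter> ball p (r p) \<longrightarrow>
        ?cn A \<le> ?c * surf A \<and> surf A \<le> ?c * ?cn A)" ..
    have r: "r p > 0" "\<And>A. A \<in> sets borel \<Longrightarrow> A \<subseteq> {x. g x = b} \<inter> ball p (r p) \<Longrightarrow>
        ?cn A \<le> ?c * surf A \<and> surf A \<le> ?c * ?cn A" if "p \<in> K" for p
      using r' that by blast+
    have "K \<subseteq> (\<Union>p\<in>K. ball p (r p))" using r(1) by (auto intro: centre_in_ball[THEN iffD2])
    then obtain F where F: "F \<subseteq> K" "finite F" "K \<subseteq> (\<Union>p\<in>F. ball p (r p))"
      using compactE_image[OF K(1), of K "\<lambda>p. ball p (r p)"] by (metis open_ball)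
    have "?cn A \<le> ?c * surf A \<and> surf A \<le> ?c * ?cn A"
      if "finite F" "F \<subseteq> K" "A \<in> sets borel" "A \<subseteq> {x. g x = b} \<inter> (\<Union>p\<in>F. ball p (r p))" for A F
      using that
    proof (induction F arbitrary: A rule: finite_induct)
      case empty
      then show ?case by (simp add: surf_def cone_over_def)
    next
      case (insert p F)
      let ?A1 = "A \<inter> ball p (r p)" and ?A2 = "A - ball p (r p)"
      have b12: "?A1 \<in> sets borel" "?A2 \<in> sets borel" using insert by auto
      have 1: "?cn ?A1 \<le> ?c * surf ?A1 \<and> surf ?A1 \<le> ?c * ?cn ?A1"
        using insert by (intro r(2)) auto
      have 2: "?cn ?A2 \<le> ?c * surf ?A2 \<and> surf ?A2 \<le> ?c * ?cn ?A2"
        using insert by (intro insert.IH) auto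
      have u: "A = ?A1 \<union> ?A2" by auto
      have su: "surf A = surf ?A1 + surf ?A2"
        by (subst u, rule surf_Un) (use b12 in auto)
      have cu: "?cn A = ?cn ?A1 + ?cn ?A2"
        by (subst u, subst cone_Un) (use b12 insert in \<open>auto simp: distrib_left\<close>)
      show ?case unfolding su cu distrib_left using 1 2 by (auto intro!: add_mono)
    qed
    from this[OF F(2,1) A(1)] show ?thesis using A(2) F(3) K(2) by blast
  qed
  show ?thesis
    by (rule antisym; rule ennreal_le_of_scaled[where k="2 * CARD('n)"]) (use both in auto)
qed

text \<open>The set where the gauge is at most t is the cone scaled by t. For indicators the claim
  is therefore \<open>cone_surf\<close> with a factor \<open>t ^ n\<close>; as an equality of two
  measures it extends to every F.\<close>

lemma nn_integral_cone_retract: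
  fixes F :: "real ^ 'n \<Rightarrow> ennreal"
  assumes K: "compact K" "K \<subseteq> {x. g x = b}" and F [measurable]: "F \<in> borel_measurable borel"
    and t: "0 < t" "t \<le> 1"
  shows "ennreal CARD('n) * (\<integral>\<^sup>+z. F (retract z) * indicator {z \<in> cone_over K. gauge z \<le> t} z \<partial>lborel)
    = ennreal (t ^ CARD('n)) * (\<integral>\<^sup>+x. F x * (ennreal (real d * b / norm (D x)) * indicator K x) \<partial>hausdorff_measure (CARD('n) - 1))"
proof -
  have Kb [measurable]: "K \<in> sets borel" using K(1) by (simp add: borel_compact)
  note [measurable] = cone_over_level_borel[OF K(2) Kb]
  let ?C = "{z \<in> cone_over K. gauge z \<le> t}" and ?H = "hausdorff_measure (CARD('n) - 1) :: (real ^ 'n) measure"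
  have C: "?C \<in> sets borel" by measurable
  define M1 where "M1 = distr (density lborel (\<lambda>z. ennreal CARD('n) * indicator ?C z)) borel retract"
  define M2 where "M2 = density ?H (\<lambda>x. ennreal (t ^ CARD('n)) * (ennreal (real d * b / norm (D x)) * indicator K x))"
  have M: "M1 = M2"
  proof (rule measure_eqI)
    show "sets M1 = sets M2" by (simp add: M1_def M2_def)
    fix A assume "A \<in> sets M1"
    then have A [measurable]: "A \<in> sets borel" by (simp add: M1_def)
    have AK: "A \<inter> K \<subseteq> {x. g x = b}" "A \<inter> K \<in> sets borel" "A \<inter> K \<subseteq> K" using K by auto
    have Rz: "retract -` A \<in> sets borel" using measurable_sets[OF retract_borel A] by simp
    have "?C \<inter> retract -` A = (*\<^sub>R) t ` cone_over (A \<inter> K)"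
    proof (intro set_eqI iffI)
      fix z assume z: "z \<in> ?C \<inter> retract -` A"
      then have z': "0 < g z" "gauge z \<le> t" "retract z \<in> A \<inter> K"
        unfolding cone_over_level[OF K(2)] by auto
      have "z = t *\<^sub>R (z /\<^sub>R t)" using t by simp
      moreover have "z /\<^sub>R t \<in> cone_over (A \<inter> K)"
      proof -
        have "inverse t > 0" using t by simp
        then have "0 < g (z /\<^sub>R t)" "gauge (z /\<^sub>R t) = inverse t * gauge z" "retract (z /\<^sub>R t) = retract z"
          using z'(1) by (simp_all only: homog gauge_scale retract_scale zero_less_mult_iff zero_less_power) simp
        moreover have "inverse t * gauge z \<le> 1" using z'(2) t(1) by (simp add: field_simps)
        ultimately show ?thesis unfolding cone_over_level[OF AK(1)] using z'(3) by simp
      qed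
      ultimately show "z \<in> (*\<^sub>R) t ` cone_over (A \<inter> K)" by blast
    next
      fix z assume "z \<in> (*\<^sub>R) t ` cone_over (A \<inter> K)"
      then obtain w where w: "w \<in> cone_over (A \<inter> K)" "z = t *\<^sub>R w" by auto
      then have "0 < g w" and "gauge w \<le> 1" and "retract w \<in> A \<inter> K" unfolding cone_over_level[OF AK(1)] by auto
      moreover have "t * gauge w \<le> t"
        using mult_left_mono[OF \<open>gauge w \<le> 1\<close>, of t] t by simp
      ultimately show "z \<in> ?C \<inter> retract -` A"
        unfolding cone_over_level[OF K(2)] w(2) using t order_trans[of "t * gauge w" t 1] by (simp add: homog gauge_scale retract_scale)
    qed
    note im = this
    have "emeasure M1 A = emeasure (density lborel (\<lambda>z. ennreal CARD('n) * indicator ?C z)) (retract -` A)"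
      unfolding M1_def by (subst emeasure_distr) auto
    also have "\<dots> = (\<integral>\<^sup>+z. ennreal CARD('n) * indicator ?C z * indicator (retract -` A) z \<partial>lborel)"
      using Rz C by (intro emeasure_density) auto
    also have "\<dots> = (\<integral>\<^sup>+z. ennreal CARD('n) * indicator (?C \<inter> retract -` A) z \<partial>lborel)"
      by (intro nn_integral_cong) (auto simp: indicator_def)
    also have "\<dots> = ennreal CARD('n) * emeasure lborel (?C \<inter> retract -` A)"
      using Rz C by (intro nn_integral_cmult_indicator) auto
    also have "\<dots> = ennreal (t ^ CARD('n)) * (ennreal CARD('n) * emeasure lborel (cone_over (A \<inter> K)))"
      unfolding im using emeasure_lborel_scale(2)[OF cone_over_level_borel[OF AK(1,2)] t(1)]
      by (simp add: mult_ac)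
    also have "\<dots> = ennreal (t ^ CARD('n)) * surf (A \<inter> K)"
      using cone_surf[OF K AK(2,3)] by simp
    also have "\<dots> = (\<integral>\<^sup>+x. ennreal (t ^ CARD('n)) * (ennreal (real d * b / norm (D x)) * indicator K x) * indicator A x \<partial>?H)"
      unfolding surf_def by (subst nn_integral_cmult[symmetric]) (auto intro!: nn_integral_cong simp: indicator_def)
    also have "\<dots> = emeasure M2 A"
      unfolding M2_def by (rule emeasure_density[symmetric]) auto
    finally show "emeasure M1 A = emeasure M2 A" .
  qed
  have "ennreal CARD('n) * (\<integral>\<^sup>+z. F (retract z) * indicator ?C z \<partial>lborel)
      = (\<integral>\<^sup>+z. ennreal CARD('n) * indicator ?C z * F (retract z) \<partial>lborel)"
    using C by (subst nn_integral_cmult[symmetric]) (auto simp: mult_ac)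
  also have "\<dots> = (\<integral>\<^sup>+z. F (retract z) \<partial>density lborel (\<lambda>z. ennreal CARD('n) * indicator ?C z))"
    using C by (intro nn_integral_density[symmetric]) auto
  also have "\<dots> = (\<integral>\<^sup>+x. F x \<partial>M1)"
    unfolding M1_def by (intro nn_integral_distr[symmetric]) auto
  also have "\<dots> = (\<integral>\<^sup>+x. F x \<partial>M2)" by (simp only: M)
  also have "\<dots> = (\<integral>\<^sup>+x. ennreal (t ^ CARD('n)) * (ennreal (real d * b / norm (D x)) * indicator K x) * F x \<partial>?H)"
    unfolding M2_def by (intro nn_integral_density) auto
  also have "\<dots> = ennreal (t ^ CARD('n)) * (\<integral>\<^sup>+x. F x * (ennreal (real d * b / norm (D x)) * indicator K x) \<partial>?H)"
    by (subst nn_integral_cmult[symmetric]) (auto simp: mult_ac)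
  finally show ?thesis .
qed

text \<open>On the cone, \<open>f z = gauge z ^ k * f (retract z)\<close>. Writing
  \<open>1 - gauge z ^ k\<close> as the integral of \<open>k * t ^ (k - 1)\<close> from
  \<open>gauge z\<close> to 1 and exchanging the integrals leaves integrals of
  \<open>f (retract z)\<close> over gauge at most t, which \<open>nn_integral_cone_retract\<close>
  evaluates. The outcome is S = n I + k / (n + k) S, with I the volume integral and S the surface
  integral, and this is solved for S.\<close>

lemma polar_integration:
  fixes f :: "real ^ 'n \<Rightarrow> real"
  assumes K: "compact K" "K \<subseteq> {x. g x = b}" and f [measurable]: "f \<in> borel_measurable borel"
    and f0: "\<And>x. 0 \<le> f x" and fh: "\<And>t x. t > 0 \<Longrightarrow> f (t *\<^sub>R x) = t ^ k * f x"
    and fB: "\<And>x. x \<in> K \<Longrightarrow> f x \<le> B"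
  shows "ennreal (real (CARD('n) + k)) * (\<integral>\<^sup>+z. ennreal (f z) * indicator (cone_over K) z \<partial>lborel)
    = (\<integral>\<^sup>+x. ennreal (f x) * (ennreal (real d * b / norm (D x)) * indicator K x) \<partial>hausdorff_measure (CARD('n) - 1))"
    (is "_ * ?I = ?S")
    and "(\<integral>\<^sup>+x. ennreal (f x) * (ennreal (real d * b / norm (D x)) * indicator K x) \<partial>hausdorff_measure (CARD('n) - 1)) < top"
proof -
  have Kb [measurable]: "K \<in> sets borel" using K(1) by (simp add: borel_compact)
  note [measurable] = cone_over_level_borel[OF K(2) Kb]
  let ?n = "real CARD('n)"
  have n: "?n > 0" by simp
  let ?C = "cone_over K"
  have Cz: "g z > 0 \<and> 0 < gauge z \<and> gauge z \<le> 1 \<and> f z = gauge z ^ k * f (retract z)" if "z \<in> ?C" for z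
  proof -
    have z: "g z > 0" "gauge z \<le> 1" using that unfolding cone_over_level[OF K(2)] by auto
    have "z = gauge z *\<^sub>R retract z" using gauge_pos[OF z(1)] by (simp add: retract_def)
    then show ?thesis using z gauge_pos[OF z(1)] fh by metis
  qed
  \<comment> \<open>Finiteness of the surface integral is what permits solving for it at the end,
    where it occurs on both sides.\<close>
  have "?S \<le> (\<integral>\<^sup>+x. ennreal B * (ennreal (real d * b / norm (D x)) * indicator K x) \<partial>hausdorff_measure (CARD('n) - 1))"
    using fB by (intro nn_integral_mono) (auto simp: indicator_def intro!: mult_right_mono ennreal_leI)
  also have "\<dots> = ennreal B * surf K" unfolding surf_def by (rule nn_integral_cmult) auto
  also have "\<dots> = ennreal B * (ennreal ?n * emeasure lborel ?C)"
    using cone_surf[OF K Kb] by simp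
  also have "\<dots> < top" using emeasure_cone_over_finite[OF compact_imp_bounded[OF K(1)]] by (simp add: ennreal_mult_less_top)
  finally show Sfin: "?S < top" .
  let ?J = "\<integral>\<^sup>+z. ennreal (f (retract z)) * indicator ?C z \<partial>lborel"
  let ?w = "\<lambda>t::real. ennreal (real k * t ^ (k - 1))"
  have "ennreal ?n * ?J = ennreal ?n * (\<integral>\<^sup>+z. ennreal (f (retract z)) * indicator {z \<in> ?C. gauge z \<le> 1} z \<partial>lborel)"
    using Cz by (intro arg_cong2[where f="(*)"] nn_integral_cong refl) (auto simp: indicator_def)
  also have "\<dots> = ?S"
    by (subst nn_integral_cone_retract[OF K]) auto
  finally have nJ: "ennreal ?n * ?J = ?S" .
  have inner: "(\<integral>\<^sup>+t. ?w t * indicator {gauge z..1} t \<partial>lborel) = ennreal (1 - gauge z ^ k)" if "z \<in> ?C" for z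
  proof -
    have "(\<integral>\<^sup>+t. ?w t * indicator {gauge z..1} t \<partial>lborel) = ennreal (1 ^ k - gauge z ^ k)"
    proof (rule nn_integral_FTC_Icc)
      fix t :: real
      show "((\<lambda>t. t ^ k) has_real_derivative real k * t ^ (k - 1)) (at t)"
        by (auto intro!: derivative_eq_intros)
    qed (use Cz[OF that] in auto)
    then show ?thesis by simp
  qed
  have "?J = (\<integral>\<^sup>+z. ennreal (f z) * indicator ?C z + ennreal (f (retract z)) * indicator ?C z * ennreal (1 - gauge z ^ k) \<partial>lborel)"
  proof (rule nn_integral_cong)
    fix z
    show "ennreal (f (retract z)) * indicator ?C z
      = ennreal (f z) * indicator ?C z + ennreal (f (retract z)) * indicator ?C z * ennreal (1 - gauge z ^ k)"
    proof (cases "z \<in> ?C")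
      case True
      have "gauge z ^ k \<le> 1" using Cz[OF True] by (intro power_le_one) auto
      then have "ennreal (f z) + ennreal (f (retract z)) * ennreal (1 - gauge z ^ k) = ennreal (f z + f (retract z) * (1 - gauge z ^ k))"
        using f0 by (simp add: ennreal_mult[symmetric] ennreal_plus[symmetric] del: ennreal_plus)
      also have "f z + f (retract z) * (1 - gauge z ^ k) = f (retract z)"
        using Cz[OF True] by (simp add: algebra_simps)
      finally show ?thesis using True by simp
    qed simp
  qed
  also have "\<dots> = ?I + (\<integral>\<^sup>+z. ennreal (f (retract z)) * indicator ?C z * ennreal (1 - gauge z ^ k) \<partial>lborel)"
    by (rule nn_integral_add) auto
  also have "(\<integral>\<^sup>+z. ennreal (f (retract z)) * indicator ?C z * ennreal (1 - gauge z ^ k) \<partial>lborel)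
      = (\<integral>\<^sup>+z. \<integral>\<^sup>+t. ennreal (f (retract z)) * indicator ?C z * (?w t * indicator {gauge z..1} t) \<partial>lborel \<partial>lborel)"
  proof (rule nn_integral_cong)
    fix z
    show "ennreal (f (retract z)) * indicator ?C z * ennreal (1 - gauge z ^ k)
       = (\<integral>\<^sup>+t. ennreal (f (retract z)) * indicator ?C z * (?w t * indicator {gauge z..1} t) \<partial>lborel)"
    proof (cases "z \<in> ?C")
      case True
      then show ?thesis using inner[OF True] by (subst nn_integral_cmult) auto
    qed simp
  qed
  also have "\<dots> = (\<integral>\<^sup>+t. \<integral>\<^sup>+z. ennreal (f (retract z)) * indicator ?C z * (?w t * indicator {gauge z..1} t) \<partial>lborel \<partial>lborel)"
  proof -
    have A: "(\<lambda>p. ennreal (f (retract (fst p))) * indicator ?C (fst p) * (?w (snd p) * indicator {p. gauge (fst p) \<le> snd p \<and> snd p \<le> 1} p))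
        \<in> borel_measurable (lborel \<Otimes>\<^sub>M lborel)" by measurable
    have B: "(\<lambda>p. ennreal (f (retract (fst p))) * indicator ?C (fst p) * (?w (snd p) * indicator {p. gauge (fst p) \<le> snd p \<and> snd p \<le> 1} p))
      = (\<lambda>(z, t). ennreal (f (retract z)) * indicator ?C z * (?w t * indicator {gauge z..1} t))"
      by (auto simp: fun_eq_iff indicator_def)
    have "(\<lambda>(z, t). ennreal (f (retract z)) * indicator ?C z * (?w t * indicator {gauge z..1} t)) \<in> borel_measurable (lborel \<Otimes>\<^sub>M lborel)"
      using A unfolding B .
    from lborel_pair.Fubini'[OF this] show ?thesis by simp
  qed
  also have "\<dots> = (\<integral>\<^sup>+t. ?w t * indicator {0<..1} t * (\<integral>\<^sup>+z. ennreal (f (retract z)) * indicator {z \<in> ?C. gauge z \<le> t} z \<partial>lborel) \<partial>lborel)"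
  proof (rule nn_integral_cong)
    fix t :: real
    have "(\<integral>\<^sup>+z. ennreal (f (retract z)) * indicator ?C z * (?w t * indicator {gauge z..1} t) \<partial>lborel)
      = (\<integral>\<^sup>+z. ?w t * indicator {0<..1} t * (ennreal (f (retract z)) * indicator {z \<in> ?C. gauge z \<le> t} z) \<partial>lborel)"
      by (intro nn_integral_cong) (use Cz in \<open>auto simp: indicator_def mult_ac dest: less_le_trans\<close>)
    also have "\<dots> = ?w t * indicator {0<..1} t * (\<integral>\<^sup>+z. ennreal (f (retract z)) * indicator {z \<in> ?C. gauge z \<le> t} z \<partial>lborel)"
      by (rule nn_integral_cmult) measurable
    finally show "(\<integral>\<^sup>+z. ennreal (f (retract z)) * indicator ?C z * (?w t * indicator {gauge z..1} t) \<partial>lborel)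
      = ?w t * indicator {0<..1} t * (\<integral>\<^sup>+z. ennreal (f (retract z)) * indicator {z \<in> ?C. gauge z \<le> t} z \<partial>lborel)" .
  qed
  finally have JI: "?J = ?I + (\<integral>\<^sup>+t. ?w t * indicator {0<..1} t * (\<integral>\<^sup>+z. ennreal (f (retract z)) * indicator {z \<in> ?C. gauge z \<le> t} z \<partial>lborel) \<partial>lborel)" .
  have "ennreal ?n * (\<integral>\<^sup>+t. ?w t * indicator {0<..1} t * (\<integral>\<^sup>+z. ennreal (f (retract z)) * indicator {z \<in> ?C. gauge z \<le> t} z \<partial>lborel) \<partial>lborel)
      = (\<integral>\<^sup>+t. ?w t * indicator {0<..1} t * (ennreal (t ^ CARD('n)) * ?S) \<partial>lborel)"
  proof (subst nn_integral_cmult[symmetric])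
    show "(\<integral>\<^sup>+ t. ennreal ?n * (?w t * indicator {0<..1} t * (\<integral>\<^sup>+z. ennreal (f (retract z)) * indicator {z \<in> ?C. gauge z \<le> t} z \<partial>lborel)) \<partial>lborel) =
      (\<integral>\<^sup>+ t. ?w t * indicator {0<..1} t * (ennreal (t ^ CARD('n)) * ?S) \<partial>lborel)"
    proof (rule nn_integral_cong)
      fix t :: real
      show "ennreal ?n * (?w t * indicator {0<..1} t * (\<integral>\<^sup>+z. ennreal (f (retract z)) * indicator {z \<in> ?C. gauge z \<le> t} z \<partial>lborel))
        = ?w t * indicator {0<..1} t * (ennreal (t ^ CARD('n)) * ?S)"
      proof (cases "0 < t \<and> t \<le> 1")
        case True
        have q: "ennreal ?n * (\<integral>\<^sup>+z. ennreal (f (retract z)) * indicator {z \<in> ?C. gauge z \<le> t} z \<partial>lborel) = ennreal (t ^ CARD('n)) * ?S"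
          using True by (intro nn_integral_cone_retract[OF K]) auto
        show ?thesis unfolding q[symmetric] by (simp only: mult_ac)
      qed auto
    qed
  qed measurable
  also have "\<dots> = (\<integral>\<^sup>+t. ennreal (real k * t ^ (k + CARD('n) - 1)) * indicator {0..1} t * ?S \<partial>lborel)"
  proof (rule nn_integral_cong_AE)
    have e: "ennreal (real k * t ^ (k - 1)) * ennreal (t ^ CARD('n)) = ennreal (real k * t ^ (k + CARD('n) - 1))" if "t > 0" for t
    proof (cases "k = 0")
      case False
      then have "k - 1 + CARD('n) = k + CARD('n) - 1" by simp
      then have "t ^ (k - 1) * t ^ CARD('n) = t ^ (k + CARD('n) - 1)" by (metis power_add)
      then show ?thesis using that by (simp add: ennreal_mult[symmetric] mult.assoc)
    qed simp
    show "AE t in lborel. ?w t * indicator {0<..1} t * (ennreal (t ^ CARD('n)) * ?S) = ennreal (real k * t ^ (k + CARD('n) - 1)) * indicator {0..1} t * ?S"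
      using AE_lborel_singleton[of "0::real"]
    proof eventually_elim
      case (elim t)
      then show ?case using e[of t] by (cases "0 < t \<and> t \<le> 1") (auto simp: indicator_def mult.assoc[symmetric])
    qed
  qed
  also have "\<dots> = (\<integral>\<^sup>+t. ennreal (real k * t ^ (k + CARD('n) - 1)) * indicator {0..1} t \<partial>lborel) * ?S"
    by (rule nn_integral_multc) measurable
  also have "(\<integral>\<^sup>+t. ennreal (real k * t ^ (k + CARD('n) - 1)) * indicator {0..1} t \<partial>lborel) = ennreal (real k * (1 ^ (k + CARD('n)) / real (k + CARD('n))) - real k * (0 ^ (k + CARD('n)) / real (k + CARD('n))))"
  proof (rule nn_integral_FTC_Icc)
    fix t :: real
    have "((\<lambda>t. real k * (t ^ (k + CARD('n)) / real (k + CARD('n)))) has_real_derivative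
        real k * (real (k + CARD('n)) * t ^ (k + CARD('n) - Suc 0) / real (k + CARD('n)))) (at t)"
      by (auto intro!: derivative_eq_intros)
    then show "((\<lambda>t. real k * (t ^ (k + CARD('n)) / real (k + CARD('n)))) has_real_derivative real k * t ^ (k + CARD('n) - 1)) (at t)"
      using n by simp
  qed auto
  also have "\<dots> = ennreal (real k / real (k + CARD('n)))" by (simp add: power_0_left)
  finally have main: "?S = ennreal ?n * ?I + ennreal (real k / real (k + CARD('n))) * ?S"
    using nJ unfolding JI distrib_left by simp
  obtain S where S: "?S = ennreal S" "S \<ge> 0" using Sfin by (cases ?S) auto
  have "ennreal ?n * ?I \<le> ?S" unfolding le_iff_add using main by blast
  then have "ennreal ?n * ?I < top" using Sfin by (rule order_le_less_trans)
  then have "?I < top" using n by (auto simp: ennreal_mult_less_top)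
  then obtain I where I: "?I = ennreal I" "I \<ge> 0" by (cases ?I) auto
  have "ennreal S = ennreal (?n * I + real k / real (k + CARD('n)) * S)"
    using main unfolding S(1) I(1) using S(2) I(2) by (simp add: ennreal_mult[symmetric] ennreal_plus[symmetric] del: ennreal_plus)
  then have eq: "S = ?n * I + real k / real (k + CARD('n)) * S"
    using S(2) I(2) by (subst (asm) ennreal_inj) auto
  have nk: "real (k + CARD('n)) > 0" using n unfolding of_nat_add by linarith
  from eq have "real (k + CARD('n)) * S = real (k + CARD('n)) * (?n * I) + real k * S"
    using nk by (simp add: field_simps)
  then have "?n * S = ?n * (real (CARD('n) + k) * I)" by (simp add: algebra_simps)
  then have SI: "S = real (CARD('n) + k) * I" using n by simp
  show "ennreal (real (CARD('n) + k)) * ?I = ?S"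
    unfolding S(1) I(1) SI by (intro ennreal_mult[symmetric]) (use I(2) in auto)
qed

end

section \<open>Polynomials and Riesz functionals\<close>

lemma riesz_superset:
  assumes "finite S" "Poly_Mapping.keys p \<subseteq> S"
  shows "riesz y p = (\<Sum>\<alpha>\<in>S. Poly_Mapping.lookup p \<alpha> * y \<alpha>)"
  unfolding riesz_def using assms by (intro sum.mono_neutral_left) (auto simp: in_keys_iff)

lemma riesz_0 [simp]: "riesz y 0 = 0"
  by (simp add: riesz_def)

lemma riesz_add: "riesz y (p + q) = riesz y p + riesz y q"
proof -
  let ?S = "Poly_Mapping.keys p \<union> Poly_Mapping.keys q"
  have "Poly_Mapping.keys (p + q) \<subseteq> ?S" by (rule keys_add)
  then show ?thesis
    by (simp add: riesz_superset[of ?S] lookup_add distrib_right sum.distrib)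
qed

lemma riesz_uminus: "riesz y (- p) = - riesz y p"
  by (simp add: riesz_def sum_negf)

lemma riesz_diff: "riesz y (p - q) = riesz y p - riesz y q"
  using riesz_add[of y p "- q"] by (simp add: riesz_uminus)

lemma riesz_sum: "riesz y (\<Sum>i\<in>I. p i) = (\<Sum>i\<in>I. riesz y (p i))"
  by (induction I rule: infinite_finite_induct) (simp_all add: riesz_add)

lemma riesz_single [simp]: "riesz y (Poly_Mapping.single \<alpha> c) = c * y \<alpha>"
  by (simp add: riesz_def)

lemma riesz_diff_left: "riesz (\<lambda>\<alpha>. y \<alpha> - z \<alpha>) p = riesz y p - riesz z p"
  by (simp add: riesz_def right_diff_distrib sum_subtractf)

lemma poly_mapping_sum_singles:
  assumes "finite S" "Poly_Mapping.keys p \<subseteq> S"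
  shows "p = (\<Sum>\<alpha>\<in>S. Poly_Mapping.single \<alpha> (Poly_Mapping.lookup p \<alpha>))"
proof (rule poly_mapping_eqI)
  fix k
  have "Poly_Mapping.lookup (\<Sum>\<alpha>\<in>S. Poly_Mapping.single \<alpha> (Poly_Mapping.lookup p \<alpha>)) k
      = (\<Sum>\<alpha>\<in>S. if \<alpha> = k then Poly_Mapping.lookup p k else 0)"
    unfolding lookup_sum by (intro sum.cong) (auto simp: lookup_single when_def)
  also have "\<dots> = Poly_Mapping.lookup p k"
    using assms by (auto simp: in_keys_iff)
  finally show "Poly_Mapping.lookup p k = Poly_Mapping.lookup (\<Sum>\<alpha>\<in>S. Poly_Mapping.single \<alpha> (Poly_Mapping.lookup p \<alpha>)) k" ..
qed

lemma riesz_scale_left: "riesz y (Poly_Mapping.single 0 c * p) = c * riesz y p"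
proof -
  have "Poly_Mapping.single 0 c * p = (\<Sum>\<alpha>\<in>Poly_Mapping.keys p. Poly_Mapping.single \<alpha> (c * Poly_Mapping.lookup p \<alpha>))"
    by (subst poly_mapping_sum_singles[of "Poly_Mapping.keys p" p]) (simp_all add: sum_distrib_left mult_single)
  then show ?thesis by (simp add: riesz_sum riesz_def[of y p] sum_distrib_left mult.assoc)
qed

lemma riesz_single_mult: "riesz y (p * Poly_Mapping.single \<gamma> c) = c * riesz y (p * Poly_Mapping.single \<gamma> 1)"
proof -
  have "p * Poly_Mapping.single \<gamma> c = Poly_Mapping.single 0 c * (p * Poly_Mapping.single \<gamma> 1)"
    by (simp add: mult.left_commute[of "Poly_Mapping.single 0 c"] mult_single)
  then show ?thesis using riesz_scale_left[of y c "p * Poly_Mapping.single \<gamma> 1"] by simp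
qed

lemma peval_riesz: "peval p x = riesz (\<lambda>\<alpha>. monom_eval \<alpha> x) p"
  by (simp add: peval_def riesz_def)

lemma monom_eval_add: "monom_eval (\<alpha> + \<beta>) x = monom_eval \<alpha> x * monom_eval \<beta> x"
  by (simp add: monom_eval_def lookup_add power_add prod.distrib)

lemma monom_eval_0 [simp]: "monom_eval 0 x = 1"
  by (simp add: monom_eval_def)

lemma peval_add: "peval (p + q) x = peval p x + peval q x"
  and peval_diff: "peval (p - q) x = peval p x - peval q x"
  and peval_0 [simp]: "peval 0 x = 0"
  and peval_single [simp]: "peval (Poly_Mapping.single \<alpha> c) x = c * monom_eval \<alpha> x"
  and peval_sum: "peval (\<Sum>i\<in>I. r i) x = (\<Sum>i\<in>I. peval (r i) x)"
  by (simp_all add: peval_riesz riesz_add riesz_diff riesz_sum)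

lemma peval_1 [simp]: "peval 1 x = 1"
  by (simp flip: single_one)

lemma peval_mult: "peval (p * q) x = peval p x * peval q x"
proof -
  let ?P = "Poly_Mapping.keys p" and ?Q = "Poly_Mapping.keys q"
  have "p * q = (\<Sum>\<alpha>\<in>?P. Poly_Mapping.single \<alpha> (Poly_Mapping.lookup p \<alpha>)) * (\<Sum>\<beta>\<in>?Q. Poly_Mapping.single \<beta> (Poly_Mapping.lookup q \<beta>))"
    using poly_mapping_sum_singles[of ?P p, symmetric] poly_mapping_sum_singles[of ?Q q, symmetric] by simp
  also have "\<dots> = (\<Sum>\<alpha>\<in>?P. \<Sum>\<beta>\<in>?Q. Poly_Mapping.single (\<alpha> + \<beta>) (Poly_Mapping.lookup p \<alpha> * Poly_Mapping.lookup q \<beta>))"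
    by (simp add: sum_product mult_single)
  finally have "peval (p * q) x = (\<Sum>\<alpha>\<in>?P. \<Sum>\<beta>\<in>?Q. Poly_Mapping.lookup p \<alpha> * Poly_Mapping.lookup q \<beta> * (monom_eval \<alpha> x * monom_eval \<beta> x))"
    by (simp add: peval_sum monom_eval_add)
  also have "\<dots> = peval p x * peval q x"
    by (simp add: peval_def sum_product mult_ac)
  finally show ?thesis .
qed

lemma total_deg_add: "total_deg (\<alpha> + \<beta>) = total_deg \<alpha> + total_deg \<beta>"
  by (simp add: total_deg_def lookup_add sum.distrib)

lemma total_deg_0 [simp]: "total_deg 0 = 0"
  by (simp add: total_deg_def)

lemma total_deg_eq_0_iff: "total_deg \<alpha> = 0 \<longleftrightarrow> \<alpha> = 0"
  by (simp add: total_deg_def poly_mapping_eq_iff fun_eq_iff)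

lemma finite_multiindices [simp]: "finite (multiindices k :: 'n::finite multiindex set)"
proof -
  have "Poly_Mapping.lookup ` (multiindices k :: 'n multiindex set) \<subseteq> PiE UNIV (\<lambda>_. {..k})"
  proof (clarsimp simp: multiindices_def PiE_def)
    fix \<alpha> :: "'n multiindex" and i assume "total_deg \<alpha> \<le> k"
    moreover have "Poly_Mapping.lookup \<alpha> i \<le> total_deg \<alpha>"
      unfolding total_deg_def by (rule member_le_sum) auto
    ultimately show "Poly_Mapping.lookup \<alpha> i \<le> k" by simp
  qed
  then have "finite (Poly_Mapping.lookup ` (multiindices k :: 'n multiindex set))"
    by (rule finite_subset) (intro finite_PiE, auto)
  then show ?thesis by (rule finite_imageD) (auto simp: inj_on_def)
qed

text \<open>Units are moved from \<gamma> to \<beta> one at a time.\<close>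

lemma multiindex_split:
  fixes \<alpha> :: "'n::finite multiindex"
  assumes "j \<le> total_deg \<alpha>"
  shows "\<exists>\<beta> \<gamma>. \<alpha> = \<beta> + \<gamma> \<and> total_deg \<beta> = j"
  using assms
proof (induction j)
  case 0
  then show ?case by (intro exI[of _ 0] exI[of _ \<alpha>]) simp
next
  case (Suc j)
  then obtain \<beta> \<gamma> where bg: "\<alpha> = \<beta> + \<gamma>" "total_deg \<beta> = j" by auto
  have "Suc j \<le> j + total_deg \<gamma>" using Suc.prems unfolding bg(1) total_deg_add bg(2) .
  then have "total_deg \<gamma> \<noteq> 0" by simp
  then obtain i where i: "Poly_Mapping.lookup \<gamma> i \<noteq> 0"
    unfolding total_deg_def by (auto elim: sum.not_neutral_contains_not_neutral)
  have g: "\<gamma> = Poly_Mapping.single i 1 + (\<gamma> - Poly_Mapping.single i 1)"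
  proof (rule poly_mapping_eqI)
    fix k
    show "Poly_Mapping.lookup \<gamma> k = Poly_Mapping.lookup (Poly_Mapping.single i 1 + (\<gamma> - Poly_Mapping.single i 1)) k"
      using i by (cases "k = i") (simp_all add: lookup_add lookup_minus lookup_single)
  qed
  have "total_deg (Poly_Mapping.single i (1::nat)) = 1"
    by (simp add: total_deg_def lookup_single when_def)
  then have "total_deg (\<beta> + Poly_Mapping.single i 1) = Suc j" using bg by (simp add: total_deg_add)
  moreover have "\<alpha> = (\<beta> + Poly_Mapping.single i 1) + (\<gamma> - Poly_Mapping.single i 1)"
    using bg(1) g by (simp add: add.assoc)
  ultimately show ?case by blast
qed

text \<open>Every variable of the program is thereby an entry of a moment matrix, so that bounds on
  entries reach all variables.\<close>

lemma multiindices_double: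
  fixes \<alpha> :: "'n::finite multiindex"
  assumes "total_deg \<alpha> \<le> 2 * k"
  obtains \<beta> \<gamma> where "\<alpha> = \<beta> + \<gamma>" "\<beta> \<in> multiindices k" "\<gamma> \<in> multiindices k"
proof -
  obtain \<beta> \<gamma> where "\<alpha> = \<beta> + \<gamma>" "total_deg \<beta> = min k (total_deg \<alpha>)"
    using multiindex_split[of "min k (total_deg \<alpha>)" \<alpha>] by auto
  then show thesis using that assms by (auto simp: multiindices_def total_deg_add)
qed

section \<open>Positive semidefinite matrices as positivity on squares\<close>

lemma quadratic_form_localizing:
  fixes c :: "'n multiindex \<Rightarrow> real"
  assumes "finite I"
  defines "q \<equiv> \<Sum>\<alpha>\<in>I. Poly_Mapping.single \<alpha> (c \<alpha>)"
  shows "(\<Sum>i\<in>I. \<Sum>j\<in>I. c i * localizing_matrix g y i j * c j) = riesz y (g * (q * q))"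
proof -
  have "g * (q * q) = (\<Sum>i\<in>I. \<Sum>j\<in>I. g * Poly_Mapping.single (i + j) (c i * c j))"
  proof -
    have "q * q = (\<Sum>i\<in>I. \<Sum>j\<in>I. Poly_Mapping.single (i + j) (c i * c j))"
      unfolding q_def sum_product by (simp add: mult_single)
    then show ?thesis by (simp add: sum_distrib_left)
  qed
  then have "riesz y (g * (q * q)) = (\<Sum>i\<in>I. \<Sum>j\<in>I. c i * c j * localizing_matrix g y i j)"
    by (simp add: riesz_sum localizing_matrix_def riesz_single_mult[where c="c _ * c _"])
  then show ?thesis by (simp add: mult_ac)
qed

text \<open>A coefficient vector on I is a polynomial q supported on I, and the quadratic form is
  the Riesz functional of \<open>g * (q * q)\<close>. Symmetry is automatic, since an entry depends
  only on the sum of its indices.\<close>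

lemma psd_on_localizing_iff:
  assumes "finite I"
  shows "psd_on I (localizing_matrix g y) \<longleftrightarrow> (\<forall>q. Poly_Mapping.keys q \<subseteq> I \<longrightarrow> 0 \<le> riesz y (g * (q * q)))"
proof
  assume psd: "psd_on I (localizing_matrix g y)"
  show "\<forall>q. Poly_Mapping.keys q \<subseteq> I \<longrightarrow> 0 \<le> riesz y (g * (q * q))"
  proof (intro allI impI)
    fix q :: "'a rpoly" assume "Poly_Mapping.keys q \<subseteq> I"
    then have "(\<Sum>\<alpha>\<in>I. Poly_Mapping.single \<alpha> (Poly_Mapping.lookup q \<alpha>)) = q"
      by (rule poly_mapping_sum_singles[OF assms, symmetric])
    then have "riesz y (g * (q * q)) = (\<Sum>i\<in>I. \<Sum>j\<in>I. Poly_Mapping.lookup q i * localizing_matrix g y i j * Poly_Mapping.lookup q j)"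
      using quadratic_form_localizing[OF assms, of "Poly_Mapping.lookup q" g y] by simp
    also have "\<dots> \<ge> 0" using psd unfolding psd_on_def by blast
    finally show "0 \<le> riesz y (g * (q * q))" .
  qed
next
  assume r: "\<forall>q. Poly_Mapping.keys q \<subseteq> I \<longrightarrow> 0 \<le> riesz y (g * (q * q))"
  show "psd_on I (localizing_matrix g y)"
    unfolding psd_on_def
  proof (intro conjI ballI allI)
    fix c :: "'a multiindex \<Rightarrow> real"
    have "Poly_Mapping.keys (\<Sum>\<alpha>\<in>I. Poly_Mapping.single \<alpha> (c \<alpha>)) \<subseteq> I"
      by (rule order_trans[OF keys_sum]) auto
    then show "0 \<le> (\<Sum>i\<in>I. \<Sum>j\<in>I. c i * localizing_matrix g y i j * c j)"
      unfolding quadratic_form_localizing[OF assms] using r by blast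
  qed (simp add: localizing_matrix_def add.commute)
qed

lemma psd_on_moment_iff:
  assumes "finite I"
  shows "psd_on I (moment_matrix y) \<longleftrightarrow> (\<forall>q. Poly_Mapping.keys q \<subseteq> I \<longrightarrow> 0 \<le> riesz y (q * q))"
  unfolding moment_matrix_def using psd_on_localizing_iff[OF assms, of 1 y] by simp

lemma loewner_le_on_moment_iff:
  assumes "finite I"
  shows "loewner_le_on I (moment_matrix y) (moment_matrix z) \<longleftrightarrow>
    (\<forall>q. Poly_Mapping.keys q \<subseteq> I \<longrightarrow> riesz y (q * q) \<le> riesz z (q * q))"
proof -
  have "(\<lambda>i j. moment_matrix z i j - moment_matrix y i j) = moment_matrix (\<lambda>\<alpha>. z \<alpha> - y \<alpha>)"
    by (intro ext) (simp add: moment_matrix_def localizing_matrix_def)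
  then show ?thesis
    unfolding loewner_le_on_def by (simp add: psd_on_moment_iff[OF assms] riesz_diff_left)
qed

text \<open>Positivity on the squares of the sum and of the difference of the two monomials.\<close>

lemma psd_on_moment_entry_bound:
  assumes psd: "psd_on I (moment_matrix y)" and I: "finite I" "\<beta> \<in> I" "\<gamma> \<in> I"
  shows "\<bar>y (\<beta> + \<gamma>)\<bar> \<le> (y (\<beta> + \<beta>) + y (\<gamma> + \<gamma>)) / 2"
proof -
  have "0 \<le> riesz y (q * q)" if "Poly_Mapping.keys q \<subseteq> I" for q
    using psd that psd_on_moment_iff[OF I(1)] by blast
  moreover have "Poly_Mapping.keys (pmonom \<beta> + Poly_Mapping.single \<gamma> s) \<subseteq> I" for s :: real
    using keys_add[of "pmonom \<beta>" "Poly_Mapping.single \<gamma> s"] I by (auto split: if_splits)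
  ultimately have "0 \<le> riesz y ((pmonom \<beta> + Poly_Mapping.single \<gamma> s) * (pmonom \<beta> + Poly_Mapping.single \<gamma> s))" for s :: real
    by blast
  moreover have "riesz y ((pmonom \<beta> + Poly_Mapping.single \<gamma> s) * (pmonom \<beta> + Poly_Mapping.single \<gamma> s))
      = y (\<beta> + \<beta>) + 2 * s * y (\<beta> + \<gamma>) + s * s * y (\<gamma> + \<gamma>)" for s :: real
  proof -
    have eq: "(pmonom \<beta> + Poly_Mapping.single \<gamma> s) * (pmonom \<beta> + Poly_Mapping.single \<gamma> s)
      = pmonom (\<beta> + \<beta>) + Poly_Mapping.single (\<beta> + \<gamma>) s + (Poly_Mapping.single (\<beta> + \<gamma>) s + Poly_Mapping.single (\<gamma> + \<gamma>) (s * s))"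
      by (simp only: distrib_left distrib_right mult_single mult_1_left mult_1_right add.commute[of \<gamma> \<beta>] add.assoc)
    show ?thesis unfolding eq riesz_add riesz_single by simp
  qed
  ultimately have pos: "0 \<le> y (\<beta> + \<beta>) + 2 * s * y (\<beta> + \<gamma>) + s * s * y (\<gamma> + \<gamma>)" for s :: real
    by (simp only:)
  from pos[of 1] pos[of "-1"] show ?thesis by simp
qed

section \<open>Scaling, derivatives and uniform approximation of polynomials\<close>

lemma monom_eval_scale: "monom_eval \<alpha> (t *\<^sub>R x) = t ^ total_deg \<alpha> * monom_eval \<alpha> x"
  by (simp add: monom_eval_def total_deg_def power_mult_distrib prod.distrib power_sum)

lemma peval_scale:
  assumes "homogeneous k p" shows "peval p (t *\<^sub>R x) = t ^ k * peval p x"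
  using assms unfolding peval_def homogeneous_def by (simp add: monom_eval_scale sum_distrib_left mult_ac)

lemma continuous_on_monom_eval [continuous_intros]: "continuous_on S (monom_eval \<alpha>)"
  unfolding monom_eval_def by (intro continuous_intros)

lemma continuous_on_peval [continuous_intros]: "continuous_on S (peval p)"
  unfolding peval_def by (intro continuous_intros)

lemma borel_measurable_monom_eval [measurable]: "monom_eval \<alpha> \<in> borel_measurable borel"
  by (intro borel_measurable_continuous_onI continuous_on_monom_eval)

lemma borel_measurable_peval [measurable]: "peval p \<in> borel_measurable borel"
  by (intro borel_measurable_continuous_onI continuous_on_peval)

text \<open>Partial derivatives term by term. The truncated subtraction in the exponent is harmless,
  since the exponent 0 also produces the factor 0.\<close>

definition pgrad :: "'n::finite rpoly \<Rightarrow> real ^ 'n \<Rightarrow> real ^ 'n" where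
  "pgrad p x = (\<chi> i. \<Sum>\<alpha>\<in>Poly_Mapping.keys p. Poly_Mapping.lookup p \<alpha> *
     (real (Poly_Mapping.lookup \<alpha> i) * (x $ i) ^ (Poly_Mapping.lookup \<alpha> i - 1) *
       (\<Prod>j\<in>UNIV - {i}. (x $ j) ^ Poly_Mapping.lookup \<alpha> j)))"

lemma peval_has_derivative: "(peval p has_derivative (\<lambda>u. pgrad p x \<bullet> u)) (at x)"
proof -
  have c: "((\<lambda>x. (x $ i) ^ k) has_derivative (\<lambda>u. real k * (u $ i) * (x $ i) ^ (k - 1))) (at x)" for i :: 'a and k
    by (auto intro!: derivative_eq_intros bounded_linear_imp_has_derivative bounded_linear_vec_nth)
  have m: "(monom_eval \<alpha> has_derivative (\<lambda>u. \<Sum>i\<in>UNIV. (real (Poly_Mapping.lookup \<alpha> i) * (u $ i) * (x $ i) ^ (Poly_Mapping.lookup \<alpha> i - 1)) *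
       (\<Prod>j\<in>UNIV - {i}. (x $ j) ^ Poly_Mapping.lookup \<alpha> j))) (at x)" for \<alpha> :: "'a multiindex"
    unfolding monom_eval_def by (intro has_derivative_prod c)
  have "(peval p has_derivative (\<lambda>u. \<Sum>\<alpha>\<in>Poly_Mapping.keys p. Poly_Mapping.lookup p \<alpha> *
      (\<Sum>i\<in>UNIV. (real (Poly_Mapping.lookup \<alpha> i) * (u $ i) * (x $ i) ^ (Poly_Mapping.lookup \<alpha> i - 1)) *
       (\<Prod>j\<in>UNIV - {i}. (x $ j) ^ Poly_Mapping.lookup \<alpha> j)))) (at x)"
    unfolding peval_def by (intro has_derivative_sum has_derivative_mult_right m)
  also have "(\<lambda>u. \<Sum>\<alpha>\<in>Poly_Mapping.keys p. Poly_Mapping.lookup p \<alpha> *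
      (\<Sum>i\<in>UNIV. (real (Poly_Mapping.lookup \<alpha> i) * (u $ i) * (x $ i) ^ (Poly_Mapping.lookup \<alpha> i - 1)) *
       (\<Prod>j\<in>UNIV - {i}. (x $ j) ^ Poly_Mapping.lookup \<alpha> j))) = (\<lambda>u. pgrad p x \<bullet> u)"
    unfolding pgrad_def inner_vec_def sum_distrib_left
    by (rule ext, subst sum.swap) (simp add: sum_distrib_left sum_distrib_right mult_ac)
  finally show ?thesis .
qed

lemma continuous_on_pgrad: "continuous_on S (pgrad p)"
  unfolding pgrad_def by (intro continuous_intros)

lemma gradient_peval: "gradient (peval p) x = pgrad p x"
  unfolding gradient_def
proof (rule the_equality)
  show g: "GDERIV (peval p) x :> pgrad p x"
    unfolding gderiv_def using peval_has_derivative[of p x] by (simp add: inner_commute)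
  fix D assume "GDERIV (peval p) x :> D"
  then have "(\<lambda>h. h \<bullet> D) = (\<lambda>h. h \<bullet> pgrad p x)"
    using g unfolding gderiv_def by (rule has_derivative_unique)
  then have "(D - pgrad p x) \<bullet> D = (D - pgrad p x) \<bullet> pgrad p x" by (rule fun_cong)
  then have "(D - pgrad p x) \<bullet> (D - pgrad p x) = 0" by (simp only: inner_diff_right)
  then show "D = pgrad p x" by simp
qed

text \<open>Connects \<open>rpoly\<close> to the class of functions for which the Stone-Weierstrass
  theorem is stated.\<close>

lemma real_polynomial_function_peval:
  fixes f :: "real ^ 'n \<Rightarrow> real"
  assumes "real_polynomial_function f" shows "\<exists>p. \<forall>x. f x = peval p x"
  using assms
proof (induction f rule: real_polynomial_function.induct)
  case (linear f)
  have x: "monom_eval (Poly_Mapping.single i (Suc 0)) x = x $ i" for i :: 'n and x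
  proof -
    have "monom_eval (Poly_Mapping.single i (Suc 0)) x = (\<Prod>j\<in>UNIV. if j = i then x $ i else 1)"
      unfolding monom_eval_def by (intro prod.cong) (auto simp: lookup_single when_def)
    then show ?thesis by simp
  qed
  have "f x = peval (\<Sum>i\<in>UNIV. Poly_Mapping.single (Poly_Mapping.single i 1) (f (axis i 1))) x" for x
  proof -
    have l: "linear f" using linear bounded_linear.linear by blast
    have "f x = f (\<Sum>i\<in>UNIV. x $ i *\<^sub>R axis i 1)" by (simp add: basis_expansion scalar_mult_eq_scaleR[symmetric])
    also have "\<dots> = (\<Sum>i\<in>UNIV. x $ i * f (axis i 1))"
      by (simp add: linear_sum[OF l] linear_scale[OF l])
    finally show ?thesis by (simp add: peval_sum x mult.commute)
  qed
  then show ?case by blast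
next
  case (const c)
  show ?case by (intro exI[of _ "Poly_Mapping.single 0 c"]) simp
next
  case (add f g)
  then obtain p q where "\<forall>x. f x = peval p x" "\<forall>x. g x = peval q x" by blast
  then show ?case by (intro exI[of _ "p + q"]) (simp add: peval_add)
next
  case (mult f g)
  then obtain p q where "\<forall>x. f x = peval p x" "\<forall>x. g x = peval q x" by blast
  then show ?case by (intro exI[of _ "p * q"]) (simp add: peval_mult)
qed

lemma peval_approx:
  fixes f :: "real ^ 'n \<Rightarrow> real"
  assumes "compact S" "continuous_on S f" "0 < e"
  obtains p where "\<And>x. x \<in> S \<Longrightarrow> \<bar>f x - peval p x\<bar> < e"
proof -
  obtain g where "real_polynomial_function g" "\<And>x. x \<in> S \<Longrightarrow> \<bar>f x - g x\<bar> < e"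
    using Stone_Weierstrass_real_polynomial_function[OF assms] by blast
  moreover then obtain p where "\<forall>x. g x = peval p x" using real_polynomial_function_peval[of g] by blast
  ultimately show thesis by (auto intro: that[of p])
qed

lemma integrable_peval:
  assumes "\<And>\<alpha>. integrable M (monom_eval \<alpha>)"
  shows "integrable M (peval p)" "(\<integral>x. peval p x \<partial>M) = riesz (\<lambda>\<alpha>. \<integral>x. monom_eval \<alpha> x \<partial>M) p"
  unfolding peval_def riesz_def using assms by auto

section \<open>The divergence identity\<close>

lemma monom_eval_le_1:
  assumes "\<And>i. \<bar>x $ i\<bar> \<le> 1" shows "\<bar>monom_eval \<alpha> x\<bar> \<le> 1"
proof -
  have "\<bar>monom_eval \<alpha> x\<bar> = (\<Prod>i\<in>UNIV. \<bar>x $ i\<bar> ^ Poly_Mapping.lookup \<alpha> i)"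
    by (simp add: monom_eval_def abs_prod power_abs)
  also have "\<dots> \<le> 1" using assms by (intro prod_le_1) (auto intro: power_le_one)
  finally show ?thesis .
qed

lemma homogeneous_0_peval:
  assumes "homogeneous 0 p" shows "p = pconst (Poly_Mapping.lookup p 0)" "pgrad p x = 0"
proof -
  have k: "Poly_Mapping.keys p \<subseteq> {0}" using assms by (auto simp: homogeneous_def total_deg_eq_0_iff)
  show "p = pconst (Poly_Mapping.lookup p 0)"
    using poly_mapping_sum_singles[OF _ k] by simp
  show "pgrad p x = 0"
    unfolding pgrad_def vec_eq_iff using k by (auto intro!: sum.neutral)
qed

locale homogeneous_semialgebraic =
  fixes m :: nat and g :: "nat \<Rightarrow> 'n::finite rpoly" and dg :: "nat \<Rightarrow> nat" and b :: "nat \<Rightarrow> real"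
  assumes homog: "\<And>j. j \<in> {1..m} \<Longrightarrow> homogeneous (dg j) (g j)"
    and b_pos: "\<And>j. j \<in> {1..m} \<Longrightarrow> 0 < b j"
    and Omega_compact: "compact (Omega m g b)"
    and Omega_box: "Omega m g b \<subseteq> open_box"
    and grad: "\<And>j x. j \<in> {1..m} \<Longrightarrow> x \<in> Omega_face m g b j \<Longrightarrow> gradient (peval (g j)) x \<noteq> 0"
    and null: "\<And>j k. j \<in> {1..m} \<Longrightarrow> k \<in> {1..m} \<Longrightarrow> k \<noteq> j \<Longrightarrow>
        emeasure (face_measure m g b j)
          {x \<in> space (face_measure m g b j). peval (g k) x = b k} = 0"
begin

abbreviation "\<Omega> \<equiv> Omega m g b"
abbreviation "face \<equiv> Omega_face m g b"
abbreviation "H \<equiv> hausdorff_measure (CARD('n) - 1) :: (real ^ 'n) measure"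

text \<open>The gradient of a constant is zero, which the gradient condition forbids at points of a
  face.\<close>

lemma face_deg_0: "j \<in> {1..m} \<Longrightarrow> dg j = 0 \<Longrightarrow> face j = {}"
  using grad homog homogeneous_0_peval(2) by (fastforce simp: gradient_peval)

lemma C1: "j \<in> {1..m} \<Longrightarrow> dg j > 0 \<Longrightarrow> homogeneous_C1 (peval (g j)) (pgrad (g j)) (dg j) (b j)"
  using homog b_pos by (unfold_locales) (auto simp: peval_has_derivative continuous_on_pgrad peval_scale)

lemma face_compact: "compact (face j)"
proof -
  have "face j = \<Omega> \<inter> {x. peval (g j) x = b j}" by (auto simp: Omega_face_def)
  then show ?thesis
    by (auto intro!: compact_Int_closed Omega_compact closed_Collect_eq continuous_intros)
qed

lemma face_level: "face j \<subseteq> {x. peval (g j) x = b j}"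
  by (auto simp: Omega_face_def)

lemma face_subset: "face j \<subseteq> \<Omega>"
  by (auto simp: Omega_face_def)

lemma Omega_borel [measurable]: "\<Omega> \<in> sets borel"
  using Omega_compact by (simp add: borel_compact)

lemma face_borel [measurable]: "face j \<in> sets borel"
  using face_compact by (simp add: borel_compact)

lemma pgrad_borel [measurable]: "pgrad p \<in> borel_measurable borel"
  by (intro borel_measurable_continuous_onI continuous_on_pgrad)

lemma Omega_abs_le_1: "x \<in> \<Omega> \<Longrightarrow> \<bar>x $ i\<bar> \<le> 1"
  using Omega_box by (auto simp: open_box_def subset_iff abs_le_iff less_imp_le minus_le_iff)

text \<open>The polynomial \<open>g j\<close> has positive degree and a positive value at x, so it
  exceeds \<open>b j\<close> as soon as one moves outward along the ray through x.\<close>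

lemma face_frontier:
  assumes j: "j \<in> {1..m}" shows "face j \<subseteq> frontier \<Omega>"
proof
  fix x assume x: "x \<in> face j"
  then have d: "dg j > 0" using face_deg_0[OF j] by auto
  interpret C: homogeneous_C1 "peval (g j)" "pgrad (g j)" "dg j" "b j" by (rule C1[OF j d])
  have xO: "x \<in> \<Omega>" and gx: "peval (g j) x = b j" using x by (auto simp: Omega_face_def)
  have "x \<notin> interior \<Omega>"
  proof
    assume "x \<in> interior \<Omega>"
    then obtain e where e: "e > 0" "cball x e \<subseteq> \<Omega>" unfolding mem_interior_cball by auto
    define t where "t = 1 + e / (norm x + 1)"
    have n1: "norm x + 1 > 0" by (simp add: add_nonneg_pos)
    then have t: "t > 1" using e by (simp add: t_def)
    have "dist x (t *\<^sub>R x) = norm ((t - 1) *\<^sub>R x)" by (simp add: dist_norm norm_minus_commute algebra_simps)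
    also have "\<dots> = e * (norm x / (norm x + 1))" using t n1 e by (simp add: t_def)
    also have "\<dots> \<le> e * 1" using e n1 by (intro mult_left_mono) (auto simp: divide_le_eq)
    finally have "t *\<^sub>R x \<in> \<Omega>" using e by auto
    then have "peval (g j) (t *\<^sub>R x) \<le> b j" using j by (auto simp: Omega_def)
    then have "t ^ dg j * b j \<le> b j" using C.homog[of t x] t gx by simp
    moreover have "1 < t ^ dg j" using t d by (simp add: one_less_power)
    ultimately show False using b_pos[OF j] by (simp add: mult_le_cancel_right1)
  qed
  then show "x \<in> frontier \<Omega>" using xO closure_subset by (auto simp: frontier_def)
qed

lemma face_measure_eq:
  assumes j: "j \<in> {1..m}" shows "face_measure m g b j = restrict_space H (face j)"
proof -
  have f: "frontier \<Omega> \<in> sets borel" by (simp add: frontier_closed)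
  have "face_measure m g b j = restrict_space H (frontier \<Omega> \<inter> face j)"
    unfolding face_measure_def surface_measure_def
    by (rule restrict_restrict_space) (use f face_borel in \<open>auto simp: sets_restrict_space\<close>)
  then show ?thesis using face_frontier[OF j] by (simp add: Int_absorb1)
qed

lemma face_overlap_null:
  assumes "j \<in> {1..m}" "k \<in> {1..m}" "k \<noteq> j"
  shows "emeasure H (face j \<inter> {x. peval (g k) x = b k}) = 0"
proof -
  have "{x. peval (g k) x = b k} \<in> sets borel" by measurable
  then have s: "face j \<inter> {x. peval (g k) x = b k} \<in> sets H" by auto
  have "{x \<in> space (face_measure m g b j). peval (g k) x = b k} = face j \<inter> {x. peval (g k) x = b k}"
    unfolding face_measure_eq[OF assms(1)] by (auto simp: space_restrict_space)
  moreover have "emeasure (restrict_space H (face j)) (face j \<inter> {x. peval (g k) x = b k}) = emeasure H (face j \<inter> {x. peval (g k) x = b k})"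
    by (rule emeasure_restrict_space) auto
  ultimately show ?thesis using null[OF assms] unfolding face_measure_eq[OF assms(1)] by simp
qed

section \<open>The face measures\<close>

definition phi_density :: "nat \<Rightarrow> real ^ 'n \<Rightarrow> real" where
  "phi_density j x = indicator (face j) x / norm (pgrad (g j) x)"

lemma phi_density_nonneg: "0 \<le> phi_density j x"
  by (simp add: phi_density_def)

lemma phi_density_borel [measurable]: "phi_density j \<in> borel_measurable borel"
  unfolding phi_density_def by measurable

text \<open>A version of \<open>phi_measure\<close> on the whole space, with the face put into the
  density. The measures of different faces then live on one space and can be added.\<close>

definition phi :: "nat \<Rightarrow> (real ^ 'n) measure" where
  "phi j = density H (\<lambda>x. ennreal (phi_density j x))"

lemma sets_phi [simp, measurable_cong]: "sets (phi j) = sets borel"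
  by (simp add: phi_def)

lemma integral_phi_measure:
  fixes f :: "real ^ 'n \<Rightarrow> real"
  assumes j: "j \<in> {1..m}" and f [measurable]: "f \<in> borel_measurable borel"
  shows "(\<integral>x. f x \<partial>phi_measure m g b j) = (\<integral>x. f x \<partial>phi j)"
proof -
  have mf: "h \<in> borel_measurable (restrict_space H (face j))" if "h \<in> borel_measurable borel" for h :: "real ^ 'n \<Rightarrow> real"
    using that by (intro measurable_restrict_space1) (simp add: measurable_def)
  have "(\<integral>x. f x \<partial>phi_measure m g b j) = (\<integral>x. f x \<partial>density (restrict_space H (face j)) (\<lambda>x. ennreal (1 / norm (pgrad (g j) x))))"
    unfolding phi_measure_def face_measure_eq[OF j] gradient_peval ..
  also have "\<dots> = (\<integral>x. (1 / norm (pgrad (g j) x)) *\<^sub>R f x \<partial>restrict_space H (face j))"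
  proof (rule integral_density)
    show "f \<in> borel_measurable (restrict_space H (face j))" by (rule mf[OF f])
    have "(\<lambda>x. 1 / norm (pgrad (g j) x)) \<in> borel_measurable borel" by measurable
    then show "(\<lambda>x. 1 / norm (pgrad (g j) x)) \<in> borel_measurable (restrict_space H (face j))" by (rule mf)
  qed simp
  also have "\<dots> = (\<integral>x. indicator (face j) x *\<^sub>R ((1 / norm (pgrad (g j) x)) *\<^sub>R f x) \<partial>H)"
    by (rule integral_restrict_space) auto
  also have "\<dots> = (\<integral>x. phi_density j x *\<^sub>R f x \<partial>H)"
    by (intro Bochner_Integration.integral_cong) (auto simp: phi_density_def)
  also have "\<dots> = (\<integral>x. f x \<partial>phi j)"
    unfolding phi_def by (rule integral_density[symmetric]) (auto simp: phi_density_nonneg)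
  finally show ?thesis .
qed

lemma nn_integral_phi:
  fixes f :: "real ^ 'n \<Rightarrow> ennreal"
  assumes f [measurable]: "f \<in> borel_measurable borel" and j: "j \<in> {1..m}"
  shows "ennreal (real (dg j) * b j) * (\<integral>\<^sup>+x. f x \<partial>phi j)
    = (\<integral>\<^sup>+x. f x * (ennreal (real (dg j) * b j / norm (pgrad (g j) x)) * indicator (face j) x) \<partial>H)"
proof -
  have "(\<integral>\<^sup>+x. f x \<partial>phi j) = (\<integral>\<^sup>+x. ennreal (phi_density j x) * f x \<partial>H)"
    unfolding phi_def by (intro nn_integral_density) auto
  then have "ennreal (real (dg j) * b j) * (\<integral>\<^sup>+x. f x \<partial>phi j) = (\<integral>\<^sup>+x. ennreal (real (dg j) * b j) * (ennreal (phi_density j x) * f x) \<partial>H)"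
    by (simp add: nn_integral_cmult)
  also have "\<dots> = (\<integral>\<^sup>+x. f x * (ennreal (real (dg j) * b j / norm (pgrad (g j) x)) * indicator (face j) x) \<partial>H)"
  proof (rule nn_integral_cong)
    fix x
    have "ennreal (real (dg j) * b j) * ennreal (phi_density j x) = ennreal (real (dg j) * b j / norm (pgrad (g j) x)) * indicator (face j) x"
      using b_pos[OF j] by (subst ennreal_mult[symmetric]) (auto simp: phi_density_def indicator_def)
    then show "ennreal (real (dg j) * b j) * (ennreal (phi_density j x) * f x) = f x * (ennreal (real (dg j) * b j / norm (pgrad (g j) x)) * indicator (face j) x)"
      by (metis mult.assoc mult.commute)
  qed
  finally show ?thesis .
qed

lemma phi_AE_face: "AE x in phi j. x \<in> face j"
  unfolding phi_def by (subst AE_density) (auto simp: phi_density_def indicator_def)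

text \<open>For positive degree this is the finiteness part of \<open>polar_integration\<close> for
  the constant function 1, with k = 0.\<close>

lemma finite_measure_phi:
  assumes j: "j \<in> {1..m}" shows "finite_measure (phi j)"
proof (cases "dg j = 0")
  case True
  then have "phi_density j = (\<lambda>x. 0)" using face_deg_0[OF j] by (simp add: phi_density_def fun_eq_iff)
  then show ?thesis by (intro finite_measureI) (simp add: phi_def emeasure_density)
next
  case False
  then have d: "dg j > 0" by simp
  interpret C: homogeneous_C1 "peval (g j)" "pgrad (g j)" "dg j" "b j" by (rule C1[OF j d])
  have "(\<integral>\<^sup>+x. ennreal 1 * (ennreal (real (dg j) * b j / norm (pgrad (g j) x)) * indicator (face j) x) \<partial>H) < top"
    by (rule C.polar_integration(2)[OF face_compact face_level, where k=0 and B=1]) auto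
  then have "ennreal (real (dg j) * b j) * (\<integral>\<^sup>+x. ennreal 1 \<partial>phi j) < top"
    by (subst nn_integral_phi[OF _ j]) auto
  then have "(\<integral>\<^sup>+x. 1 \<partial>phi j) < top"
    using d b_pos[OF j] by (auto simp: ennreal_mult_less_top)
  then show ?thesis by (intro finite_measureI) simp
qed

lemma integrable_phi:
  fixes f :: "real ^ 'n \<Rightarrow> real"
  assumes j: "j \<in> {1..m}" and f: "continuous_on UNIV f"
  shows "integrable (phi j) f"
proof -
  interpret finite_measure "phi j" by (rule finite_measure_phi[OF j])
  have "compact (f ` face j)"
    using f by (intro compact_continuous_image face_compact) (rule continuous_on_subset, auto)
  then obtain B where B: "\<And>x. x \<in> face j \<Longrightarrow> norm (f x) \<le> B"
    using compact_imp_bounded bounded_iff by (metis imageI)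
  have "f \<in> borel_measurable borel" using f by (rule borel_measurable_continuous_onI)
  then show ?thesis
    using B by (intro integrable_const_bound[where B=B] eventually_mono[OF phi_AE_face[of j]]) (auto simp: measurable_def)
qed

section \<open>Decomposition into cones over the faces\<close>

lemma Omega_scale:
  assumes x: "x \<in> \<Omega>" and t: "0 < t" "t \<le> 1" shows "t *\<^sub>R x \<in> \<Omega>"
  unfolding Omega_def
proof (intro CollectI ballI)
  fix j assume j: "j \<in> {1..m}"
  have gx: "peval (g j) x \<le> b j" using x j by (auto simp: Omega_def)
  have "t ^ dg j * peval (g j) x \<le> b j"
  proof (cases "peval (g j) x \<ge> 0")
    case True
    have "t ^ dg j * peval (g j) x \<le> 1 * peval (g j) x"
      using t True by (intro mult_right_mono power_le_one) auto
    then show ?thesis using gx by simp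
  next
    case False
    then have "t ^ dg j * peval (g j) x \<le> 0" using t by (simp add: mult_nonneg_nonpos)
    then show ?thesis using b_pos[OF j] by simp
  qed
  then show "peval (g j) (t *\<^sub>R x) \<le> b j" using peval_scale[OF homog[OF j]] by simp
qed

lemma cone_face_subset: "cone_over (face j) \<subseteq> \<Omega>"
  using Omega_scale face_subset by (auto simp: cone_over_def)

text \<open>By compactness the ray through z has a largest multiple T that stays in \<Omega>. Some
  constraint is active there: if all finitely many were strict, they would remain so slightly beyond
  T.\<close>

lemma Omega_cover:
  assumes z: "z \<in> \<Omega>" "z \<noteq> 0"
  shows "\<exists>j\<in>{1..m}. 0 < dg j \<and> z \<in> cone_over (face j)"
proof -
  define S where "S = {t. t *\<^sub>R z \<in> \<Omega>} \<inter> {1..}"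
  have "closed {t. t *\<^sub>R z \<in> \<Omega>}"
  proof -
    have "{t. t *\<^sub>R z \<in> \<Omega>} = (\<lambda>t. t *\<^sub>R z) -` \<Omega>" by auto
    then show ?thesis using compact_imp_closed[OF Omega_compact]
      by (auto intro!: continuous_closed_vimage continuous_intros)
  qed
  then have "closed S" unfolding S_def by (intro closed_Int) auto
  moreover have "bounded S"
  proof -
    obtain B where B: "\<And>x. x \<in> \<Omega> \<Longrightarrow> norm x \<le> B" using compact_imp_bounded[OF Omega_compact] bounded_iff by blast
    have "norm t \<le> B / norm z" if "t \<in> S" for t
      using B[of "t *\<^sub>R z"] that z by (auto simp: S_def field_simps)
    then show ?thesis by (auto simp: bounded_iff)
  qed
  ultimately have "compact S" by (simp add: compact_eq_bounded_closed)
  moreover have "1 \<in> S" using z by (simp add: S_def)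
  ultimately obtain T where T: "T \<in> S" "\<And>t. t \<in> S \<Longrightarrow> t \<le> T"
    using compact_attains_sup[of S] by blast
  have T1: "T \<ge> 1" "T *\<^sub>R z \<in> \<Omega>" using T by (auto simp: S_def)
  have "\<exists>j\<in>{1..m}. peval (g j) (T *\<^sub>R z) = b j"
  proof (rule ccontr)
    assume "\<not> ?thesis"
    then have lt: "peval (g j) (T *\<^sub>R z) < b j" if "j \<in> {1..m}" for j
      using T1(2) that unfolding Omega_def by (force simp: less_le)
    have "\<forall>\<^sub>F t in at_right T. \<forall>j\<in>{1..m}. peval (g j) (t *\<^sub>R z) < b j"
    proof (intro eventually_ball_finite ballI)
      fix j assume j: "j \<in> {1..m}"
      have "continuous_on UNIV (\<lambda>t. peval (g j) (t *\<^sub>R z))"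
        by (rule continuous_on_compose2[OF continuous_on_peval[of UNIV]]) (auto intro!: continuous_intros)
      then have "isCont (\<lambda>t. peval (g j) (t *\<^sub>R z)) T" by (simp add: continuous_on_eq_continuous_at)
      then have "((\<lambda>t. peval (g j) (t *\<^sub>R z)) \<longlongrightarrow> peval (g j) (T *\<^sub>R z)) (at_right T)"
        by (auto simp: isCont_def intro: filterlim_mono at_le)
      then show "\<forall>\<^sub>F t in at_right T. peval (g j) (t *\<^sub>R z) < b j"
        using lt[OF j] by (rule order_tendstoD)
    qed simp
    then obtain u where u: "u > T" "\<And>t. T < t \<Longrightarrow> t < u \<Longrightarrow> \<forall>j\<in>{1..m}. peval (g j) (t *\<^sub>R z) < b j"
      unfolding eventually_at_right_field by blast
    have "(T + u) / 2 \<in> S"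
      using u(2)[of "(T + u) / 2"] u(1) T1(1) by (auto simp: S_def Omega_def less_imp_le)
    then show False using T(2)[of "(T + u) / 2"] u(1) by simp
  qed
  then obtain j where j: "j \<in> {1..m}" "peval (g j) (T *\<^sub>R z) = b j" by blast
  then have f: "T *\<^sub>R z \<in> face j" using T1 by (simp add: Omega_face_def)
  then have "dg j > 0" using face_deg_0[OF j(1)] by auto
  moreover have "z = (1 / T) *\<^sub>R (T *\<^sub>R z)" using T1 by simp
  then have "z \<in> cone_over (face j)" unfolding cone_over_def using f T1 by (intro CollectI exI[of _ "1 / T"] exI[of _ "T *\<^sub>R z"]) auto
  ultimately show ?thesis using j(1) by blast
qed

text \<open>If \<open>s *\<^sub>R x = t *\<^sub>R y\<close> with x and y on the two faces, then the
  inequality of each constraint at the point of the other face forces s = t, hence x = y. The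
  overlap thus lies in the cone over the intersection of the faces, which is a null set.\<close>

lemma cone_overlap_null:
  assumes j: "j \<in> {1..m}" "0 < dg j" and k: "k \<in> {1..m}" "0 < dg k" "k \<noteq> j"
  shows "emeasure lborel (cone_over (face j) \<inter> cone_over (face k)) = 0"
proof -
  interpret C: homogeneous_C1 "peval (g j)" "pgrad (g j)" "dg j" "b j" by (rule C1[OF j])
  interpret E: homogeneous_C1 "peval (g k)" "pgrad (g k)" "dg k" "b k" by (rule C1[OF k(1,2)])
  let ?A = "face j \<inter> {x. peval (g k) x = b k}"
  have "{x. peval (g k) x = b k} \<in> sets borel" by measurable
  then have A: "?A \<in> sets borel" by auto
  have AE0: "AE x in H. x \<notin> ?A"
    using face_overlap_null[OF j(1) k(1,3)] A by (intro AE_not_in) (auto simp: null_sets_def)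
  have "C.surf ?A = 0"
    unfolding C.surf_def using AE0
    by (subst nn_integral_0_iff_AE) (use A in \<open>auto elim!: eventually_mono simp: indicator_def\<close>)
  then have z: "emeasure lborel (cone_over ?A) = 0"
    using C.cone_surf[OF face_compact face_level A] by auto
  have "cone_over (face j) \<inter> cone_over (face k) \<subseteq> cone_over ?A"
  proof
    fix z assume "z \<in> cone_over (face j) \<inter> cone_over (face k)"
    then obtain s x t y where s: "0 < s" "s \<le> 1" "x \<in> face j" "z = s *\<^sub>R x"
      and t: "0 < t" "t \<le> 1" "y \<in> face k" "z = t *\<^sub>R y" by (auto simp: cone_over_def)
    have "x = (1 / s) *\<^sub>R z" using s by simp
    then have x': "x = (t / s) *\<^sub>R y" using t(4) by simp
    have "y = (1 / t) *\<^sub>R z" using t by simp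
    then have y': "y = (s / t) *\<^sub>R x" using s(4) by simp
    note xy = x' y'
    have "peval (g k) x \<le> b k" "peval (g j) y \<le> b j" "peval (g j) x = b j" "peval (g k) y = b k"
      using s(3) t(3) j(1) k(1) by (auto simp: Omega_face_def Omega_def)
    moreover have "peval (g k) x = (t / s) ^ dg k * peval (g k) y" "peval (g j) y = (s / t) ^ dg j * peval (g j) x"
      using E.homog[of "t / s" y] C.homog[of "s / t" x] s(1) t(1) by (simp_all only: xy[symmetric]) simp_all
    ultimately have "(t / s) ^ dg k * b k \<le> b k" "(s / t) ^ dg j * b j \<le> b j" by simp_all
    then have "(t / s) ^ dg k \<le> 1" "(s / t) ^ dg j \<le> 1" using b_pos[OF j(1)] b_pos[OF k(1)] by (simp_all add: mult_le_cancel_right1)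
    then have "\<not> 1 < t / s" "\<not> 1 < s / t" using one_less_power[of "t / s" "dg k"] one_less_power[of "s / t" "dg j"] j(2) k(2) by linarith+
    then have "s = t" using s(1) t(1) by (auto simp: field_simps)
    then have "x = y" using xy(1) s(1) by simp
    then have "x \<in> ?A" using s(3) t(3) by (auto simp: Omega_face_def)
    then show "z \<in> cone_over ?A" unfolding cone_over_def using s(1,2,4) by blast
  qed
  moreover have "cone_over ?A \<in> sets borel"
    by (rule C.cone_over_level_borel[OF _ A]) (auto simp: Omega_face_def)
  ultimately show ?thesis using z emeasure_mono[of "cone_over (face j) \<inter> cone_over (face k)" "cone_over ?A" lborel] by simp
qed

text \<open>The divergence theorem for the field \<open>f x *\<^sub>R x\<close>: by Euler's identity
  its divergence is n + k times f, and its normal component on face j is f times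
  \<open>dg j * b j\<close> over the norm of the gradient. It is proved by adding up
  \<open>polar_integration\<close> over the cones; faces of degree 0 contribute nothing, having
  weight 0.\<close>

lemma stokes_nn:
  fixes f :: "real ^ 'n \<Rightarrow> real"
  assumes f [measurable]: "f \<in> borel_measurable borel"
    and f0: "\<And>x. 0 \<le> f x" and fh: "\<And>t x. t > 0 \<Longrightarrow> f (t *\<^sub>R x) = t ^ k * f x"
    and fB: "\<And>x. x \<in> \<Omega> \<Longrightarrow> f x \<le> B"
  shows "ennreal (real (CARD('n) + k)) * (\<integral>\<^sup>+z. ennreal (f z) * indicator \<Omega> z \<partial>lborel)
    = (\<Sum>j=1..m. ennreal (real (dg j) * b j) * (\<integral>\<^sup>+x. ennreal (f x) \<partial>phi j))"
proof -
  define J where "J = {j \<in> {1..m}. 0 < dg j}"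
  have J: "finite J" by (simp add: J_def)
  have cb [measurable]: "cone_over (face j) \<in> sets borel" if "j \<in> J" for j
    using homogeneous_C1.cone_over_level_borel[OF C1 face_level face_borel] that by (auto simp: J_def)
  have "AE z in lborel. z \<noteq> (0 :: real ^ 'n)" by (rule AE_lborel_singleton)
  moreover have "AE z in lborel. \<forall>j\<in>J. \<forall>k\<in>J. k \<noteq> j \<longrightarrow> z \<notin> cone_over (face j) \<inter> cone_over (face k)"
  proof (intro AE_finite_allI J)
    fix j k assume jk: "j \<in> J" "k \<in> J"
    show "AE z in lborel. k \<noteq> j \<longrightarrow> z \<notin> cone_over (face j) \<inter> cone_over (face k)"
    proof (cases "k = j")
      case False
      then have "cone_over (face j) \<inter> cone_over (face k) \<in> null_sets lborel"
        using cone_overlap_null jk cb by (auto simp: J_def null_sets_def)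
      from AE_not_in[OF this] show ?thesis by (rule eventually_mono) simp
    qed simp
  qed
  ultimately have "AE z in lborel. ennreal (f z) * indicator \<Omega> z = (\<Sum>j\<in>J. ennreal (f z) * indicator (cone_over (face j)) z)"
  proof eventually_elim
    case (elim z)
    show ?case
    proof (cases "z \<in> \<Omega>")
      case True
      then obtain j where j: "j \<in> J" "z \<in> cone_over (face j)"
        using Omega_cover[OF True elim(1)] unfolding J_def by blast
      have "(\<Sum>i\<in>J. ennreal (f z) * indicator (cone_over (face i)) z) = (\<Sum>i\<in>J. if i = j then ennreal (f z) else 0)"
        using elim(2) j by (intro sum.cong) (auto simp: indicator_def)
      then show ?thesis using J j True by simp
    next
      case False
      then have "z \<notin> cone_over (face i)" for i using cone_face_subset by blast
      then show ?thesis using False by simp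
    qed
  qed
  then have "(\<integral>\<^sup>+z. ennreal (f z) * indicator \<Omega> z \<partial>lborel) = (\<integral>\<^sup>+z. (\<Sum>j\<in>J. ennreal (f z) * indicator (cone_over (face j)) z) \<partial>lborel)"
    by (rule nn_integral_cong_AE)
  also have "\<dots> = (\<Sum>j\<in>J. \<integral>\<^sup>+z. ennreal (f z) * indicator (cone_over (face j)) z \<partial>lborel)"
    by (rule nn_integral_sum) (use cb in auto)
  finally have "ennreal (real (CARD('n) + k)) * (\<integral>\<^sup>+z. ennreal (f z) * indicator \<Omega> z \<partial>lborel)
    = (\<Sum>j\<in>J. ennreal (real (CARD('n) + k)) * (\<integral>\<^sup>+z. ennreal (f z) * indicator (cone_over (face j)) z \<partial>lborel))"
    by (simp add: sum_distrib_left)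
  also have "\<dots> = (\<Sum>j\<in>J. ennreal (real (dg j) * b j) * (\<integral>\<^sup>+x. ennreal (f x) \<partial>phi j))"
  proof (rule sum.cong[OF refl])
    fix j assume "j \<in> J"
    then have j: "j \<in> {1..m}" "0 < dg j" by (auto simp: J_def)
    show "ennreal (real (CARD('n) + k)) * (\<integral>\<^sup>+z. ennreal (f z) * indicator (cone_over (face j)) z \<partial>lborel)
      = ennreal (real (dg j) * b j) * (\<integral>\<^sup>+x. ennreal (f x) \<partial>phi j)"
      unfolding nn_integral_phi[OF measurable_compose[OF f measurable_ennreal] j(1)]
      by (rule homogeneous_C1.polar_integration(1)[OF C1[OF j] face_compact face_level f f0 fh fB])
        (use face_subset in auto)
  qed
  also have "\<dots> = (\<Sum>j=1..m. ennreal (real (dg j) * b j) * (\<integral>\<^sup>+x. ennreal (f x) \<partial>phi j))"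
    by (rule sum.mono_neutral_left) (auto simp: J_def)
  finally show ?thesis .
qed

definition omega_measure :: "(real ^ 'n) measure" where
  "omega_measure = density lborel (\<lambda>x. ennreal (indicator \<Omega> x))"

lemma sets_omega_measure [simp, measurable_cong]: "sets omega_measure = sets borel"
  by (simp add: omega_measure_def)

text \<open>The identity for nonnegative functions is applied to the positive part (s = 1) and the
  negative part (s = -1) of the monomial, which are homogeneous of the same degree under positive
  scaling.\<close>

lemma stokes:
  "real (CARD('n) + total_deg \<alpha>) * (\<integral>x. monom_eval \<alpha> x \<partial>omega_measure)
     = (\<Sum>j=1..m. real (dg j) * b j * (\<integral>x. monom_eval \<alpha> x \<partial>phi j))"
  and integrable_omega_monom: "integrable omega_measure (monom_eval \<alpha>)"
proof -
  have "emeasure omega_measure UNIV = emeasure lborel \<Omega>"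
    unfolding omega_measure_def by (subst emeasure_density) (auto simp: ennreal_indicator)
  also have "\<dots> < \<infinity>" using emeasure_bounded_finite[OF compact_imp_bounded[OF Omega_compact]] by simp
  finally have fin: "finite_measure omega_measure"
    by (intro finite_measureI) (simp add: omega_measure_def)
  interpret finite_measure omega_measure by (rule fin)
  have mb: "\<bar>monom_eval \<alpha> x\<bar> \<le> 1" if "x \<in> \<Omega>" for x \<alpha>
    using monom_eval_le_1 Omega_abs_le_1[OF that] by blast
  have AE: "AE x in omega_measure. x \<in> \<Omega>"
    unfolding omega_measure_def by (subst AE_density) (auto simp: indicator_def)
  show int: "integrable omega_measure (monom_eval \<alpha>)" for \<alpha>
    by (intro integrable_const_bound[where B=1]) (use AE mb in \<open>auto elim: eventually_mono\<close>)
  have nn: "real (CARD('n) + total_deg \<alpha>) * enn2real (\<integral>\<^sup>+x. ennreal (f x) \<partial>omega_measure)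
     = (\<Sum>j=1..m. real (dg j) * b j * enn2real (\<integral>\<^sup>+x. ennreal (f x) \<partial>phi j))"
    if f: "f = (\<lambda>x. max 0 (s * monom_eval \<alpha> x))" and s: "\<bar>s\<bar> = 1" for f s
  proof -
    have fm [measurable]: "f \<in> borel_measurable borel" unfolding f by measurable
    have fc: "continuous_on UNIV f" unfolding f by (intro continuous_intros)
    have fh: "f (t *\<^sub>R x) = t ^ total_deg \<alpha> * f x" if "t > 0" for t x
    proof -
      have "max 0 (c * a) = c * max 0 a" if "c > 0" for a c :: real
        using that by (cases "a \<ge> 0") (auto simp: max_def zero_le_mult_iff)
      from this[of "t ^ total_deg \<alpha>" "s * monom_eval \<alpha> x"] show ?thesis
        using that unfolding f monom_eval_scale by (simp add: mult.left_commute[of s])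
    qed
    have fB: "f x \<le> 1" if "x \<in> \<Omega>" for x
    proof -
      have "s * monom_eval \<alpha> x \<le> \<bar>s\<bar> * \<bar>monom_eval \<alpha> x\<bar>" by (metis abs_ge_self abs_mult)
      then show ?thesis using mb[OF that, of \<alpha>] s by (simp add: f)
    qed
    have e: "(\<integral>\<^sup>+x. ennreal (f x) \<partial>omega_measure) = (\<integral>\<^sup>+z. ennreal (f z) * indicator \<Omega> z \<partial>lborel)"
      unfolding omega_measure_def by (subst nn_integral_density) (auto intro!: nn_integral_cong simp: indicator_def)
    have main: "ennreal (real (CARD('n) + total_deg \<alpha>)) * (\<integral>\<^sup>+x. ennreal (f x) \<partial>omega_measure)
       = (\<Sum>j=1..m. ennreal (real (dg j) * b j) * (\<integral>\<^sup>+x. ennreal (f x) \<partial>phi j))"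
      unfolding e by (rule stokes_nn[OF fm _ fh fB]) (auto simp: f)
    have pf: "(\<integral>\<^sup>+x. ennreal (f x) \<partial>phi j) < top" if j: "j \<in> {1..m}" for j
      using integrable_phi[OF j fc] by (simp add: integrable_iff_bounded f)
    have "real (CARD('n) + total_deg \<alpha>) * enn2real (\<integral>\<^sup>+x. ennreal (f x) \<partial>omega_measure)
      = enn2real (ennreal (real (CARD('n) + total_deg \<alpha>)) * (\<integral>\<^sup>+x. ennreal (f x) \<partial>omega_measure))"
      by (simp add: enn2real_mult del: of_nat_add)
    also have "\<dots> = (\<Sum>j=1..m. enn2real (ennreal (real (dg j) * b j) * (\<integral>\<^sup>+x. ennreal (f x) \<partial>phi j)))"
      unfolding main using pf by (subst enn2real_sum) (auto simp: ennreal_mult_less_top)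
    also have "\<dots> = (\<Sum>j=1..m. real (dg j) * b j * enn2real (\<integral>\<^sup>+x. ennreal (f x) \<partial>phi j))"
      using b_pos by (intro sum.cong) (auto simp: enn2real_mult less_imp_le)
    finally show ?thesis .
  qed
  have split: "(\<integral>x. monom_eval \<alpha> x \<partial>M) = enn2real (\<integral>\<^sup>+x. ennreal (max 0 (1 * monom_eval \<alpha> x)) \<partial>M) - enn2real (\<integral>\<^sup>+x. ennreal (max 0 ((-1) * monom_eval \<alpha> x)) \<partial>M)"
    if "integrable M (monom_eval \<alpha>)" for M
    unfolding real_lebesgue_integral_def[OF that] by (simp add: ennreal_max_0)
  show "real (CARD('n) + total_deg \<alpha>) * (\<integral>x. monom_eval \<alpha> x \<partial>omega_measure)
     = (\<Sum>j=1..m. real (dg j) * b j * (\<integral>x. monom_eval \<alpha> x \<partial>phi j))"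
  proof -
    have "(\<Sum>j=1..m. real (dg j) * b j * (\<integral>x. monom_eval \<alpha> x \<partial>phi j))
       = (\<Sum>j=1..m. real (dg j) * b j * enn2real (\<integral>\<^sup>+x. ennreal (max 0 (1 * monom_eval \<alpha> x)) \<partial>phi j)
            - real (dg j) * b j * enn2real (\<integral>\<^sup>+x. ennreal (max 0 ((-1) * monom_eval \<alpha> x)) \<partial>phi j))"
      using integrable_phi[OF _ continuous_on_monom_eval] by (intro sum.cong refl, subst split) (auto simp: right_diff_distrib)
    also have "\<dots> = real (CARD('n) + total_deg \<alpha>) * enn2real (\<integral>\<^sup>+x. ennreal (max 0 (1 * monom_eval \<alpha> x)) \<partial>omega_measure)
        - real (CARD('n) + total_deg \<alpha>) * enn2real (\<integral>\<^sup>+x. ennreal (max 0 ((-1) * monom_eval \<alpha> x)) \<partial>omega_measure)"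
      unfolding sum_subtractf using nn[OF refl, of 1] nn[OF refl, of "-1"] by simp
    also have "\<dots> = real (CARD('n) + total_deg \<alpha>) * (\<integral>x. monom_eval \<alpha> x \<partial>omega_measure)"
      by (subst split[OF int]) (simp add: right_diff_distrib)
    finally show ?thesis ..
  qed
qed

end

section \<open>Functionals dominated by a measure\<close>

text \<open>The function a is approximated rather than its square, so that the approximant of the
  square is itself a square.\<close>

lemma square_approx:
  fixes a :: "real ^ 'n \<Rightarrow> real"
  assumes K: "compact K" and a: "continuous_on K a" and \<delta>: "\<delta> > 0"
  shows "\<exists>t. \<forall>x\<in>K. \<bar>peval (t * t) x - (a x)\<^sup>2\<bar> \<le> \<delta>"
proof -
  obtain F where F: "\<And>x. x \<in> K \<Longrightarrow> norm (a x) \<le> F" "F \<ge> 0"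
  proof -
    have "bounded (a ` K)" using K a by (intro compact_imp_bounded compact_continuous_image)
    then obtain F where "\<And>x. x \<in> K \<Longrightarrow> norm (a x) \<le> F" unfolding bounded_iff by blast
    then show thesis using that[of "max F 0"] by (simp add: le_max_iff_disj)
  qed
  \<comment> \<open>As e is at most 1, the sum of a and its approximant is at most 2 F + 1 in
    absolute value, which is the factor in the difference of the squares.\<close>
  define e where "e = min 1 (\<delta> / (2 * F + 1))"
  have e: "e > 0" "e \<le> 1" "e * (2 * F + 1) \<le> \<delta>"
  proof -
    show "e > 0" "e \<le> 1" using F(2) \<delta> by (auto simp: e_def)
    have "e \<le> \<delta> / (2 * F + 1)" by (simp add: e_def)
    then show "e * (2 * F + 1) \<le> \<delta>" using F(2) by (simp add: field_simps)
  qed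
  obtain t where t: "\<And>x. x \<in> K \<Longrightarrow> \<bar>a x - peval t x\<bar> < e"
    using peval_approx[OF K a e(1)] by blast
  have "\<bar>peval (t * t) x - (a x)\<^sup>2\<bar> \<le> \<delta>" if x: "x \<in> K" for x
  proof -
    have "\<bar>peval (t * t) x - (a x)\<^sup>2\<bar> = \<bar>a x - peval t x\<bar> * \<bar>a x + peval t x\<bar>"
      unfolding abs_mult[symmetric] peval_mult
      by (simp add: power2_eq_square algebra_simps abs_minus_commute)
    also have "\<dots> \<le> e * (2 * F + 1)"
      using t[OF x] F(1)[OF x] e(2) by (intro mult_mono) auto
    finally show ?thesis using e(3) by linarith
  qed
  then show ?thesis by blast
qed

text \<open>An error so small that k times it, multiplied by a mass c, stays below e. The mass may
  be 0, hence c + 1 in the denominator.\<close>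

lemma epsilon_share:
  fixes c e k :: real
  assumes "c \<ge> 0" "e > 0" "k > 0"
  shows "0 < e / (k * (c + 1))" "k * (e / (k * (c + 1))) * c \<le> e"
proof -
  show "0 < e / (k * (c + 1))" using assms by (intro divide_pos_pos mult_pos_pos) auto
  have "k * (e / (k * (c + 1))) * c = e * (c / (c + 1))" using assms(3) by simp
  also have "\<dots> \<le> e * 1" using assms by (intro mult_left_mono) (auto simp: divide_le_eq)
  finally show "k * (e / (k * (c + 1))) * c \<le> e" by simp
qed

text \<open>Positivity and domination are assumed on squares only, since this is what the moment
  matrices provide.\<close>

locale dominated_functional =
  fixes K :: "(real ^ 'n) set" and M :: "(real ^ 'n) measure" and y :: "'n multiindex \<Rightarrow> real"
  assumes K: "compact K" and sets_M [simp, measurable_cong]: "sets M = sets borel"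
    and fin: "finite_measure M" and AE_K: "AE x in M. x \<in> K"
    and sq_nonneg: "\<And>q. 0 \<le> riesz y (q * q)"
    and sq_le: "\<And>q. riesz y (q * q) \<le> (\<integral>x. peval (q * q) x \<partial>M)"
begin

sublocale finite_measure M by (rule fin)

lemma integrable_bounded_on:
  assumes "f \<in> borel_measurable borel" "\<And>x. x \<in> K \<Longrightarrow> \<bar>f x\<bar> \<le> B"
  shows "integrable M f" "(\<integral>x. f x \<partial>M) \<le> B * measure M UNIV" "- (B * measure M UNIV) \<le> (\<integral>x. f x \<partial>M)"
proof -
  have AE: "AE x in M. \<bar>f x\<bar> \<le> B" using AE_K by eventually_elim (use assms(2) in auto)
  have sp: "space M = UNIV" using sets_eq_imp_space_eq[OF sets_M] by simp
  show i: "integrable M f"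
    using AE assms(1) by (intro integrable_const_bound[where B=B]) (auto simp: measurable_def)
  have "(\<integral>x. f x \<partial>M) \<le> (\<integral>x. B \<partial>M)"
    using AE by (intro integral_mono_AE i) (auto elim: eventually_mono)
  then show "(\<integral>x. f x \<partial>M) \<le> B * measure M UNIV" by (simp add: sp mult.commute)
  have "(\<integral>x. - B \<partial>M) \<le> (\<integral>x. f x \<partial>M)"
    using AE by (intro integral_mono_AE i) (auto elim: eventually_mono)
  then show "- (B * measure M UNIV) \<le> (\<integral>x. f x \<partial>M)" by (simp add: sp mult.commute)
qed

lemma integrable_cont:
  assumes "continuous_on UNIV f" shows "integrable M (f :: _ \<Rightarrow> real)"
proof -
  have "bounded (f ` K)"
    using assms by (intro compact_imp_bounded compact_continuous_image K) (auto intro: continuous_on_subset)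
  then obtain B where "\<And>x. x \<in> K \<Longrightarrow> \<bar>f x\<bar> \<le> B" unfolding bounded_iff by auto
  then show ?thesis using assms by (intro integrable_bounded_on) (auto intro: borel_measurable_continuous_onI)
qed

lemma integrable_pe: "integrable M (peval p)"
  by (intro integrable_cont continuous_on_peval)

lemma riesz_1_le: "riesz y 1 \<le> measure M UNIV"
proof -
  have "space M = UNIV" using sets_eq_imp_space_eq[OF sets_M] by simp
  then show ?thesis using sq_le[of 1] by simp
qed

text \<open>Positivity on the squares of \<open>\<delta> + r\<close> and \<open>\<delta> - r\<close>
  bounds \<open>2 * \<delta> * |riesz y r|\<close> by
  \<open>\<delta>^2 * riesz y 1 + riesz y (r * r)\<close>, and domination bounds each of the two
  terms by \<open>\<delta>^2\<close> times the mass.\<close>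

lemma riesz_small:
  assumes \<delta>: "\<delta> > 0" and r: "\<And>x. x \<in> K \<Longrightarrow> \<bar>peval r x\<bar> \<le> \<delta>"
  shows "\<bar>riesz y r\<bar> \<le> \<delta> * measure M UNIV"
proof -
  have rr: "riesz y (r * r) \<le> \<delta> * \<delta> * measure M UNIV"
  proof -
    have "\<bar>peval (r * r) x\<bar> \<le> \<delta> * \<delta>" if "x \<in> K" for x
      unfolding peval_mult abs_mult using r[OF that] \<delta> by (intro mult_mono) auto
    then have "(\<integral>x. peval (r * r) x \<partial>M) \<le> \<delta> * \<delta> * measure M UNIV"
      by (intro integrable_bounded_on) auto
    then show ?thesis using sq_le[of r] by linarith
  qed
  have expand: "0 \<le> \<delta> * \<delta> * riesz y 1 + 2 * s * \<delta> * riesz y r + s * s * riesz y (r * r)" for s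
  proof -
    have "0 \<le> riesz y ((pconst \<delta> + pconst s * r) * (pconst \<delta> + pconst s * r))" by (rule sq_nonneg)
    also have "(pconst \<delta> + pconst s * r) * (pconst \<delta> + pconst s * r)
        = pconst (\<delta> * \<delta>) * 1 + pconst (s * \<delta>) * r + pconst (s * \<delta>) * r + pconst (s * s) * (r * r)"
    proof -
      have "pconst (\<delta> * \<delta>) = pconst \<delta> * (pconst \<delta> :: 'n rpoly)" "pconst (s * \<delta>) = pconst s * (pconst \<delta> :: 'n rpoly)"
        "pconst (s * s) = pconst s * (pconst s :: 'n rpoly)"
        by (simp_all add: mult_single)
      then show ?thesis by (simp only: distrib_left distrib_right mult_1_right) (simp only: mult_ac add_ac)
    qed
    finally show ?thesis unfolding riesz_add riesz_scale_left by (simp add: algebra_simps)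
  qed
  have 1: "\<delta> * \<delta> * riesz y 1 \<le> \<delta> * \<delta> * measure M UNIV" using riesz_1_le \<delta> by (intro mult_left_mono) auto
  have "2 * \<delta> * \<bar>riesz y r\<bar> \<le> 2 * \<delta> * (\<delta> * measure M UNIV)"
    using expand[of 1] expand[of "-1"] 1 rr by (cases "riesz y r \<ge> 0") (auto simp: algebra_simps)
  then show ?thesis using \<delta> by simp
qed

text \<open>With t close to the square root of q, the difference \<open>q - t * t\<close> is
  uniformly small on K. Both the functional and the integral are then small on it, and the
  assumptions about squares apply to t.\<close>

lemma riesz_bounds:
  assumes q: "\<And>x. x \<in> K \<Longrightarrow> 0 \<le> peval q x"
  shows "0 \<le> riesz y q" "riesz y q \<le> (\<integral>x. peval q x \<partial>M)"
proof -
  let ?C = "measure M UNIV"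
  have main: "- (2 * \<epsilon> * ?C) \<le> riesz y q \<and> riesz y q \<le> (\<integral>x. peval q x \<partial>M) + 4 * \<epsilon> * ?C" if \<epsilon>: "\<epsilon> > 0" for \<epsilon>
  proof -
    have "continuous_on K (\<lambda>x. sqrt (max 0 (peval q x)))" by (intro continuous_intros)
    from square_approx[OF K this, of "2 * \<epsilon>"] \<epsilon> obtain t where
      t: "\<And>x. x \<in> K \<Longrightarrow> \<bar>peval (t * t) x - (sqrt (max 0 (peval q x)))\<^sup>2\<bar> \<le> 2 * \<epsilon>" by auto
    have t': "\<bar>peval (q - t * t) x\<bar> \<le> 2 * \<epsilon>" if "x \<in> K" for x
      using t[OF that] q[OF that] by (simp add: peval_diff abs_minus_commute)
    have "\<bar>riesz y (q - t * t)\<bar> \<le> 2 * \<epsilon> * ?C" by (rule riesz_small) (use \<epsilon> t' in auto)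
    moreover have "- (2 * \<epsilon> * ?C) \<le> (\<integral>x. peval (q - t * t) x \<partial>M)"
      by (rule integrable_bounded_on) (use t' in auto)
    moreover have "(\<integral>x. peval (q - t * t) x \<partial>M) = (\<integral>x. peval q x \<partial>M) - (\<integral>x. peval (t * t) x \<partial>M)"
      unfolding peval_diff by (intro Bochner_Integration.integral_diff integrable_pe)
    ultimately show ?thesis using sq_nonneg[of t] sq_le[of t] by (auto simp: riesz_diff)
  qed
  have C: "?C \<ge> 0" by simp
  show "0 \<le> riesz y q"
  proof (rule field_le_epsilon)
    fix e :: real assume e: "e > 0"
    have "- (2 * (e / (2 * (?C + 1))) * ?C) \<le> riesz y q"
      using main[OF epsilon_share(1)[OF C e, of 2]] by simp
    moreover have "2 * (e / (2 * (?C + 1))) * ?C \<le> e" by (rule epsilon_share(2)[OF C e]) simp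
    ultimately show "0 \<le> riesz y q + e" by linarith
  qed
  show "riesz y q \<le> (\<integral>x. peval q x \<partial>M)"
  proof (rule field_le_epsilon)
    fix e :: real assume e: "e > 0"
    have "riesz y q \<le> (\<integral>x. peval q x \<partial>M) + 4 * (e / (4 * (?C + 1))) * ?C"
      using main[OF epsilon_share(1)[OF C e, of 4]] by simp
    moreover have "4 * (e / (4 * (?C + 1))) * ?C \<le> e" by (rule epsilon_share(2)[OF C e]) simp
    ultimately show "riesz y q \<le> (\<integral>x. peval q x \<partial>M) + e" by linarith
  qed
qed

lemma riesz_mono:
  assumes "\<And>x. x \<in> K \<Longrightarrow> peval p x \<le> peval q x"
  shows "riesz y p \<le> riesz y q"
  using riesz_bounds(1)[of "q - p"] assms by (simp add: peval_diff riesz_diff)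

text \<open>
  The hypothesis on u says that the functional vanishes on u. Since
  \<open>q \<le> q * max 0 (1 - N * u) + q * N * u\<close>, the bound follows by letting N tend to infinity.
\<close>

lemma riesz_le_on_zero_set:
  fixes u :: "real ^ 'n \<Rightarrow> real"
  assumes u: "continuous_on UNIV u" "\<And>x. 0 \<le> u x"
    and s: "\<And>\<delta>. \<delta> > 0 \<Longrightarrow> \<exists>s. (\<forall>x\<in>K. u x \<le> peval s x) \<and> riesz y s \<le> \<delta>"
    and q: "\<And>x. x \<in> K \<Longrightarrow> 0 \<le> peval q x"
  shows "riesz y q \<le> (\<integral>x. peval q x * indicator {x. u x = 0} x \<partial>M)"
proof -
  define f where "f N x = max 0 (1 - real N * u x)" for N x
  have fc: "continuous_on UNIV (f N)" for N unfolding f_def by (intro continuous_intros u)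
  have f01: "0 \<le> f N x" "f N x \<le> 1" for N x using u(2)[of x] by (auto simp: f_def)
  let ?C = "measure M UNIV"
  have step: "riesz y q \<le> (\<integral>x. peval q x * f N x \<partial>M)" for N
  proof (rule field_le_epsilon)
    fix e :: real assume e: "e > 0"
    have "bounded (peval q ` K)"
      by (intro compact_imp_bounded compact_continuous_image K continuous_on_peval)
    then obtain Q where Q: "\<And>x. x \<in> K \<Longrightarrow> \<bar>peval q x\<bar> \<le> Q" unfolding bounded_iff by auto
    \<comment> \<open>A bound for \<open>q * N\<close> on K; the summand 1 keeps it positive so that
      it can be divided by.\<close>
    define R where "R = max Q 0 * real N + 1"
    have R: "R > 0" by (simp add: R_def add_nonneg_pos)
    define \<delta> where "\<delta> = (e / 2) / (2 * (?C + 1))"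
    have C: "?C \<ge> 0" by simp
    have \<delta>: "\<delta> > 0" "2 * \<delta> * ?C \<le> e / 2" unfolding \<delta>_def using e by (intro epsilon_share[OF C]; simp)+
    \<comment> \<open>The shift by \<delta> puts the approximating polynomial r above
      \<open>q * f N\<close> on K, by less than \<open>2 * \<delta>\<close>. In particular r is
      nonnegative there and \<open>riesz_bounds\<close> applies to it.\<close>
    have "continuous_on K (\<lambda>x. peval q x * f N x + \<delta>)"
      by (intro continuous_intros continuous_on_subset[OF fc]) auto
    from peval_approx[OF K this \<delta>(1)] obtain r where
      r: "\<And>x. x \<in> K \<Longrightarrow> \<bar>peval q x * f N x + \<delta> - peval r x\<bar> < \<delta>" by blast
    have "e / (2 * R) > 0" using e R by simp
    from s[OF this] obtain s where s: "\<And>x. x \<in> K \<Longrightarrow> u x \<le> peval s x" "riesz y s \<le> e / (2 * R)" by blast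
    have "riesz y q \<le> riesz y (r + pconst R * s)"
    proof (rule riesz_mono)
      fix x assume x: "x \<in> K"
      have "peval q x * (1 - f N x) \<le> peval q x * (real N * u x)"
        using q[OF x] by (intro mult_left_mono) (auto simp: f_def)
      also have "\<dots> \<le> max Q 0 * (real N * u x)"
        using Q[OF x] u(2)[of x] by (intro mult_right_mono) auto
      also have "\<dots> \<le> R * u x" using u(2)[of x] by (simp add: R_def algebra_simps)
      also have "\<dots> \<le> R * peval s x" using s(1)[OF x] R by (intro mult_left_mono) auto
      finally have "peval q x \<le> peval q x * f N x + R * peval s x" by (simp add: algebra_simps)
      then show "peval q x \<le> peval (r + pconst R * s) x"
        using r[OF x] by (simp add: peval_add peval_mult)
    qed
    also have "\<dots> = riesz y r + R * riesz y s" by (simp add: riesz_add riesz_scale_left)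
    also have "R * riesz y s \<le> e / 2" using s(2) R by (simp add: field_simps)
    also have "riesz y r \<le> (\<integral>x. peval r x \<partial>M)"
    proof (rule riesz_bounds(2))
      fix x assume x: "x \<in> K"
      have "0 \<le> peval q x * f N x" using q[OF x] f01 by simp
      then show "0 \<le> peval r x" using r[OF x] by linarith
    qed
    also have "(\<integral>x. peval r x \<partial>M) \<le> (\<integral>x. peval q x * f N x + 2 * \<delta> \<partial>M)"
    proof (rule integral_mono_AE)
      show "integrable M (\<lambda>x. peval q x * f N x + 2 * \<delta>)"
        by (intro integrable_cont continuous_intros fc)
      show "AE x in M. peval r x \<le> peval q x * f N x + 2 * \<delta>"
        using AE_K by eventually_elim (use r in \<open>force simp: abs_less_iff\<close>)
    qed (rule integrable_pe)
    also have "\<dots> = (\<integral>x. peval q x * f N x \<partial>M) + 2 * \<delta> * ?C"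
    proof -
      have sp: "space M = UNIV" using sets_eq_imp_space_eq[OF sets_M] by simp
      have i: "integrable M (\<lambda>x. peval q x * f N x)"
        by (intro integrable_cont continuous_intros fc)
      show ?thesis by (subst Bochner_Integration.integral_add[OF i]) (simp_all add: sp)
    qed
    finally show "riesz y q \<le> (\<integral>x. peval q x * f N x \<partial>M) + e" using \<delta>(2) by simp
  qed
  have "(\<lambda>N. \<integral>x. peval q x * f N x \<partial>M) \<longlonglongrightarrow> (\<integral>x. peval q x * indicator {x. u x = 0} x \<partial>M)"
  proof (rule integral_dominated_convergence[where w="\<lambda>x. \<bar>peval q x\<bar>"])
    have "closed {x. u x = 0}" by (intro closed_Collect_eq u continuous_intros)
    then have [measurable]: "{x. u x = 0} \<in> sets borel" by simp
    show "(\<lambda>x. peval q x * indicator {x. u x = 0} x) \<in> borel_measurable M" by measurable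
    show "(\<lambda>x. peval q x * f N x) \<in> borel_measurable M" for N
      using borel_measurable_continuous_onI[OF fc[of N]] by measurable
    show "integrable M (\<lambda>x. \<bar>peval q x\<bar>)" by (intro integrable_cont continuous_intros)
    show "AE x in M. norm (peval q x * f N x) \<le> \<bar>peval q x\<bar>" for N
      using f01 by (auto simp: abs_mult mult_le_cancel_left2 intro!: mult_left_le)
    show "AE x in M. (\<lambda>N. peval q x * f N x) \<longlonglongrightarrow> peval q x * indicator {x. u x = 0} x"
    proof (rule AE_I2)
      fix x
      show "(\<lambda>N. peval q x * f N x) \<longlonglongrightarrow> peval q x * indicator {x. u x = 0} x"
      proof (cases "u x = 0")
        case True then show ?thesis by (simp add: f_def)
      next
        case False
        then have pos: "u x > 0" using u(2)[of x] by simp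
        obtain N0 where N0: "1 < real N0 * u x" using reals_Archimedean3[OF pos] by blast
        have "f N x = 0" if "N \<ge> N0" for N
        proof -
          have "real N0 * u x \<le> real N * u x" using that pos by (intro mult_right_mono) auto
          then show ?thesis using N0 by (simp add: f_def)
        qed
        then have "eventually (\<lambda>N. peval q x * f N x = 0) sequentially"
          unfolding eventually_sequentially by auto
        then show ?thesis using False by (simp add: tendsto_eventually)
      qed
    qed
  qed
  then show ?thesis by (rule LIMSEQ_le_const) (use step in blast)
qed

end

section \<open>Lebesgue measure on the box\<close>

definition unit_cube :: "(real ^ 'n) set" where
  "unit_cube = {x. \<forall>i. \<bar>x $ i\<bar> \<le> 1}"

lemma compact_unit_cube: "compact (unit_cube :: (real ^ 'n) set)"
proof -
  have "(unit_cube :: (real ^ 'n) set) = cbox (\<chi> i. -1) (\<chi> i. 1)"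
    by (auto simp: unit_cube_def mem_box_cart abs_le_iff minus_le_iff)
  then show ?thesis by (metis compact_cbox)
qed

lemma open_box_subset: "open_box \<subseteq> unit_cube"
  by (auto simp: open_box_def unit_cube_def abs_le_iff less_imp_le minus_le_iff)

lemma open_box_borel [measurable]: "(open_box :: (real ^ 'n) set) \<in> sets borel"
proof -
  have "(open_box :: (real ^ 'n) set) = box (\<chi> i. -1) (\<chi> i. 1)"
    by (auto simp: open_box_def mem_box_cart)
  then show ?thesis by (metis borel_open open_box)
qed

definition box_measure :: "(real ^ 'n) measure" where
  "box_measure = density lborel (\<lambda>x. ennreal (indicator open_box x))"

lemma sets_box_measure [simp, measurable_cong]: "sets box_measure = sets borel"
  by (simp add: box_measure_def)

lemma finite_box_measure: "finite_measure (box_measure :: (real ^ 'n) measure)"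
proof (rule finite_measureI)
  have "emeasure (box_measure :: (real ^ 'n) measure) UNIV = emeasure lborel (open_box :: (real ^ 'n) set)"
    unfolding box_measure_def by (subst emeasure_density) (auto simp: ennreal_indicator)
  also have "\<dots> < \<infinity>"
    using emeasure_bounded_finite[OF bounded_subset[OF compact_imp_bounded[OF compact_unit_cube] open_box_subset]] .
  finally show "emeasure (box_measure :: (real ^ 'n) measure) (space box_measure) \<noteq> \<infinity>" by (simp add: box_measure_def)
qed

lemma AE_box_measure: "AE x in box_measure. x \<in> unit_cube"
  unfolding box_measure_def using open_box_subset by (subst AE_density) (auto simp: indicator_def)

text \<open>Passes from the completed measure of the statement to a Borel measure, the form in which
  dominated functionals are set up.\<close>

lemma set_integral_lebesgue_density:
  fixes f :: "real ^ 'n \<Rightarrow> real"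
  assumes [measurable]: "f \<in> borel_measurable borel" "S \<in> sets borel"
  shows "(LINT x:S|lebesgue. f x) = (\<integral>x. f x \<partial>density lborel (\<lambda>x. ennreal (indicator S x)))"
proof -
  have "(LINT x:S|lebesgue. f x) = (\<integral>x. indicator S x *\<^sub>R f x \<partial>lborel)"
    unfolding set_lebesgue_integral_def by (rule integral_completion) measurable
  also have "\<dots> = (\<integral>x. f x \<partial>density lborel (\<lambda>x. ennreal (indicator S x)))"
    by (rule integral_density[symmetric]) auto
  finally show ?thesis .
qed

lemma box_moments_eq: "box_moments \<alpha> = (\<integral>x. monom_eval \<alpha> x \<partial>box_measure)"
  unfolding box_moments_def box_measure_def by (rule set_integral_lebesgue_density) measurable

lemma monom_unit_cube: "x \<in> unit_cube \<Longrightarrow> \<bar>monom_eval \<alpha> x\<bar> \<le> 1"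
  by (rule monom_eval_le_1) (auto simp: unit_cube_def)

lemma monom_unit_cube_pm:
  "x \<in> unit_cube \<Longrightarrow> 0 \<le> 1 + monom_eval \<alpha> x" "x \<in> unit_cube \<Longrightarrow> 0 \<le> 1 - monom_eval \<alpha> x"
  using monom_unit_cube[of x \<alpha>] by linarith+

lemma integrable_box_monom: "integrable box_measure (monom_eval \<alpha>)"
proof -
  interpret finite_measure "box_measure :: (real ^ 'n) measure" by (rule finite_box_measure)
  show ?thesis
    using AE_box_measure by (intro integrable_const_bound[where B=1]) (auto elim!: eventually_mono intro: monom_unit_cube simp: measurable_def)
qed

lemma riesz_box_moments: "riesz box_moments p = (\<integral>x. peval p x \<partial>box_measure)"
  by (simp add: integrable_peval(2)[OF integrable_box_monom] box_moments_eq[abs_def])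

context homogeneous_semialgebraic
begin

lemma Omega_subset_cube: "\<Omega> \<subseteq> unit_cube"
  using Omega_box open_box_subset by blast

lemma omega_le_box:
  fixes f :: "real ^ 'n \<Rightarrow> real"
  assumes f: "f \<in> borel_measurable borel"
  shows "(\<integral>x. f x * indicator \<Omega> x \<partial>box_measure) = (\<integral>x. f x \<partial>omega_measure)"
proof -
  note [measurable] = f
  have "(\<integral>x. f x * indicator \<Omega> x \<partial>box_measure) = (\<integral>x. indicator open_box x *\<^sub>R (f x * indicator \<Omega> x) \<partial>lborel)"
    unfolding box_measure_def by (rule integral_density) auto
  also have "\<dots> = (\<integral>x. indicator \<Omega> x *\<^sub>R f x \<partial>lborel)"
    using Omega_box by (intro Bochner_Integration.integral_cong) (auto simp: indicator_def)
  also have "\<dots> = (\<integral>x. f x \<partial>omega_measure)"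
    unfolding omega_measure_def by (rule integral_density[symmetric]) auto
  finally show ?thesis .
qed

lemma omega_moment: "(LINT x:\<Omega>|lebesgue. monom_eval \<alpha> x) = (\<integral>x. monom_eval \<alpha> x \<partial>omega_measure)"
  unfolding omega_measure_def by (rule set_integral_lebesgue_density) measurable

lemma riesz_omega: "riesz (\<lambda>\<alpha>. \<integral>x. monom_eval \<alpha> x \<partial>omega_measure) p = (\<integral>x. peval p x \<partial>omega_measure)"
  by (rule integrable_peval(2)[symmetric]) (rule integrable_omega_monom)

lemma riesz_phi: "j \<in> {1..m} \<Longrightarrow> riesz (\<lambda>\<alpha>. \<integral>x. monom_eval \<alpha> x \<partial>phi j) p = (\<integral>x. peval p x \<partial>phi j)"
  by (rule integrable_peval(2)[symmetric]) (rule integrable_phi[OF _ continuous_on_monom_eval])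

lemma AE_omega: "AE x in omega_measure. x \<in> \<Omega>"
  unfolding omega_measure_def by (subst AE_density) (auto simp: indicator_def)

text \<open>The function u adds up the squared violations of the constraints, so its zero set is
  \<Omega>, and \<open>riesz_le_on_zero_set\<close> bounds the functional by integration over
  \<Omega>. Using this for \<open>1 + x^\<alpha>\<close> and \<open>1 - x^\<alpha>\<close>, both
  nonnegative on the cube, the lower bound on the mass leaves only equality.\<close>

lemma limit_y_unique:
  fixes y :: "'n multiindex \<Rightarrow> real"
  assumes sq: "\<And>q. 0 \<le> riesz y (q * q)" "\<And>q. riesz y (q * q) \<le> riesz box_moments (q * q)"
    and loc: "\<And>j q. j \<in> {1..m} \<Longrightarrow> 0 \<le> riesz y ((pconst (b j) - g j) * (q * q))"
    and vol: "(\<integral>x. monom_eval 0 x \<partial>omega_measure) \<le> y 0"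
  shows "y \<alpha> = (\<integral>x. monom_eval \<alpha> x \<partial>omega_measure)"
proof -
  interpret D: dominated_functional unit_cube box_measure y
  proof (rule dominated_functional.intro)
    show "riesz y (q * q) \<le> (\<integral>x. peval (q * q) x \<partial>box_measure)" for q
      using sq(2)[of q] by (simp only: riesz_box_moments)
  qed (rule compact_unit_cube sets_box_measure finite_box_measure AE_box_measure sq(1))+
  define w where "w j x = max 0 (peval (g j) x - b j)" for j x
  define u where "u x = (\<Sum>j=1..m. (w j x)\<^sup>2)" for x
  have uc: "continuous_on UNIV u" unfolding u_def w_def by (intro continuous_intros)
  have u0: "0 \<le> u x" for x unfolding u_def by (intro sum_nonneg) auto
  have uz: "{x. u x = 0} = \<Omega>"
    by (auto simp: u_def sum_nonneg_eq_0_iff w_def Omega_def max_def split: if_splits)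
  have s: "\<exists>s. (\<forall>x\<in>unit_cube. u x \<le> peval s x) \<and> riesz y s \<le> \<delta>" if \<delta>: "\<delta> > 0" for \<delta>
  proof -
    let ?C = "measure box_measure (UNIV :: (real ^ 'n) set)"
    define \<eta> where "\<eta> = \<delta> / (real (Suc m) * (?C + 1))"
    have \<eta>: "\<eta> > 0" "real (Suc m) * \<eta> * ?C \<le> \<delta>"
      unfolding \<eta>_def by (rule epsilon_share[OF measure_nonneg \<delta>]; simp)+
    \<comment> \<open>Since w is the positive part of \<open>g - b\<close>, its square is
      \<open>(g - b) * w\<close>. Replacing w by a nearby square t * t costs at most \<eta> and
      yields a product on which the localizing constraint makes the functional nonpositive.\<close>
    have "\<exists>t. \<forall>x\<in>unit_cube. (w j x)\<^sup>2 \<le> (peval (g j) x - b j) * peval (t * t) x + \<eta>" for j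
    proof -
      have "bounded ((\<lambda>x. peval (g j) x - b j) ` unit_cube)"
        by (intro compact_imp_bounded compact_continuous_image compact_unit_cube continuous_intros)
      then obtain F where F: "\<And>x. x \<in> unit_cube \<Longrightarrow> \<bar>peval (g j) x - b j\<bar> \<le> F" unfolding bounded_iff by auto
      define F' where "F' = max F 1"
      have F': "F' > 0" "\<And>x. x \<in> unit_cube \<Longrightarrow> \<bar>peval (g j) x - b j\<bar> \<le> F'"
        using F by (auto simp: F'_def le_max_iff_disj)
      have "continuous_on unit_cube (\<lambda>x. sqrt (w j x))" unfolding w_def by (intro continuous_intros)
      from square_approx[OF compact_unit_cube this, of "\<eta> / F'"] F'(1) \<eta>(1)
      obtain t where t: "\<And>x. x \<in> unit_cube \<Longrightarrow> \<bar>peval (t * t) x - (sqrt (w j x))\<^sup>2\<bar> \<le> \<eta> / F'" by auto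
      have "(w j x)\<^sup>2 \<le> (peval (g j) x - b j) * peval (t * t) x + \<eta>" if x: "x \<in> unit_cube" for x
      proof -
        have "\<bar>(peval (g j) x - b j) * (w j x - peval (t * t) x)\<bar> \<le> F' * (\<eta> / F')"
          unfolding abs_mult using F'(2)[OF x] t[OF x] F'(1)
          by (intro mult_mono) (auto simp: w_def abs_minus_commute)
        then have "(peval (g j) x - b j) * w j x \<le> (peval (g j) x - b j) * peval (t * t) x + \<eta>"
          using F'(1) by (auto simp: abs_le_iff right_diff_distrib)
        moreover have "(peval (g j) x - b j) * w j x = (w j x)\<^sup>2"
          by (auto simp: w_def max_def power2_eq_square)
        ultimately show ?thesis by simp
      qed
      then show ?thesis by blast
    qed
    then obtain t where t: "\<And>j x. x \<in> unit_cube \<Longrightarrow> (w j x)\<^sup>2 \<le> (peval (g j) x - b j) * peval (t j * t j) x + \<eta>"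
      by metis
    define s where "s = (\<Sum>j=1..m. pconst \<eta> * 1 - (pconst (b j) - g j) * (t j * t j))"
    have "u x \<le> peval s x" if x: "x \<in> unit_cube" for x
    proof -
      have "peval s x = (\<Sum>j=1..m. (peval (g j) x - b j) * peval (t j * t j) x + \<eta>)"
        unfolding s_def peval_sum by (intro sum.cong refl) (simp add: peval_add peval_diff peval_mult algebra_simps)
      then show ?thesis unfolding u_def using t[OF x] by (simp add: sum_mono)
    qed
    moreover have "riesz y s \<le> \<delta>"
    proof -
      have "riesz y s \<le> (\<Sum>j=1..m. \<eta> * ?C)"
        unfolding s_def riesz_sum
      proof (rule sum_mono)
        fix j assume j: "j \<in> {1..m}"
        have "\<eta> * riesz y 1 \<le> \<eta> * ?C" using \<eta>(1) D.riesz_1_le by (intro mult_left_mono) auto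
        then show "riesz y (pconst \<eta> * 1 - (pconst (b j) - g j) * (t j * t j)) \<le> \<eta> * ?C"
          using loc[OF j, of "t j"] unfolding riesz_diff riesz_scale_left by linarith
      qed
      also have "\<dots> = real m * \<eta> * ?C" by simp
      also have "\<dots> \<le> real (Suc m) * \<eta> * ?C" using \<eta>(1) by (intro mult_right_mono) auto
      finally show ?thesis using \<eta>(2) by linarith
    qed
    ultimately show ?thesis by blast
  qed
  have le: "riesz y q \<le> (\<integral>x. peval q x \<partial>omega_measure)" if q: "\<And>x. x \<in> unit_cube \<Longrightarrow> 0 \<le> peval q x" for q
    using D.riesz_le_on_zero_set[OF uc u0 s q] unfolding uz omega_le_box[OF borel_measurable_peval] .
  let ?z = "\<lambda>\<alpha>. \<integral>x. monom_eval \<alpha> x \<partial>omega_measure"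
  have "y 0 + y \<alpha> \<le> ?z 0 + ?z \<alpha>"
  proof -
    have "riesz y (pmonom 0 + pmonom \<alpha>) \<le> riesz ?z (pmonom 0 + pmonom \<alpha>)"
      unfolding riesz_omega by (intro le) (simp add: peval_add monom_unit_cube_pm)
    then show ?thesis by (simp only: riesz_add riesz_single mult_1_left)
  qed
  moreover have "y 0 - y \<alpha> \<le> ?z 0 - ?z \<alpha>"
  proof -
    have "riesz y (pmonom 0 - pmonom \<alpha>) \<le> riesz ?z (pmonom 0 - pmonom \<alpha>)"
      unfolding riesz_omega using monom_unit_cube_pm(2)[of _ \<alpha>] by (intro le) (simp add: peval_diff)
    then show ?thesis by (simp only: riesz_diff riesz_single mult_1_left)
  qed
  ultimately show ?thesis using vol by linarith
qed

section \<open>Uniqueness of the limits on the faces\<close>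

definition wt :: "nat \<Rightarrow> real" where "wt j = real (dg j) * b j"

lemma wt_nonneg: "j \<in> {1..m} \<Longrightarrow> 0 \<le> wt j"
  using b_pos by (simp add: wt_def less_imp_le)

text \<open>The linear constraint fixes only the weighted sum of the functionals \<open>v j\<close>.
  As all of them are nonnegative on squares, integration against this sum of face measures dominates
  each single one.\<close>

definition Phi :: "(real ^ 'n) measure" where
  "Phi = density H (\<lambda>x. ennreal (\<Sum>j=1..m. wt j * phi_density j x))"

lemma sets_Phi [simp, measurable_cong]: "sets Phi = sets borel"
  by (simp add: Phi_def)

lemma integral_Phi:
  fixes f :: "real ^ 'n \<Rightarrow> real"
  assumes f [measurable]: "f \<in> borel_measurable borel" and i: "\<And>j. j \<in> {1..m} \<Longrightarrow> integrable (phi j) f"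
  shows "(\<integral>x. f x \<partial>Phi) = (\<Sum>j=1..m. wt j * (\<integral>x. f x \<partial>phi j))"
proof -
  have nn: "0 \<le> (\<Sum>j=1..m. wt j * phi_density j x)" for x
    by (intro sum_nonneg mult_nonneg_nonneg wt_nonneg phi_density_nonneg)
  have iH: "integrable H (\<lambda>x. phi_density j x *\<^sub>R f x)" if "j \<in> {1..m}" for j
    using i[OF that] unfolding phi_def
    by (subst (asm) integrable_density) (auto simp: phi_density_nonneg)
  have "(\<integral>x. f x \<partial>Phi) = (\<integral>x. (\<Sum>j=1..m. wt j * phi_density j x) *\<^sub>R f x \<partial>H)"
    unfolding Phi_def by (rule integral_density[OF _ _ AE_I2[OF nn]]) auto
  also have "\<dots> = (\<integral>x. (\<Sum>j=1..m. wt j * (phi_density j x *\<^sub>R f x)) \<partial>H)"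
    by (intro Bochner_Integration.integral_cong) (auto simp: sum_distrib_right mult.assoc)
  also have "\<dots> = (\<Sum>j=1..m. wt j * (\<integral>x. phi_density j x *\<^sub>R f x \<partial>H))"
    using iH by (subst Bochner_Integration.integral_sum) auto
  also have "\<dots> = (\<Sum>j=1..m. wt j * (\<integral>x. f x \<partial>phi j))"
  proof (rule sum.cong[OF refl])
    fix j
    have "(\<integral>x. f x \<partial>phi j) = (\<integral>x. phi_density j x *\<^sub>R f x \<partial>H)"
      unfolding phi_def by (rule integral_density) (auto simp: phi_density_nonneg)
    then show "wt j * (\<integral>x. phi_density j x *\<^sub>R f x \<partial>H) = wt j * (\<integral>x. f x \<partial>phi j)" by simp
  qed
  finally show ?thesis .
qed

lemma finite_Phi: "finite_measure Phi"
proof (rule finite_measureI)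
  have "emeasure Phi UNIV = (\<integral>\<^sup>+x. (\<Sum>j=1..m. ennreal (wt j) * ennreal (phi_density j x)) \<partial>H)"
  proof -
    have "emeasure Phi UNIV = (\<integral>\<^sup>+x. ennreal (\<Sum>j=1..m. wt j * phi_density j x) \<partial>H)"
      unfolding Phi_def by (subst emeasure_density) auto
    also have "\<dots> = (\<integral>\<^sup>+x. (\<Sum>j=1..m. ennreal (wt j) * ennreal (phi_density j x)) \<partial>H)"
      by (intro nn_integral_cong) (subst sum_ennreal[symmetric], auto simp: ennreal_mult wt_nonneg phi_density_nonneg intro!: sum.cong)
    finally show ?thesis .
  qed
  also have "\<dots> = (\<Sum>j=1..m. \<integral>\<^sup>+x. ennreal (wt j) * ennreal (phi_density j x) \<partial>H)"
    by (rule nn_integral_sum) auto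
  also have "\<dots> = (\<Sum>j=1..m. ennreal (wt j) * emeasure (phi j) UNIV)"
    unfolding phi_def by (intro sum.cong refl) (simp add: nn_integral_cmult emeasure_density)
  also have "\<dots> < \<infinity>"
  proof -
    have "emeasure (phi j) UNIV < top" if "j \<in> {1..m}" for j
      using finite_measure.emeasure_finite[OF finite_measure_phi[OF that], of UNIV] by (simp add: less_top)
    then show ?thesis by (auto simp: ennreal_mult_less_top)
  qed
  finally show "emeasure Phi (space Phi) \<noteq> \<infinity>" by (simp add: Phi_def)
qed

lemma AE_Phi: "AE x in Phi. x \<in> unit_cube"
  unfolding Phi_def
proof (subst AE_density)
  show "AE x in H. 0 < ennreal (\<Sum>j=1..m. wt j * phi_density j x) \<longrightarrow> x \<in> unit_cube"
  proof (rule AE_I2, rule impI)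
    fix x assume p: "0 < ennreal (\<Sum>j=1..m. wt j * phi_density j x)"
    have "\<exists>j\<in>{1..m}. phi_density j x \<noteq> 0"
    proof (rule ccontr)
      assume "\<not> ?thesis"
      then have "(\<Sum>j=1..m. wt j * phi_density j x) = 0" by (intro sum.neutral) auto
      then show False using p by simp
    qed
    then obtain j where "x \<in> face j" by (auto simp: phi_density_def indicator_def split: if_splits)
    then show "x \<in> unit_cube" using face_subset Omega_subset_cube by blast
  qed
qed measurable

text \<open>The overlap hypothesis says that the level set of constraint i is null for the other
  face measures.\<close>

lemma phi_face_restrict:
  fixes f :: "real ^ 'n \<Rightarrow> real"
  assumes i: "i \<in> {1..m}" and j: "j \<in> {1..m}" and f [measurable]: "f \<in> borel_measurable borel"
  shows "(\<integral>x. f x * indicator {x. peval (g i) x = b i} x \<partial>phi j) = (if j = i then (\<integral>x. f x \<partial>phi i) else 0)"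
proof (cases "j = i")
  case True
  have [measurable]: "{x. peval (g i) x = b i} \<in> sets borel" by measurable
  have "(\<integral>x. f x * indicator {x. peval (g i) x = b i} x \<partial>phi i) = (\<integral>x. f x \<partial>phi i)"
  proof (rule integral_cong_AE)
    show "AE x in phi i. f x * indicator {x. peval (g i) x = b i} x = f x"
      using phi_AE_face[of i] by eventually_elim (auto simp: Omega_face_def)
  qed measurable
  then show ?thesis using True by simp
next
  case False
  have [measurable]: "{x. peval (g i) x = b i} \<in> sets borel" by measurable
  have "face j \<inter> {x. peval (g i) x = b i} \<in> null_sets H"
    using face_overlap_null[OF j i] False face_borel[of j] by (auto simp: null_sets_def)
  from AE_not_in[OF this] have "AE x in phi j. x \<notin> {x. peval (g i) x = b i}"
    unfolding phi_def by (subst AE_density) (auto elim!: eventually_mono simp: phi_density_def indicator_def)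
  then have "AE x in phi j. f x * indicator {x. peval (g i) x = b i} x = 0"
    by eventually_elim auto
  then have "(\<integral>x. f x * indicator {x. peval (g i) x = b i} x \<partial>phi j) = 0"
    by (rule integral_eq_zero_AE)
  then show ?thesis using False by simp
qed

text \<open>For positive degree the weight is nonzero, and equality for 1 and for
  \<open>1 + x^\<alpha>\<close>, both nonnegative on the cube, gives equality for the monomial. For
  degree 0 the face is empty and both sides vanish.\<close>

lemma limit_v_unique:
  fixes v :: "nat \<Rightarrow> 'n multiindex \<Rightarrow> real"
  assumes sq: "\<And>j q. j \<in> {1..m} \<Longrightarrow> 0 \<le> riesz (v j) (q * q)"
    and loc: "\<And>j p. j \<in> {1..m} \<Longrightarrow> riesz (v j) ((pconst (b j) - g j) * p) = 0"
    and eq: "\<And>\<alpha>. (\<Sum>j=1..m. wt j * v j \<alpha>) = (\<Sum>j=1..m. wt j * (\<integral>x. monom_eval \<alpha> x \<partial>phi j))"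
    and zero: "\<And>j \<alpha>. j \<in> {1..m} \<Longrightarrow> dg j = 0 \<Longrightarrow> v j \<alpha> = 0"
    and i: "i \<in> {1..m}"
  shows "v i \<alpha> = (\<integral>x. monom_eval \<alpha> x \<partial>phi i)"
proof (cases "dg i = 0")
  case True
  have "AE x in phi i. monom_eval \<alpha> x = 0"
    using phi_AE_face[of i] face_deg_0[OF i True] by (auto elim!: eventually_mono)
  then show ?thesis using zero[OF i True] by (simp add: integral_eq_zero_AE)
next
  case False
  have scale: "riesz (\<lambda>\<alpha>. c * z \<alpha>) p = c * riesz z p" for c z and p :: "'n rpoly"
    by (simp add: riesz_def sum_distrib_left mult_ac)
  have ip: "integrable (phi j) (peval q)" if "j \<in> {1..m}" for j q
    by (rule integrable_phi[OF that continuous_on_peval])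
  have tot: "(\<Sum>j=1..m. wt j * riesz (v j) p) = (\<Sum>j=1..m. wt j * (\<integral>x. peval p x \<partial>phi j))" for p
  proof -
    have "(\<Sum>j=1..m. wt j * riesz (v j) p) = riesz (\<lambda>\<alpha>. \<Sum>j=1..m. wt j * v j \<alpha>) p"
      unfolding riesz_def by (simp add: sum_distrib_left, subst sum.swap) (simp add: mult_ac)
    also have "\<dots> = (\<Sum>j=1..m. wt j * riesz (\<lambda>\<alpha>. \<integral>x. monom_eval \<alpha> x \<partial>phi j) p)"
      unfolding eq unfolding riesz_def by (simp add: sum_distrib_left, subst sum.swap) (simp add: mult_ac)
    also have "\<dots> = (\<Sum>j=1..m. wt j * (\<integral>x. peval p x \<partial>phi j))"
      by (intro sum.cong refl) (simp add: riesz_phi)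
    finally show ?thesis .
  qed
  have le: "wt i * riesz (v i) q \<le> wt i * (\<integral>x. peval q x \<partial>phi i)"
    if i: "i \<in> {1..m}" and q: "\<And>x. x \<in> unit_cube \<Longrightarrow> 0 \<le> peval q x" for i q
  proof -
    interpret D: dominated_functional unit_cube Phi "\<lambda>\<alpha>. wt i * v i \<alpha>"
    proof (rule dominated_functional.intro)
      fix q
      show "0 \<le> riesz (\<lambda>\<alpha>. wt i * v i \<alpha>) (q * q)"
        unfolding scale using sq[OF i] wt_nonneg[OF i] by simp
      have "riesz (\<lambda>\<alpha>. wt i * v i \<alpha>) (q * q) \<le> (\<Sum>j=1..m. wt j * riesz (v j) (q * q))"
        unfolding scale using i sq wt_nonneg by (intro member_le_sum) auto
      also have "\<dots> = (\<integral>x. peval (q * q) x \<partial>Phi)"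
        unfolding tot by (rule integral_Phi[symmetric]) (use ip in auto)
      finally show "riesz (\<lambda>\<alpha>. wt i * v i \<alpha>) (q * q) \<le> (\<integral>x. peval (q * q) x \<partial>Phi)" .
    qed (rule compact_unit_cube sets_Phi finite_Phi AE_Phi)+
    \<comment> \<open>This u is a polynomial multiple of the constraint, so the functional vanishes
      on it exactly and u serves as its own majorant.\<close>
    let ?u = "\<lambda>x. (b i - peval (g i) x)\<^sup>2"
    have z: "{x. ?u x = 0} = {x. peval (g i) x = b i}" by auto
    have [measurable]: "{x. peval (g i) x = b i} \<in> sets borel" by measurable
    have "riesz (\<lambda>\<alpha>. wt i * v i \<alpha>) q \<le> (\<integral>x. peval q x * indicator {x. ?u x = 0} x \<partial>Phi)"
    proof (rule D.riesz_le_on_zero_set)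
      fix \<delta> :: real assume "\<delta> > 0"
      have "peval ((pconst (b i) - g i) * (pconst (b i) - g i)) x = ?u x" for x
        by (simp add: peval_mult peval_diff power2_eq_square)
      moreover have "riesz (\<lambda>\<alpha>. wt i * v i \<alpha>) ((pconst (b i) - g i) * (pconst (b i) - g i)) = 0"
        unfolding scale using loc[OF i] by simp
      ultimately show "\<exists>s. (\<forall>x\<in>unit_cube. ?u x \<le> peval s x) \<and> riesz (\<lambda>\<alpha>. wt i * v i \<alpha>) s \<le> \<delta>"
        using \<open>\<delta> > 0\<close> by (intro exI[of _ "(pconst (b i) - g i) * (pconst (b i) - g i)"]) auto
    qed (use q in \<open>auto intro!: continuous_intros\<close>)
    also have "\<dots> = (\<Sum>j=1..m. wt j * (\<integral>x. peval q x * indicator {x. peval (g i) x = b i} x \<partial>phi j))"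
      unfolding z by (rule integral_Phi) (auto intro!: integrable_real_mult_indicator ip)
    also have "\<dots> = (\<Sum>j=1..m. if j = i then wt i * (\<integral>x. peval q x \<partial>phi i) else 0)"
      using i by (intro sum.cong refl) (simp add: phi_face_restrict)
    also have "\<dots> = wt i * (\<integral>x. peval q x \<partial>phi i)" using i by simp
    finally show ?thesis unfolding scale .
  qed
  have eq': "riesz (v i) q = (\<integral>x. peval q x \<partial>phi i)" if q: "\<And>x. x \<in> unit_cube \<Longrightarrow> 0 \<le> peval q x" for q
  proof -
    \<comment> \<open>All the differences are nonnegative by \<open>le\<close> and their sum is 0,
      so each of them is 0.\<close>
    have "(\<Sum>j=1..m. wt j * (\<integral>x. peval q x \<partial>phi j) - wt j * riesz (v j) q) = 0"
      unfolding sum_subtractf using tot[of q] by simp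
    then have "wt i * (\<integral>x. peval q x \<partial>phi i) - wt i * riesz (v i) q = 0"
      using le[OF _ q] i by (subst (asm) sum_nonneg_eq_0_iff) auto
    moreover have "wt i \<noteq> 0" using False b_pos[OF i] by (simp add: wt_def)
    ultimately show ?thesis by simp
  qed
  have "riesz (v i) (pmonom 0 + pmonom \<alpha>) = riesz (\<lambda>\<alpha>. \<integral>x. monom_eval \<alpha> x \<partial>phi i) (pmonom 0 + pmonom \<alpha>)"
    unfolding riesz_phi[OF i] by (intro eq') (simp add: peval_add monom_unit_cube_pm)
  moreover have "riesz (v i) (pmonom 0) = riesz (\<lambda>\<alpha>. \<integral>x. monom_eval \<alpha> x \<partial>phi i) (pmonom 0)"
    unfolding riesz_phi[OF i] by (intro eq') auto
  ultimately show ?thesis by (simp only: riesz_add riesz_single mult_1_left)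
qed

end

section \<open>Compactness of the relaxations\<close>

text \<open>Tychonoff's theorem. The bound for index i holds only eventually, depending on i, so the
  family is first clipped into the compact product. Convergence along a finer filter takes the place
  of a diagonal subsequence.\<close>

lemma bounded_cluster_point:
  fixes X :: "'k \<Rightarrow> 'i \<Rightarrow> real"
  assumes F0: "F0 \<noteq> bot" and bnd: "\<And>i. \<forall>\<^sub>F k in F0. \<bar>X k i\<bar> \<le> C i"
  obtains F l where "F \<noteq> bot" "F \<le> F0" "\<And>i. ((\<lambda>k. X k i) \<longlongrightarrow> l i) F"
proof -
  define X' where "X' k i = max (- \<bar>C i\<bar>) (min \<bar>C i\<bar> (X k i))" for k i
  define S where "S = PiE UNIV (\<lambda>i. {- \<bar>C i\<bar>..\<bar>C i\<bar>})"
  have "compactin (product_topology (\<lambda>i. euclidean) UNIV) S"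
    unfolding S_def compactin_PiE by simp
  then have "compact S" by (simp add: euclidean_product_topology)
  moreover have "filtermap X' F0 \<noteq> bot" using F0 by (simp add: filtermap_bot_iff)
  moreover have "\<forall>\<^sub>F x in filtermap X' F0. x \<in> S"
    by (auto simp: eventually_filtermap S_def X'_def PiE_def)
  ultimately obtain l where l: "inf (nhds l) (filtermap X' F0) \<noteq> bot"
    unfolding compact_filter by blast
  define F where "F = inf (filtercomap X' (nhds l)) F0"
  have "F \<noteq> bot"
  proof
    assume "F = bot"
    then have "eventually (\<lambda>_. False) F" by simp
    then obtain P Q where PQ: "eventually P (filtercomap X' (nhds l))" "eventually Q F0" "\<And>k. P k \<Longrightarrow> Q k \<Longrightarrow> False"
      unfolding F_def eventually_inf by blast
    then obtain R where R: "eventually R (nhds l)" "\<And>k. R (X' k) \<Longrightarrow> P k"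
      unfolding eventually_filtercomap by blast
    have "eventually (\<lambda>x. \<not> R x) (filtermap X' F0)"
      unfolding eventually_filtermap using PQ(2) by (rule eventually_mono) (use PQ(3) R(2) in blast)
    then have "eventually (\<lambda>_. False) (inf (nhds l) (filtermap X' F0))"
      using R(1) unfolding eventually_inf by blast
    then show False using l by (simp add: trivial_limit_def)
  qed
  moreover have "F \<le> F0" by (simp add: F_def)
  moreover have "((\<lambda>k. X k i) \<longlongrightarrow> l i) F" for i
  proof -
    have "filterlim X' (nhds l) (filtercomap X' (nhds l))" by (rule filterlim_filtercomap)
    then have lim: "filterlim X' (nhds l) F" unfolding F_def by (rule filterlim_mono) auto
    have t: "((\<lambda>k. X' k i) \<longlongrightarrow> l i) F"
    proof (rule topological_tendstoI)
      fix U :: "real set" assume U: "open U" "l i \<in> U"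
      have "continuous_on UNIV (\<lambda>f :: 'i \<Rightarrow> real. f i)" by (rule continuous_on_product_coordinates)
      from open_vimage[OF U(1) this] have "open ((\<lambda>f :: 'i \<Rightarrow> real. f i) -` U)" .
      then have "\<forall>\<^sub>F k in F. X' k \<in> (\<lambda>f. f i) -` U"
        using topological_tendstoD[OF lim, of "(\<lambda>f. f i) -` U"] U(2) by simp
      then show "\<forall>\<^sub>F k in F. X' k i \<in> U" by simp
    qed
    have "\<forall>\<^sub>F k in F0. X' k i = X k i"
      using bnd[of i] by eventually_elim (auto simp: X'_def)
    then have "\<forall>\<^sub>F k in F. X' k i = X k i" using \<open>F \<le> F0\<close> filter_leD by blast
    from tendsto_cong[OF this] t show ?thesis by (rule iffD1)
  qed
  ultimately show thesis by (rule that)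
qed

text \<open>The subsequence principle for filters: if f were outside a neighbourhood of l infinitely
  often, those indices would generate a proper filter, and along no proper filter finer than it
  could f converge to l.\<close>

lemma tendsto_by_cluster:
  fixes f :: "nat \<Rightarrow> real"
  assumes "\<And>F0. F0 \<noteq> bot \<Longrightarrow> F0 \<le> sequentially \<Longrightarrow> \<exists>F. F \<noteq> bot \<and> F \<le> F0 \<and> (f \<longlongrightarrow> l) F"
  shows "f \<longlonglongrightarrow> l"
proof (rule topological_tendstoI, rule ccontr)
  fix S assume S: "open S" "l \<in> S" and n: "\<not> (\<forall>\<^sub>F k in sequentially. f k \<in> S)"
  define F0 where "F0 = inf sequentially (principal {k. f k \<notin> S})"
  have "F0 \<noteq> bot"
    using n unfolding F0_def trivial_limit_def eventually_inf_principal by simp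
  then obtain F where F: "F \<noteq> bot" "F \<le> F0" "(f \<longlongrightarrow> l) F"
    using assms[of F0] by (auto simp: F0_def)
  have "\<forall>\<^sub>F k in F0. f k \<notin> S" unfolding F0_def eventually_inf_principal by simp
  then have "\<forall>\<^sub>F k in F. f k \<notin> S" using F(2) filter_leD by blast
  moreover have "\<forall>\<^sub>F k in F. f k \<in> S" using topological_tendstoD[OF F(3) S] .
  ultimately have "\<forall>\<^sub>F k in F. False" by eventually_elim simp
  then show False using F(1) by (simp add: trivial_limit_def)
qed

lemma le_2_half_deg: "k \<le> 2 * half_deg k"
proof -
  have "real (half_deg k) = of_int \<lceil>real k / 2\<rceil>" by (simp add: half_deg_def)
  then have "real k \<le> 2 * real (half_deg k)" using le_of_int_ceiling[of "real k / 2"] by linarith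
  then show ?thesis by linarith
qed

lemma half_deg_0 [simp]: "half_deg 0 = 0"
  by (simp add: half_deg_def)

lemma half_deg_le_d_min: "j \<in> {1..m} \<Longrightarrow> half_deg (dg j) \<le> d_min m dg"
  unfolding d_min_def by (intro Max_ge) auto

lemma multiindices_mono: "k \<le> l \<Longrightarrow> multiindices k \<subseteq> multiindices l"
  by (auto simp: multiindices_def)

lemma zero_in_multiindices [simp]: "0 \<in> multiindices k"
  by (simp add: multiindices_def)

lemma keys_mult_multiindices:
  fixes p q :: "'n::finite rpoly"
  assumes "Poly_Mapping.keys p \<subseteq> multiindices k" "Poly_Mapping.keys q \<subseteq> multiindices l"
  shows "Poly_Mapping.keys (p * q) \<subseteq> multiindices (k + l)"
proof
  fix \<alpha> assume "\<alpha> \<in> Poly_Mapping.keys (p * q)"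
  then obtain \<beta> \<gamma> where "\<alpha> = \<beta> + \<gamma>" "\<beta> \<in> Poly_Mapping.keys p" "\<gamma> \<in> Poly_Mapping.keys q"
    using keys_mult[of p q] by blast
  then show "\<alpha> \<in> multiindices (k + l)"
    using assms by (auto simp: multiindices_def total_deg_add subset_iff intro: add_mono)
qed

lemma tendsto_riesz:
  assumes "\<And>\<alpha>. \<alpha> \<in> Poly_Mapping.keys p \<Longrightarrow> ((\<lambda>k. Y k \<alpha>) \<longlongrightarrow> y \<alpha>) F"
  shows "((\<lambda>k. riesz (Y k) p) \<longlongrightarrow> riesz y p) F"
  unfolding riesz_def using assms by (intro tendsto_sum tendsto_mult tendsto_const) auto

context homogeneous_semialgebraic
begin

text \<open>
  The constraints of the program without the extensionality requirement, so that they make sense for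
  infinite sequences and one and the same sequence can satisfy them for several d.
\<close>

definition core :: "nat \<Rightarrow> ('n multiindex \<Rightarrow> real) \<Rightarrow> (nat \<Rightarrow> 'n multiindex \<Rightarrow> real) \<Rightarrow> bool" where
  "core d y v \<longleftrightarrow>
     (\<forall>\<alpha>\<in>multiindices (2 * d). real (CARD('n) + total_deg \<alpha>) * y \<alpha> = (\<Sum>j=1..m. wt j * v j \<alpha>)) \<and>
     (\<forall>q. Poly_Mapping.keys q \<subseteq> multiindices d \<longrightarrow> riesz y (q * q) \<le> riesz box_moments (q * q)) \<and>
     (\<forall>q. Poly_Mapping.keys q \<subseteq> multiindices d \<longrightarrow> 0 \<le> riesz y (q * q)) \<and>
     (\<forall>j\<in>{1..m}. \<forall>q. Poly_Mapping.keys q \<subseteq> multiindices (d - half_deg (dg j)) \<longrightarrow>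
        0 \<le> riesz y ((pconst (b j) - g j) * (q * q))) \<and>
     (\<forall>j\<in>{1..m}. \<forall>q. Poly_Mapping.keys q \<subseteq> multiindices d \<longrightarrow> 0 \<le> riesz (v j) (q * q)) \<and>
     (\<forall>j\<in>{1..m}. \<forall>\<alpha>\<in>multiindices (d - half_deg (dg j)). \<forall>\<beta>\<in>multiindices (d - half_deg (dg j)).
        riesz (v j) ((pconst (b j) - g j) * pmonom (\<alpha> + \<beta>)) = 0) \<and>
     (\<forall>j\<in>{1..m}. \<forall>l\<in>{1..m}. l \<noteq> j \<longrightarrow>
       (\<forall>q. Poly_Mapping.keys q \<subseteq> multiindices (d - half_deg (dg l)) \<longrightarrow>
          0 \<le> riesz (v j) ((pconst (b l) - g l) * (q * q))))"

lemma feasible_iff_core: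
  "feasible m g dg b d y v \<longleftrightarrow> y \<in> multiindices (2 * d) \<rightarrow>\<^sub>E UNIV \<and>
     v \<in> {1..m} \<rightarrow>\<^sub>E (multiindices (2 * d) \<rightarrow>\<^sub>E UNIV) \<and> core d y v"
  unfolding feasible_def core_def wt_def zero_on_def localizing_matrix_def[symmetric]
  by (simp add: loewner_le_on_moment_iff psd_on_moment_iff psd_on_localizing_iff)

lemma keys_constraint:
  assumes "j \<in> {1..m}"
  shows "Poly_Mapping.keys (pconst (b j) - g j) \<subseteq> multiindices (dg j)"
proof -
  have "Poly_Mapping.keys (g j) \<subseteq> multiindices (dg j)"
    using homog[OF assms] by (auto simp: homogeneous_def multiindices_def)
  moreover have "Poly_Mapping.keys (pconst (b j) :: 'n rpoly) \<subseteq> multiindices (dg j)" by simp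
  ultimately show ?thesis using keys_diff[of "pconst (b j)" "g j"] by blast
qed

text \<open>Rounding up in \<open>half_deg\<close> gives
  \<open>dg j \<le> 2 * half_deg (dg j)\<close>, so the localizing constraints involve no moments of
  degree beyond 2 * d.\<close>

lemma keys_localizing:
  assumes j: "j \<in> {1..m}" and d: "half_deg (dg j) \<le> d"
    and p: "Poly_Mapping.keys p \<subseteq> multiindices (2 * (d - half_deg (dg j)))"
  shows "Poly_Mapping.keys ((pconst (b j) - g j) * p) \<subseteq> multiindices (2 * d)"
proof -
  have "dg j + 2 * (d - half_deg (dg j)) \<le> 2 * d" using d le_2_half_deg[of "dg j"] by linarith
  then show ?thesis
    using keys_mult_multiindices[OF keys_constraint[OF j] p] multiindices_mono by blast
qed

text \<open>Each constraint is a closed condition on finitely many moments of degree at most 2 * d.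
  The bound on d prevents the subtraction \<open>d - half_deg (dg j)\<close> from truncating, which
  could bring in moments of higher degree.\<close>

lemma core_limit:
  assumes F: "F \<noteq> bot" and ev: "\<forall>\<^sub>F k in F. core d (Y k) (V k)" and d: "d_min m dg \<le> d"
    and Y: "\<And>\<alpha>. \<alpha> \<in> multiindices (2 * d) \<Longrightarrow> ((\<lambda>k. Y k \<alpha>) \<longlongrightarrow> y \<alpha>) F"
    and V: "\<And>j \<alpha>. j \<in> {1..m} \<Longrightarrow> \<alpha> \<in> multiindices (2 * d) \<Longrightarrow> ((\<lambda>k. V k j \<alpha>) \<longlongrightarrow> v j \<alpha>) F"
  shows "core d y v"
proof -
  have TY: "((\<lambda>k. riesz (Y k) p) \<longlongrightarrow> riesz y p) F" if "Poly_Mapping.keys p \<subseteq> multiindices (2 * d)" for p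
    using that by (intro tendsto_riesz Y) auto
  have TV: "((\<lambda>k. riesz (V k j) p) \<longlongrightarrow> riesz (v j) p) F"
    if "j \<in> {1..m}" "Poly_Mapping.keys p \<subseteq> multiindices (2 * d)" for p j
    using that by (intro tendsto_riesz V) auto
  have hd: "half_deg (dg j) \<le> d" if "j \<in> {1..m}" for j
    using half_deg_le_d_min[OF that] d order_trans by blast
  have kq: "Poly_Mapping.keys (q * q) \<subseteq> multiindices (2 * k)" if "Poly_Mapping.keys q \<subseteq> multiindices k" for q :: "'n rpoly" and k
    using keys_mult_multiindices[OF that that] by (simp add: mult_2)
  have km: "Poly_Mapping.keys (pmonom (\<alpha> + \<beta>)) \<subseteq> multiindices (2 * k)" if "\<alpha> \<in> multiindices k" "\<beta> \<in> multiindices k" for \<alpha> \<beta> :: "'n multiindex" and k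
    using that by (auto simp: multiindices_def total_deg_add)
  show ?thesis
    unfolding core_def
  proof (intro conjI ballI allI impI)
    fix \<alpha> :: "'n multiindex" assume a: "\<alpha> \<in> multiindices (2 * d)"
    have A: "((\<lambda>k. real (CARD('n) + total_deg \<alpha>) * Y k \<alpha>) \<longlongrightarrow> real (CARD('n) + total_deg \<alpha>) * y \<alpha>) F"
      by (intro tendsto_intros Y a)
    have B: "((\<lambda>k. \<Sum>j=1..m. wt j * V k j \<alpha>) \<longlongrightarrow> (\<Sum>j=1..m. wt j * v j \<alpha>)) F"
      by (intro tendsto_sum tendsto_mult tendsto_const V a)
    have "\<forall>\<^sub>F k in F. real (CARD('n) + total_deg \<alpha>) * Y k \<alpha> = (\<Sum>j=1..m. wt j * V k j \<alpha>)"
      using ev by (rule eventually_mono) (use a in \<open>simp add: core_def\<close>)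
    from tendsto_unique[OF F iffD1[OF tendsto_cong[OF this] A] B]
    show "real (CARD('n) + total_deg \<alpha>) * y \<alpha> = (\<Sum>j=1..m. wt j * v j \<alpha>)" .
  next
    fix q :: "'n rpoly" assume q: "Poly_Mapping.keys q \<subseteq> multiindices d"
    show "riesz y (q * q) \<le> riesz box_moments (q * q)"
      by (rule tendsto_upperbound[OF TY[OF kq[OF q]] eventually_mono[OF ev] F]) (use q in \<open>simp add: core_def\<close>)
    show "0 \<le> riesz y (q * q)"
      by (rule tendsto_lowerbound[OF TY[OF kq[OF q]] eventually_mono[OF ev] F]) (use q in \<open>simp add: core_def\<close>)
    fix j assume j: "j \<in> {1..m}"
    show "0 \<le> riesz (v j) (q * q)"
      by (rule tendsto_lowerbound[OF TV[OF j kq[OF q]] eventually_mono[OF ev] F]) (use q j in \<open>simp add: core_def\<close>)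
  next
    fix j and q :: "'n rpoly" assume j: "j \<in> {1..m}" and q: "Poly_Mapping.keys q \<subseteq> multiindices (d - half_deg (dg j))"
    show "0 \<le> riesz y ((pconst (b j) - g j) * (q * q))"
      by (rule tendsto_lowerbound[OF TY[OF keys_localizing[OF j hd[OF j] kq[OF q]]] eventually_mono[OF ev] F])
        (use q j in \<open>simp add: core_def\<close>)
    fix i assume i: "i \<in> {1..m}" "j \<noteq> i"
    show "0 \<le> riesz (v i) ((pconst (b j) - g j) * (q * q))"
      by (rule tendsto_lowerbound[OF TV[OF i(1) keys_localizing[OF j hd[OF j] kq[OF q]]] eventually_mono[OF ev] F])
        (use q i j in \<open>simp add: core_def\<close>)
  next
    fix j and \<alpha> \<beta> :: "'n multiindex"
    assume j: "j \<in> {1..m}" and a: "\<alpha> \<in> multiindices (d - half_deg (dg j))" "\<beta> \<in> multiindices (d - half_deg (dg j))"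
    have A: "((\<lambda>k. riesz (V k j) ((pconst (b j) - g j) * pmonom (\<alpha> + \<beta>))) \<longlongrightarrow> riesz (v j) ((pconst (b j) - g j) * pmonom (\<alpha> + \<beta>))) F"
      by (rule TV[OF j keys_localizing[OF j hd[OF j] km[OF a]]])
    have "\<forall>\<^sub>F k in F. riesz (V k j) ((pconst (b j) - g j) * pmonom (\<alpha> + \<beta>)) = 0"
      using ev by (rule eventually_mono) (use j a in \<open>simp add: core_def\<close>)
    from tendsto_unique[OF F A tendsto_eventually[OF this]]
    show "riesz (v j) ((pconst (b j) - g j) * pmonom (\<alpha> + \<beta>)) = 0" .
  qed
qed

text \<open>The constraints see only indices of degree at most 2 * d, and convergence of a constant
  sequence on these indices is equality there.\<close>

lemma core_cong:
  assumes "core d y v" "d_min m dg \<le> d" "\<And>\<alpha>. \<alpha> \<in> multiindices (2 * d) \<Longrightarrow> y' \<alpha> = y \<alpha>"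
    "\<And>j \<alpha>. j \<in> {1..m} \<Longrightarrow> \<alpha> \<in> multiindices (2 * d) \<Longrightarrow> v' j \<alpha> = v j \<alpha>"
  shows "core d y' v'"
  by (rule core_limit[of sequentially d "\<lambda>_. y" "\<lambda>_. v"]) (use assms in auto)

lemma core_mono:
  assumes c: "core d' y v" and d: "d \<le> d'" shows "core d y v"
proof -
  have M: "multiindices (2 * d) \<subseteq> (multiindices (2 * d') :: 'n multiindex set)"
    "multiindices d \<subseteq> (multiindices d' :: 'n multiindex set)"
    "\<And>k. multiindices (d - k) \<subseteq> (multiindices (d' - k) :: 'n multiindex set)"
    using d by (auto intro!: multiindices_mono)
  show ?thesis
    unfolding core_def
  proof (intro conjI ballI allI impI)
    fix \<alpha> :: "'n multiindex" assume "\<alpha> \<in> multiindices (2 * d)"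
    then show "real (CARD('n) + total_deg \<alpha>) * y \<alpha> = (\<Sum>j=1..m. wt j * v j \<alpha>)"
      using c M(1) unfolding core_def by blast
  next
    fix q :: "'n rpoly" assume "Poly_Mapping.keys q \<subseteq> multiindices d"
    then have q: "Poly_Mapping.keys q \<subseteq> multiindices d'" using M(2) by blast
    then show "riesz y (q * q) \<le> riesz box_moments (q * q)" "0 \<le> riesz y (q * q)"
      using c unfolding core_def by blast+
    show "0 \<le> riesz (v j) (q * q)" if "j \<in> {1..m}" for j
      using c q that unfolding core_def by blast
  next
    fix j and q :: "'n rpoly" assume j: "j \<in> {1..m}" and "Poly_Mapping.keys q \<subseteq> multiindices (d - half_deg (dg j))"
    then have q: "Poly_Mapping.keys q \<subseteq> multiindices (d' - half_deg (dg j))" using M(3) by blast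
    then show "0 \<le> riesz y ((pconst (b j) - g j) * (q * q))"
      using c j unfolding core_def by blast
    show "0 \<le> riesz (v i) ((pconst (b j) - g j) * (q * q))" if "i \<in> {1..m}" "j \<noteq> i" for i
      using c j q that unfolding core_def by blast
  next
    fix j and \<alpha> \<beta> :: "'n multiindex"
    assume "j \<in> {1..m}" "\<alpha> \<in> multiindices (d - half_deg (dg j))" "\<beta> \<in> multiindices (d - half_deg (dg j))"
    then show "riesz (v j) ((pconst (b j) - g j) * pmonom (\<alpha> + \<beta>)) = 0"
      using c M(3) unfolding core_def by blast
  qed
qed

lemma feasible_restrict:
  assumes "core d y v" "d_min m dg \<le> d"
  shows "feasible m g dg b d (restrict y (multiindices (2 * d))) (\<lambda>j\<in>{1..m}. restrict (v j) (multiindices (2 * d)))"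
  unfolding feasible_iff_core
proof (intro conjI)
  show "core d (restrict y (multiindices (2 * d))) (\<lambda>j\<in>{1..m}. restrict (v j) (multiindices (2 * d)))"
    using assms by (rule core_cong) auto
qed auto

section \<open>Feasibility of the true moments\<close>

definition y_true :: "'n multiindex \<Rightarrow> real" where
  "y_true \<alpha> = (\<integral>x. monom_eval \<alpha> x \<partial>omega_measure)"

definition v_true :: "nat \<Rightarrow> 'n multiindex \<Rightarrow> real" where
  "v_true j \<alpha> = (\<integral>x. monom_eval \<alpha> x \<partial>phi j)"

lemma riesz_y_true: "riesz y_true p = (\<integral>x. peval p x \<partial>omega_measure)"
  using riesz_omega by (simp add: y_true_def[abs_def])

lemma riesz_v_true: "j \<in> {1..m} \<Longrightarrow> riesz (v_true j) p = (\<integral>x. peval p x \<partial>phi j)"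
  using riesz_phi by (simp add: v_true_def[abs_def])

lemma peval_square_nonneg: "0 \<le> peval (q * q) x"
  by (simp add: peval_mult)

lemma core_true: "core d y_true v_true"
  unfolding core_def
proof (intro conjI ballI allI impI)
  fix \<alpha> :: "'n multiindex"
  show "real (CARD('n) + total_deg \<alpha>) * y_true \<alpha> = (\<Sum>j=1..m. wt j * v_true j \<alpha>)"
    using stokes[of \<alpha>] by (simp add: y_true_def v_true_def wt_def)
next
  fix q :: "'n rpoly"
  show "0 \<le> riesz y_true (q * q)" unfolding riesz_y_true by (intro Bochner_Integration.integral_nonneg peval_square_nonneg)
  interpret B: finite_measure "box_measure :: (real ^ 'n) measure" by (rule finite_box_measure)
  have ib: "integrable box_measure (peval (q * q))" by (intro integrable_peval integrable_box_monom)
  have "(\<integral>x. peval (q * q) x * indicator \<Omega> x \<partial>box_measure) \<le> (\<integral>x. peval (q * q) x \<partial>box_measure)"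
    by (intro integral_mono integrable_real_mult_indicator ib)
      (auto simp: peval_square_nonneg indicator_def)
  then show "riesz y_true (q * q) \<le> riesz box_moments (q * q)"
    unfolding riesz_y_true riesz_box_moments omega_le_box[OF borel_measurable_peval] .
next
  fix j and q :: "'n rpoly" assume j: "j \<in> {1..m}"
  show "0 \<le> riesz y_true ((pconst (b j) - g j) * (q * q))"
    unfolding riesz_y_true
  proof (rule integral_nonneg_AE)
    show "AE x in omega_measure. 0 \<le> peval ((pconst (b j) - g j) * (q * q)) x"
      using AE_omega
    proof eventually_elim
      case (elim x)
      then have "0 \<le> peval (pconst (b j) - g j) x" using j by (auto simp: peval_diff Omega_def)
      then show ?case unfolding peval_mult[of _ "q * q"] using peval_square_nonneg by (rule mult_nonneg_nonneg)
    qed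
  qed
next
  fix j and q :: "'n rpoly" assume j: "j \<in> {1..m}"
  show "0 \<le> riesz (v_true j) (q * q)" unfolding riesz_v_true[OF j] by (intro Bochner_Integration.integral_nonneg peval_square_nonneg)
next
  fix j and \<alpha> \<beta> :: "'n multiindex" assume j: "j \<in> {1..m}"
  have "AE x in phi j. peval ((pconst (b j) - g j) * pmonom (\<alpha> + \<beta>)) x = 0"
    using phi_AE_face[of j] by eventually_elim (simp add: peval_mult peval_diff Omega_face_def)
  then show "riesz (v_true j) ((pconst (b j) - g j) * pmonom (\<alpha> + \<beta>)) = 0"
    unfolding riesz_v_true[OF j] by (rule integral_eq_zero_AE)
next
  fix j l and q :: "'n rpoly" assume j: "j \<in> {1..m}" and l: "l \<in> {1..m}"
  show "0 \<le> riesz (v_true j) ((pconst (b l) - g l) * (q * q))"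
    unfolding riesz_v_true[OF j]
  proof (rule integral_nonneg_AE)
    show "AE x in phi j. 0 \<le> peval ((pconst (b l) - g l) * (q * q)) x"
      using phi_AE_face[of j]
    proof eventually_elim
      case (elim x)
      then have "0 \<le> peval (pconst (b l) - g l) x" using l by (auto simp: peval_diff Omega_face_def Omega_def)
      then show ?case unfolding peval_mult[of _ "q * q"] using peval_square_nonneg by (rule mult_nonneg_nonneg)
    qed
  qed
qed

text \<open>
  If \<open>g j\<close> is constant then \<open>v j\<close> has weight 0 in the linear constraint, which does not bound it.
  It vanishes nevertheless: if \<open>g j = b j\<close> then \<open>\<Omega>\<close> is empty by the gradient condition, so another
  constraint is a constant that exceeds its bound.
\<close>

lemma core_v_deg_0:
  assumes c: "core d y v" and j: "j \<in> {1..m}" and dj: "dg j = 0" and \<alpha>: "\<alpha> \<in> multiindices (2 * d)"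
  shows "v j \<alpha> = 0"
proof -
  define c0 where "c0 = Poly_Mapping.lookup (g j) 0"
  have gj: "g j = pconst c0"
    using homogeneous_0_peval(1)[of "g j"] homog[OF j] dj by (simp add: c0_def)
  obtain \<beta> \<gamma> where ab: "\<alpha> = \<beta> + \<gamma>" "\<beta> \<in> multiindices d" "\<gamma> \<in> multiindices d"
    using multiindices_double[of \<alpha> d] \<alpha> by (auto simp: multiindices_def)
  show ?thesis
  proof (cases "c0 = b j")
    case False
    have "riesz (v j) ((pconst (b j) - g j) * pmonom (\<beta> + \<gamma>)) = 0"
      using c j ab dj unfolding core_def by simp
    then have "(b j - c0) * v j \<alpha> = 0"
      unfolding gj by (simp add: single_diff[symmetric] mult_single ab(1))
    then show ?thesis using False by simp
  next
    case True
    have "\<Omega> = {}"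
    proof (rule ccontr)
      assume "\<Omega> \<noteq> {}"
      then obtain x where "x \<in> \<Omega>" by blast
      then have "x \<in> face j" using True by (simp add: Omega_face_def gj)
      then show False using face_deg_0[OF j dj] by simp
    qed
    \<comment> \<open>With \<Omega> empty, some constraint fails at the origin. A homogeneous
      polynomial of positive degree vanishes there, so the failing one is a constant.\<close>
    then obtain l where l: "l \<in> {1..m}" "b l < peval (g l) 0"
      by (force simp: Omega_def not_le)
    have dl: "dg l = 0"
    proof (rule ccontr)
      assume "dg l \<noteq> 0"
      then have "peval (g l) 0 = 0" using peval_scale[OF homog[OF l(1)], of 0 0] by (simp add: power_0_left)
      then show False using l b_pos[OF l(1)] by simp
    qed
    define cl where "cl = Poly_Mapping.lookup (g l) 0"
    have gl: "g l = pconst cl"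
      using homogeneous_0_peval(1)[of "g l"] homog[OF l(1)] dl by (simp add: cl_def)
    have cl: "b l < cl" using l(2) by (simp add: gl)
    have lj: "l \<noteq> j" using cl True gj gl by (metis less_irrefl lookup_single_eq)
    \<comment> \<open>The constraint for l multiplies by the negative constant
      \<open>b l - cl\<close>, so the diagonal entries are both nonpositive and nonnegative. A zero
      diagonal then forces all entries to vanish.\<close>
    have z: "v j (\<beta> + \<beta>) = 0" if "\<beta> \<in> multiindices d" for \<beta>
    proof -
      have k: "Poly_Mapping.keys (pmonom \<beta> :: 'n rpoly) \<subseteq> multiindices d" using that by simp
      have "0 \<le> riesz (v j) ((pconst (b l) - g l) * (pmonom \<beta> * pmonom \<beta>))"
        using c j l(1) lj k dl unfolding core_def by simp
      then have "0 \<le> (b l - cl) * v j (\<beta> + \<beta>)"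
        unfolding gl by (simp add: single_diff[symmetric] mult_single)
      moreover have "0 \<le> riesz (v j) (pmonom \<beta> * pmonom \<beta>)"
        using c j k unfolding core_def by blast
      then have "0 \<le> v j (\<beta> + \<beta>)" by (simp add: mult_single)
      ultimately show ?thesis using cl by (simp add: zero_le_mult_iff)
    qed
    have "psd_on (multiindices d) (moment_matrix (v j))"
      using c j unfolding core_def psd_on_moment_iff[OF finite_multiindices] by blast
    from psd_on_moment_entry_bound[OF this finite_multiindices ab(2,3)] show ?thesis
      using z[OF ab(2)] z[OF ab(3)] ab(1) by simp
  qed
qed

section \<open>A priori bounds and existence of optimal solutions\<close>

definition bound :: real where
  "bound = measure box_measure (UNIV :: (real ^ 'n) set)"

lemma box_moments_le: "box_moments (\<alpha> :: 'n multiindex) \<le> bound"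
proof -
  interpret finite_measure "box_measure :: (real ^ 'n) measure" by (rule finite_box_measure)
  have "(\<integral>x. monom_eval \<alpha> x \<partial>box_measure) \<le> (\<integral>x. 1 \<partial>(box_measure :: (real ^ 'n) measure))"
    by (intro integral_mono_AE integrable_box_monom)
      (use AE_box_measure monom_unit_cube_pm(2)[of _ \<alpha>] in \<open>auto elim!: eventually_mono\<close>)
  then show ?thesis by (simp add: box_moments_eq bound_def box_measure_def)
qed

text \<open>Domination by the box bounds y on squares of monomials, and semidefiniteness bounds the
  other entries by the diagonal. In the linear constraint all terms are nonnegative at squares, so
  the bound on y passes to each \<open>v j\<close> of positive weight. The bounds are uniform in d,
  as needed for the limit of the whole hierarchy.\<close>

lemma core_bounds:
  assumes c: "core d y v" and \<alpha>: "\<alpha> \<in> multiindices (2 * d)"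
  shows "\<bar>y \<alpha>\<bar> \<le> bound"
    "j \<in> {1..m} \<Longrightarrow> \<bar>v j \<alpha>\<bar> \<le> real (CARD('n) + total_deg \<alpha> + 1) * bound / wt j"
proof -
  \<comment> \<open>Splitting \<alpha> into halves of about equal degree keeps the diagonal entries
    at degree at most \<open>total_deg \<alpha> + 1\<close>, so the bound for v depends on \<alpha>
    but not on d.\<close>
  define k where "k = (total_deg \<alpha> + 1) div 2"
  have "total_deg \<alpha> \<le> 2 * k" by (simp add: k_def)
  then obtain \<beta> \<gamma> where ab: "\<alpha> = \<beta> + \<gamma>" "\<beta> \<in> multiindices k" "\<gamma> \<in> multiindices k"
    by (rule multiindices_double)
  have "k \<le> d" using \<alpha> by (auto simp: k_def multiindices_def)
  then have bd: "\<beta> \<in> multiindices d" "\<gamma> \<in> multiindices d" using ab multiindices_mono by blast+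
  have b0: "0 \<le> bound" by (simp add: bound_def)
  have y2: "y (\<delta> + \<delta>) \<le> bound" if "\<delta> \<in> multiindices d" for \<delta>
  proof -
    have "riesz y (pmonom \<delta> * pmonom \<delta>) \<le> riesz box_moments (pmonom \<delta> * pmonom \<delta>)"
      using c that unfolding core_def by simp
    then show ?thesis using box_moments_le[of "\<delta> + \<delta>"] by (simp add: mult_single)
  qed
  have "psd_on (multiindices d) (moment_matrix y)"
    using c unfolding core_def psd_on_moment_iff[OF finite_multiindices] by blast
  from psd_on_moment_entry_bound[OF this finite_multiindices bd]
  show "\<bar>y \<alpha>\<bar> \<le> bound" using y2[OF bd(1)] y2[OF bd(2)] ab(1) by simp
  assume j: "j \<in> {1..m}"
  show "\<bar>v j \<alpha>\<bar> \<le> real (CARD('n) + total_deg \<alpha> + 1) * bound / wt j"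
  proof (cases "dg j = 0")
    case True
    \<comment> \<open>For weight 0 the bound is a division by zero with value 0, and it holds
      because \<open>v j\<close> vanishes.\<close>
    then show ?thesis using core_v_deg_0[OF c j True \<alpha>] by (simp add: wt_def)
  next
    case False
    have w: "wt j > 0" using False b_pos[OF j] by (simp add: wt_def)
    have v2: "v j (\<delta> + \<delta>) \<le> real (CARD('n) + total_deg \<alpha> + 1) * bound / wt j" if \<delta>: "\<delta> \<in> multiindices k" for \<delta>
    proof -
      have \<delta>d: "\<delta> \<in> multiindices d" using \<delta> \<open>k \<le> d\<close> multiindices_mono by blast
      have nn: "0 \<le> v i (\<delta> + \<delta>)" if "i \<in> {1..m}" for i
      proof -
        have "0 \<le> riesz (v i) (pmonom \<delta> * pmonom \<delta>)" using c that \<delta>d unfolding core_def by simp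
        then show ?thesis by (simp add: mult_single)
      qed
      have deg: "total_deg (\<delta> + \<delta>) \<le> total_deg \<alpha> + 1"
        using \<delta> by (auto simp: multiindices_def total_deg_add k_def)
      have "wt j * v j (\<delta> + \<delta>) \<le> (\<Sum>i=1..m. wt i * v i (\<delta> + \<delta>))"
        using j nn wt_nonneg by (intro member_le_sum) auto
      also have "\<dots> = real (CARD('n) + total_deg (\<delta> + \<delta>)) * y (\<delta> + \<delta>)"
      proof -
        have "\<delta> + \<delta> \<in> multiindices (2 * d)" using \<delta>d by (simp add: multiindices_def total_deg_add)
        then show ?thesis using c unfolding core_def by simp
      qed
      also have "\<dots> \<le> real (CARD('n) + total_deg (\<delta> + \<delta>)) * bound"
        using y2[OF \<delta>d] by (intro mult_left_mono) auto
      also have "\<dots> \<le> real (CARD('n) + total_deg \<alpha> + 1) * bound"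
        using deg b0 by (intro mult_right_mono) auto
      finally show ?thesis using w by (simp add: field_simps)
    qed
    have "psd_on (multiindices d) (moment_matrix (v j))"
      using c j unfolding core_def psd_on_moment_iff[OF finite_multiindices] by blast
    from psd_on_moment_entry_bound[OF this finite_multiindices bd]
    have "\<bar>v j \<alpha>\<bar> \<le> (v j (\<beta> + \<beta>) + v j (\<gamma> + \<gamma>)) / 2" unfolding ab(1) .
    moreover have "a \<le> c" if "a \<le> (x + z) / 2" "x \<le> c" "z \<le> c" for a c x z :: real
    proof -
      have "(x + z) / 2 \<le> (c + c) / 2" using that(2,3) by (intro divide_right_mono add_mono) auto
      also have "\<dots> = c" by simp
      finally show ?thesis using that(1) by (rule order_trans[rotated])
    qed
    ultimately show ?thesis using v2[OF ab(2)] v2[OF ab(3)] by blast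
  qed
qed

text \<open>The limits of y and of all \<open>v j\<close> have to be taken along one filter, so
  everything is packed into one family.\<close>

lemma cluster_core:
  fixes Y :: "nat \<Rightarrow> 'n multiindex \<Rightarrow> real" and V :: "nat \<Rightarrow> nat \<Rightarrow> 'n multiindex \<Rightarrow> real"
  assumes F0: "F0 \<noteq> bot"
    and Y: "\<And>\<alpha>. \<forall>\<^sub>F k in F0. \<bar>Y k \<alpha>\<bar> \<le> A \<alpha>"
    and V: "\<And>j \<alpha>. j \<in> {1..m} \<Longrightarrow> \<forall>\<^sub>F k in F0. \<bar>V k j \<alpha>\<bar> \<le> B j \<alpha>"
  obtains F y v where "F \<noteq> bot" "F \<le> F0" "\<And>\<alpha>. ((\<lambda>k. Y k \<alpha>) \<longlongrightarrow> y \<alpha>) F"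
    "\<And>j \<alpha>. j \<in> {1..m} \<Longrightarrow> ((\<lambda>k. V k j \<alpha>) \<longlongrightarrow> v j \<alpha>) F"
proof -
  \<comment> \<open>The first index 0, being outside {1..m}, stands for y.\<close>
  define X where "X k = (\<lambda>(i, \<alpha>). if i \<in> {1..m} then V k i \<alpha> else Y k \<alpha>)" for k
  have bX: "\<forall>\<^sub>F k in F0. \<bar>X k p\<bar> \<le> (case p of (i, \<alpha>) \<Rightarrow> if i \<in> {1..m} then B i \<alpha> else A \<alpha>)" for p
    using V[of "fst p" "snd p"] Y[of "snd p"] by (cases p) (auto simp: X_def)
  obtain F l where F: "F \<noteq> bot" "F \<le> F0" "\<And>p. ((\<lambda>k. X k p) \<longlongrightarrow> l p) F"
    by (rule bounded_cluster_point[where X=X, OF F0 bX]) (rule that)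
  show thesis
  proof (rule that[OF F(1,2)])
    show "((\<lambda>k. Y k \<alpha>) \<longlongrightarrow> l (0, \<alpha>)) F" for \<alpha> using F(3)[of "(0, \<alpha>)"] by (simp add: X_def)
    show "((\<lambda>k. V k j \<alpha>) \<longlongrightarrow> l (j, \<alpha>)) F" if "j \<in> {1..m}" for j \<alpha>
      using F(3)[of "(j, \<alpha>)"] that by (simp add: X_def)
  qed
qed

text \<open>Cluster points of a maximizing sequence satisfy the closed constraints and attain the
  supremum.\<close>

lemma optimal_exists:
  assumes d: "d_min m dg \<le> d"
  shows "\<exists>y v. optimal m g dg b d y v"
proof -
  define S where "S = {y 0 | y v. core d y v}"
  have ne: "S \<noteq> {}" unfolding S_def using core_true by blast
  have "s \<le> bound" if "s \<in> S" for s
    using that core_bounds(1)[of d _ _ 0] by (force simp: S_def)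
  then have bdd: "bdd_above S" by (rule bdd_aboveI)
  have "\<exists>y v. core d y v \<and> Sup S - 1 / real (Suc k) < y 0" for k
  proof -
    have "Sup S - 1 / real (Suc k) < Sup S" by simp
    then obtain s where "s \<in> S" "Sup S - 1 / real (Suc k) < s" using less_cSup_iff[OF ne bdd] by blast
    then show ?thesis by (auto simp: S_def)
  qed
  then obtain Y V where YV: "\<And>k. core d (Y k) (V k)" "\<And>k. Sup S - 1 / real (Suc k) < Y k 0" by metis
  \<comment> \<open>The constraints do not bound entries of degree beyond 2 * d, so these are set to
    0 to obtain a family that is bounded in every entry.\<close>
  define Y' where "Y' k \<alpha> = (if \<alpha> \<in> multiindices (2 * d) then Y k \<alpha> else 0)" for k \<alpha>
  define V' where "V' k j \<alpha> = (if \<alpha> \<in> multiindices (2 * d) then V k j \<alpha> else 0)" for k j \<alpha>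
  have c': "core d (Y' k) (V' k)" for k
    by (rule core_cong[OF YV(1) d]) (auto simp: Y'_def V'_def)
  have bY: "\<forall>\<^sub>F k in sequentially. \<bar>Y' k \<alpha>\<bar> \<le> (if \<alpha> \<in> multiindices (2 * d) then bound else 0)" for \<alpha>
    using core_bounds(1)[OF YV(1)] by (simp add: Y'_def)
  have bV: "\<forall>\<^sub>F k in sequentially. \<bar>V' k j \<alpha>\<bar> \<le> (if \<alpha> \<in> multiindices (2 * d) then real (CARD('n) + total_deg \<alpha> + 1) * bound / wt j else 0)"
    if "j \<in> {1..m}" for j \<alpha>
    using core_bounds(2)[OF YV(1) _ that] by (simp add: V'_def)
  obtain F y v where F: "F \<noteq> bot" "F \<le> sequentially" "\<And>\<alpha>. ((\<lambda>k. Y' k \<alpha>) \<longlongrightarrow> y \<alpha>) F"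
    "\<And>j \<alpha>. j \<in> {1..m} \<Longrightarrow> ((\<lambda>k. V' k j \<alpha>) \<longlongrightarrow> v j \<alpha>) F"
    by (rule cluster_core[where Y=Y' and V=V', OF sequentially_bot bY bV]) (assumption, rule that)
  have c: "core d y v"
    by (rule core_limit[where Y=Y' and V=V', OF F(1) _ d F(3,4)]) (use c' in auto)
  have le: "Sup S \<le> y 0"
  proof (rule tendsto_le[OF F(1) F(3)])
    have "(\<lambda>k. Sup S - 1 / real (Suc k)) \<longlonglongrightarrow> Sup S - 0"
      by (intro tendsto_intros LIMSEQ_Suc[OF lim_1_over_n])
    then show "((\<lambda>k. Sup S - 1 / real (Suc k)) \<longlongrightarrow> Sup S) F"
      using F(2) by (auto intro: filterlim_mono)
    show "\<forall>\<^sub>F k in F. Sup S - 1 / real (Suc k) \<le> Y' k 0"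
      using YV(2) by (intro always_eventually allI) (simp add: Y'_def less_imp_le)
  qed
  have ub: "y' 0 \<le> Sup S" if "feasible m g dg b d y' v'" for y' v'
    using that bdd by (intro cSup_upper) (auto simp: S_def feasible_iff_core)
  have "optimal m g dg b d (restrict y (multiindices (2 * d))) (\<lambda>j\<in>{1..m}. restrict (v j) (multiindices (2 * d)))"
    unfolding optimal_def
  proof (intro conjI allI impI feasible_restrict[OF c d])
    fix y' v' assume "feasible m g dg b d y' v'"
    from order_trans[OF ub[OF this] le] show "y' 0 \<le> restrict y (multiindices (2 * d)) 0" by simp
  qed
  then show ?thesis by blast
qed

text \<open>A solution of higher order, cut off at degree 2 * d, is feasible at order d; hence the
  optimal values decrease.\<close>

lemma optimal_core:
  assumes "optimal m g dg b d y v" "d_min m dg \<le> d"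
  shows "core d y v" "\<And>d' y' v'. core d' y' v' \<Longrightarrow> d \<le> d' \<Longrightarrow> y' 0 \<le> y 0"
proof -
  show "core d y v" using assms by (simp add: optimal_def feasible_iff_core)
  fix d' y' v' assume "core d' y' v'" "d \<le> d'"
  then have "feasible m g dg b d (restrict y' (multiindices (2 * d))) (\<lambda>j\<in>{1..m}. restrict (v' j) (multiindices (2 * d)))"
    using core_mono feasible_restrict assms(2) by blast
  then have "restrict y' (multiindices (2 * d)) 0 \<le> y 0" using assms(1) unfolding optimal_def by blast
  then show "y' 0 \<le> y 0" by simp
qed

text \<open>Every polynomial is admissible at a sufficiently high order, so the constraints at all
  orders supply the hypotheses of the two uniqueness lemmas without any restriction on the
  degree.\<close>

lemma core_all_unique:
  assumes c: "\<And>d. core d y v" and vol: "y_true 0 \<le> y 0"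
  shows "y = y_true" "\<And>j. j \<in> {1..m} \<Longrightarrow> v j = v_true j"
proof -
  have K: "\<exists>d. Poly_Mapping.keys q \<subseteq> multiindices d" for q :: "'n rpoly"
  proof -
    have "total_deg \<alpha> \<le> Max (total_deg ` Poly_Mapping.keys q)" if "\<alpha> \<in> Poly_Mapping.keys q" for \<alpha>
      using that by (intro Max_ge) auto
    then show ?thesis by (intro exI[of _ "Max (total_deg ` Poly_Mapping.keys q)"]) (auto simp: multiindices_def)
  qed
  have sy: "0 \<le> riesz y (q * q)" "riesz y (q * q) \<le> riesz box_moments (q * q)" for q :: "'n rpoly"
  proof -
    obtain d where "Poly_Mapping.keys q \<subseteq> multiindices d" using K by blast
    then show "0 \<le> riesz y (q * q)" "riesz y (q * q) \<le> riesz box_moments (q * q)"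
      using c[of d] unfolding core_def by blast+
  qed
  have ly: "0 \<le> riesz y ((pconst (b j) - g j) * (q * q))" if j: "j \<in> {1..m}" for j q
  proof -
    obtain d where "Poly_Mapping.keys q \<subseteq> multiindices d" using K by blast
    then have "Poly_Mapping.keys q \<subseteq> multiindices (d + half_deg (dg j) - half_deg (dg j))" by simp
    then show ?thesis using c[of "d + half_deg (dg j)"] j unfolding core_def by blast
  qed
  show y: "y = y_true"
  proof
    fix \<alpha>
    show "y \<alpha> = y_true \<alpha>"
      unfolding y_true_def by (rule limit_y_unique[OF sy ly]) (use vol in \<open>auto simp: y_true_def\<close>)
  qed
  fix i assume i: "i \<in> {1..m}"
  show "v i = v_true i"
  proof
    fix \<alpha>
    show "v i \<alpha> = v_true i \<alpha>"
      unfolding v_true_def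
    proof (rule limit_v_unique[OF _ _ _ _ i])
      fix j and q :: "'n rpoly" assume j: "j \<in> {1..m}"
      obtain d where "Poly_Mapping.keys q \<subseteq> multiindices d" using K by blast
      then show "0 \<le> riesz (v j) (q * q)" using c[of d] j unfolding core_def by blast
    next
      fix j and p :: "'n rpoly" assume j: "j \<in> {1..m}"
      have m1: "riesz (v j) ((pconst (b j) - g j) * pmonom \<alpha>) = 0" for \<alpha>
      proof -
        have "\<alpha> \<in> multiindices (total_deg \<alpha> + half_deg (dg j) - half_deg (dg j))"
          by (simp add: multiindices_def)
        moreover have "0 \<in> multiindices (total_deg \<alpha> + half_deg (dg j) - half_deg (dg j))" by simp
        ultimately have "riesz (v j) ((pconst (b j) - g j) * pmonom (\<alpha> + 0)) = 0"
          using c[of "total_deg \<alpha> + half_deg (dg j)"] j unfolding core_def by blast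
        then show ?thesis by simp
      qed
      have "(pconst (b j) - g j) * p = (\<Sum>\<alpha>\<in>Poly_Mapping.keys p. (pconst (b j) - g j) * Poly_Mapping.single \<alpha> (Poly_Mapping.lookup p \<alpha>))"
        unfolding sum_distrib_left[symmetric] by (subst poly_mapping_sum_singles[of "Poly_Mapping.keys p" p, symmetric]) auto
      then show "riesz (v j) ((pconst (b j) - g j) * p) = 0"
        by (simp only: riesz_sum riesz_single_mult[of _ _ _ "Poly_Mapping.lookup p _"] m1) simp
    next
      fix \<alpha> :: "'n multiindex"
      have "\<alpha> \<in> multiindices (2 * total_deg \<alpha>)" by (simp add: multiindices_def)
      then show "(\<Sum>j=1..m. wt j * v j \<alpha>) = (\<Sum>j=1..m. wt j * (\<integral>x. monom_eval \<alpha> x \<partial>phi j))"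
        using c[of "total_deg \<alpha>"] stokes[of \<alpha>] unfolding core_def y by (simp add: y_true_def wt_def)
    next
      fix j and \<alpha> :: "'n multiindex" assume "j \<in> {1..m}" "dg j = 0"
      then show "v j \<alpha> = 0"
        by (intro core_v_deg_0[OF c[of "total_deg \<alpha>"]]) (auto simp: multiindices_def)
    qed
  qed
qed

lemma optimal_cluster:
  assumes opt: "\<And>d. d_min m dg \<le> d \<Longrightarrow> optimal m g dg b d (y d) (v d)"
    and F0: "F0 \<noteq> bot" "F0 \<le> sequentially"
  obtains F where "F \<noteq> bot" "F \<le> F0" "\<And>\<alpha>. ((\<lambda>d. y d \<alpha>) \<longlongrightarrow> y_true \<alpha>) F"
    "\<And>j \<alpha>. j \<in> {1..m} \<Longrightarrow> ((\<lambda>d. v d j \<alpha>) \<longlongrightarrow> v_true j \<alpha>) F"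
proof -
  have core: "core d (y d) (v d)" if "d_min m dg \<le> d" for d
    using optimal_core(1)[OF opt[OF that] that] .
  have ev: "\<forall>\<^sub>F d in F0. d0 \<le> d" for d0
    using F0(2) eventually_ge_at_top filter_leD by blast
  have mi: "\<alpha> \<in> multiindices (2 * d)" if "total_deg \<alpha> \<le> d" for \<alpha> :: "'n multiindex" and d
    using that by (simp add: multiindices_def)
  have bY: "\<forall>\<^sub>F d in F0. \<bar>y d \<alpha>\<bar> \<le> bound" for \<alpha>
    using ev[of "max (d_min m dg) (total_deg \<alpha>)"]
    by (rule eventually_mono) (auto intro!: core_bounds(1)[OF core mi])
  have bV: "\<forall>\<^sub>F d in F0. \<bar>v d j \<alpha>\<bar> \<le> real (CARD('n) + total_deg \<alpha> + 1) * bound / wt j" if "j \<in> {1..m}" for j \<alpha>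
    using ev[of "max (d_min m dg) (total_deg \<alpha>)"]
    by (rule eventually_mono) (use that in \<open>intro core_bounds(2)[OF core mi]; simp\<close>)
  obtain F y' v' where F: "F \<noteq> bot" "F \<le> F0" "\<And>\<alpha>. ((\<lambda>k. y k \<alpha>) \<longlongrightarrow> y' \<alpha>) F"
    "\<And>j \<alpha>. j \<in> {1..m} \<Longrightarrow> ((\<lambda>k. v k j \<alpha>) \<longlongrightarrow> v' j \<alpha>) F"
    by (rule cluster_core[where Y=y and V=v, OF F0(1) bY bV]) (assumption, rule that)
  have evF: "\<forall>\<^sub>F d in F. d0 \<le> d" for d0 using ev F(2) filter_leD by blast
  \<comment> \<open>At a fixed order only a tail of the optimal solutions is feasible, and
    \<open>core_limit\<close> asks for order at least \<open>d_min\<close>; smaller orders follow by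
    \<open>core_mono\<close>.\<close>
  have c': "core (max d (d_min m dg)) y' v'" for d
  proof (rule core_limit[OF F(1) _ _ F(3,4)])
    show "\<forall>\<^sub>F k in F. core (max d (d_min m dg)) (y k) (v k)"
      using evF[of "max d (d_min m dg)"] by (rule eventually_mono) (auto intro: core_mono[OF core])
  qed auto
  have c: "core d y' v'" for d by (rule core_mono[OF c'[of d]]) simp
  \<comment> \<open>The true moments compete at every order, so each optimal value is at least the
    volume, and so is the limit.\<close>
  have "y_true 0 \<le> y' 0"
  proof (rule tendsto_lowerbound[OF F(3) _ F(1)])
    show "\<forall>\<^sub>F d in F. y_true 0 \<le> y d 0"
      using evF[of "d_min m dg"] by (rule eventually_mono) (use optimal_core(2)[OF opt _ core_true] in blast)
  qed
  from core_all_unique[OF c this] show thesis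
    using F by (intro that[of F]) auto
qed

text \<open>Every proper filter below \<open>sequentially\<close> has a finer one along which the
  solutions converge, always to the true moments; this forces convergence of the whole
  sequence.\<close>

theorem optimal_limits:
  assumes opt: "\<And>d. d_min m dg \<le> d \<Longrightarrow> optimal m g dg b d (y d) (v d)"
  shows "(\<lambda>d. y d \<alpha>) \<longlonglongrightarrow> (LINT x:\<Omega>|lebesgue. monom_eval \<alpha> x)"
    and "j \<in> {1..m} \<Longrightarrow> (\<lambda>d. v d j \<alpha>) \<longlonglongrightarrow> (LINT x|phi_measure m g b j. monom_eval \<alpha> x)"
    and "antimono_on {d_min m dg..} (\<lambda>d. y d 0)"
    and "(\<lambda>d. y d 0) \<longlonglongrightarrow> measure lebesgue \<Omega>"
proof -
  show y: "(\<lambda>d. y d \<alpha>) \<longlonglongrightarrow> (LINT x:\<Omega>|lebesgue. monom_eval \<alpha> x)" for \<alpha>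
    unfolding omega_moment y_true_def[symmetric]
  proof (rule tendsto_by_cluster)
    fix F0 :: "nat filter" assume F0: "F0 \<noteq> bot" "F0 \<le> sequentially"
    show "\<exists>F. F \<noteq> bot \<and> F \<le> F0 \<and> ((\<lambda>d. y d \<alpha>) \<longlongrightarrow> y_true \<alpha>) F"
      by (rule optimal_cluster[where y=y and v=v, OF opt F0]) blast+
  qed
  show "(\<lambda>d. v d j \<alpha>) \<longlonglongrightarrow> (LINT x|phi_measure m g b j. monom_eval \<alpha> x)" if "j \<in> {1..m}"
    unfolding integral_phi_measure[OF that borel_measurable_monom_eval] v_true_def[symmetric]
  proof (rule tendsto_by_cluster)
    fix F0 :: "nat filter" assume F0: "F0 \<noteq> bot" "F0 \<le> sequentially"
    show "\<exists>F. F \<noteq> bot \<and> F \<le> F0 \<and> ((\<lambda>d. v d j \<alpha>) \<longlongrightarrow> v_true j \<alpha>) F"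
      by (rule optimal_cluster[where y=y and v=v, OF opt F0]) (use that in blast)+
  qed
  show "antimono_on {d_min m dg..} (\<lambda>d. y d 0)"
  proof (rule monotone_onI)
    fix d d' assume "d \<in> {d_min m dg..}" "d' \<in> {d_min m dg..}" "d \<le> d'"
    then show "y d' 0 \<le> y d 0"
      using optimal_core(2)[OF opt _ optimal_core(1)[OF opt]] by simp
  qed
  have "\<Omega> \<in> sets lebesgue" using Omega_borel by simp
  then have "(LINT x:\<Omega>|lebesgue. monom_eval 0 x) = measure lebesgue \<Omega>"
    by (simp add: set_lebesgue_integral_def)
  then show "(\<lambda>d. y d 0) \<longlonglongrightarrow> measure lebesgue \<Omega>" using y[of 0] by simp
qed

end

theorem theorem3p4:
  fixes m :: nat
    and g :: "nat \<Rightarrow> 'n::finite rpoly"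
    and dg :: "nat \<Rightarrow> nat"
    and b :: "nat \<Rightarrow> real"
  assumes homog: "\<And>j. j \<in> {1..m} \<Longrightarrow> homogeneous (dg j) (g j)"
    and b_pos: "\<And>j. j \<in> {1..m} \<Longrightarrow> 0 < b j"
    and Omega_compact: "compact (Omega m g b)"
    and Omega_box: "Omega m g b \<subseteq> open_box"
    and grad: "\<And>j x. j \<in> {1..m} \<Longrightarrow> x \<in> Omega_face m g b j \<Longrightarrow> gradient (peval (g j)) x \<noteq> 0"
    and null: "\<And>j k. j \<in> {1..m} \<Longrightarrow> k \<in> {1..m} \<Longrightarrow> k \<noteq> j \<Longrightarrow>
        emeasure (face_measure m g b j)
          {x \<in> space (face_measure m g b j). peval (g k) x = b k} = 0"
  shows "(\<forall>d\<ge>d_min m dg. \<exists>y v. optimal m g dg b d y v) \<and>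
    (\<forall>y v. (\<forall>d\<ge>d_min m dg. optimal m g dg b d (y d) (v d)) \<longrightarrow>
      (\<forall>\<alpha>. (\<lambda>d. y d \<alpha>) \<longlonglongrightarrow> (LINT x:Omega m g b|lebesgue. monom_eval \<alpha> x)) \<and>
      (\<forall>j\<in>{1..m}. \<forall>\<alpha>. (\<lambda>d. v d j \<alpha>) \<longlonglongrightarrow> (LINT x|phi_measure m g b j. monom_eval \<alpha> x)) \<and>
      antimono_on {d_min m dg..} (\<lambda>d. y d 0) \<and>
      (\<lambda>d. y d 0) \<longlonglongrightarrow> measure lebesgue (Omega m g b))"
proof -
  interpret homogeneous_semialgebraic m g dg b
    by (rule homogeneous_semialgebraic.intro) (fact homog b_pos Omega_compact Omega_box grad null)+
  show ?thesis
    using optimal_exists optimal_limits by (intro conjI allI impI ballI) blast+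
qed

end
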